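(* Let $L$ be a flat linear structure (linear connection) on $TM$, i.e. $L$ has no torsion and all curvature forms of $DL$ vanish. Then all linear structures $D^kL$, $k\in\mathbb{N}$, on $T^{k+2}M$ are totally symmetric and invariant under all shifts.
   Context: $\mathbb{K}$ is a commutative unital Hausdorff topological ring with open dense unit group and continuous inversion; topological modules are Hausdorff. A map $f:V\supset U\to W$ is $C^1$ if there is a continuous $f^{[1]}$ on $\{(x,v,t)\in U\times V\times\mathbb{K}:x+tv\in U\}$ with $f(x+tv)-f(x)=tf^{[1]}(x,v,t)$; $df(x)v=f^{[1]}(x,v,0)$; $C^{j+1}$ means $C^1$ with $f^{[1]}$ of class $C^j$; smooth means $C^j$ for all $j$. Manifolds and tangent bundles are defined by charts; $M$ is modelled on $V$; everything is smooth. Coordinates. $T^{N+1}M$ is built with units $\varepsilon_0,\varepsilon_1,\dots,\varepsilon_N$ (in this order); in a chart over $U\subset V$ its points are $x+\sum_{0\ne\alpha\in\{0,1\}^{N+1}}\varepsilon^\alpha v_\alpha$, $\alpha=(\alpha_0,\dots,\alpha_N)$, $\varepsilon^\alpha=\prod\varepsilon_i^{\alpha_i}$, $v_\alpha\in V$. Put $A^{N+1}M=\bigoplus_{\alpha\neq0}\varepsilon^\alpha TM$ (direct sum over $M$ of copies of $TM$). The symmetric group $\Sigma_{N+1}$ acts on $T^{N+1}M$ and on $A^{N+1}M$ by permuting $\varepsilon_0,\dots,\varepsilon_N$. For $i\ne j$ in $\{0,\dots,N\}$ the shift $S_{ij}:T^{N+1}M\to T^{N+1}M$ is given in charts by $$S_{ij}\Big(x+\sum_\alpha\varepsilon^\alpha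 v_\alpha\Big)=x+\sum_{\alpha_i=0}\varepsilon^\alpha v_\alpha+\sum_{\alpha_i=1,\ \alpha_j=0}\varepsilon^{\alpha+e_j}v_\alpha$$ (all these maps are chart-independent). A linear connection $L$ on $TM$ is a smooth family of $\mathbb{K}$-module structures on the fibers of $TTM\to M$ such that in each chart there are bilinear maps $b_x:V\times V\to V$ (Christoffel tensor, smooth in all variables) such that the structure on $(TTM)_x=V\times V\times V$ is the push-forward of the chart's linear structure under $(u,v,w)\mapsto(u,v,w+b_x(u,v))$. Its splitting map is $\Phi_1:A^2M\to T^2M$, $\Phi_1(x;\varepsilon_0u,\varepsilon_1v,\varepsilon_0\varepsilon_1w)=x+\varepsilon_0u+\varepsilon_1v+\varepsilon_0\varepsilon_1(w+b_x(u,v))$. $L$ is torsionfree if all $b_x$ are symmetric. Derived structures. Given $\Phi_N:A^{N+1}M\to T^{N+1}M$, define $\Phi_{N+1}=D\Phi_N:A^{N+2}M\to T^{N+2}M$ in charts by $$\Phi_{N+1}\big(x;(v_\beta)_\beta\big)=T\Phi_N\Big(x+\varepsilon_{N+1}v_{e}+\sum_{\alpha\neq0,\ \alpha_{N+1}=0}\varepsilon^\alpha\big(v_\alpha+\varepsilon_{N+1}(v_{\alpha+e}+b_x(v_\alpha,v_{e}))\big)\Big),$$ where $T\Phi_N$ is the tangent map with respect to $\varepsilon_{N+1}$ and $e=e_{N+1}$ is the multi-index with $\varepsilon^e=\varepsilon_{N+1}$ (chart-independent). $D^kL$ is the linear structure on the fibers of $T^{k+2}M\to M$ obtained by push-forward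 under $\Phi_{k+1}$ of the linear structure of $A^{k+2}M$. The curvature operators of $DL$ are $R^{\sigma}=\sigma\circ\Phi_2\circ\sigma^{-1}\circ\Phi_2^{-1}:T^3M\to T^3M$, $\sigma\in\Sigma_3$; the curvature forms are their non-trivial multilinear components, so that all curvature forms vanish if and only if $R^\sigma=\mathrm{id}$ for all $\sigma\in\Sigma_3$. A linear structure on $T^{k+2}M\to M$ is totally symmetric if every $\sigma\in\Sigma_{k+2}$ acts fiberwise linearly with respect to it, and invariant under all shifts if every $S_{ij}$ ($i\neq j$) acts fiberwise linearly with respect to it. *)

theory Defs
  imports "HOL-Analysis.Analysis" "HOL-Combinatorics.Permutations"
begin

section \<open>Base rings and topological modules\<close>

class base_ring = comm_ring_1 + topological_ab_group_add + topological_semigroup_mult + t2_space +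
  assumes open_units: "open {x. x dvd 1}"
    and dense_units: "open S \<Longrightarrow> S \<noteq> {} \<Longrightarrow> \<exists>x\<in>S. x dvd 1"
    and continuous_inversion:
      "\<exists>i. \<forall>x. x dvd 1 \<longrightarrow> x * i x = 1 \<and> (i \<longlongrightarrow> i x) (at x within {y. y dvd 1})"

locale topological_module = module sc
  for sc :: "'k::base_ring \<Rightarrow> 'v::{topological_ab_group_add,t2_space} \<Rightarrow> 'v" +
  assumes continuous_scale: "continuous_on UNIV (\<lambda>(t, v). sc t v)"

text \<open>
  The recursion defining \<open>C\<^sup>j\<close> maps passes from a module \<open>E\<close> to \<open>E \<times> E \<times> K\<close>, so it
  changes the type of the domain.  To have all modules built from \<open>V\<close> and \<open>K\<close> by finite products
  in a single type, their points are binary trees with leaves in \<open>V\<close> or \<open>K\<close>.  Such a module is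
  given by its topology, whose underlying space is its set of points; its operations are the
  restrictions of leafwise operations, and these are only meaningful on trees of the same shape.
\<close>

datatype ('k, 'v) tm = Vec (vec_of: 'v) | Scal (scal_of: 'k)
  | Pair (first: "('k, 'v) tm") (second: "('k, 'v) tm")

instantiation tm :: (plus, plus) plus
begin
fun plus_tm :: "('a, 'b) tm \<Rightarrow> ('a, 'b) tm \<Rightarrow> ('a, 'b) tm" where
  "plus_tm (Vec u) (Vec v) = Vec (u + v)"
| "plus_tm (Scal s) (Scal t) = Scal (s + t)"
| "plus_tm (Pair p q) (Pair p' q') = Pair (plus_tm p p') (plus_tm q q')"
| "plus_tm _ _ = undefined"
instance ..
end

instantiation tm :: (minus, minus) minus
begin
fun minus_tm :: "('a, 'b) tm \<Rightarrow> ('a, 'b) tm \<Rightarrow> ('a, 'b) tm" where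
  "minus_tm (Vec u) (Vec v) = Vec (u - v)"
| "minus_tm (Scal s) (Scal t) = Scal (s - t)"
| "minus_tm (Pair p q) (Pair p' q') = Pair (minus_tm p p') (minus_tm q q')"
| "minus_tm _ _ = undefined"
instance ..
end

primrec tm_scale :: "('k::times \<Rightarrow> 'v \<Rightarrow> 'v) \<Rightarrow> 'k \<Rightarrow> ('k, 'v) tm \<Rightarrow> ('k, 'v) tm" where
  "tm_scale sc t (Vec v) = Vec (sc t v)"
| "tm_scale sc t (Scal s) = Scal (t * s)"
| "tm_scale sc t (Pair p q) = Pair (tm_scale sc t p) (tm_scale sc t q)"

definition vec_space :: "('k, 'v::topological_space) tm topology" where
  "vec_space = pullback_topology (range Vec) vec_of euclidean"

definition scal_space :: "('k::topological_space, 'v) tm topology" where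
  "scal_space = pullback_topology (range Scal) scal_of euclidean"

definition pair_space ::
  "('k, 'v) tm topology \<Rightarrow> ('k, 'v) tm topology \<Rightarrow> ('k, 'v) tm topology" where
  "pair_space E F = pullback_topology {Pair p q |p q. p \<in> topspace E \<and> q \<in> topspace F}
     (\<lambda>z. (first z, second z)) (prod_topology E F)"


section \<open>Differential calculus\<close>

definition ext_space :: "('k::topological_space, 'v) tm topology \<Rightarrow> ('k, 'v) tm topology" where
  "ext_space E = pair_space E (pair_space E scal_space)"

definition ext_dom ::
  "('k::base_ring \<Rightarrow> 'v::plus \<Rightarrow> 'v) \<Rightarrow> ('k, 'v) tm topology \<Rightarrow> ('k, 'v) tm set \<Rightarrow> ('k, 'v) tm set" where
  "ext_dom sc E U =
     {Pair x (Pair v (Scal t)) |x v t. x \<in> U \<and> v \<in> topspace E \<and> x + tm_scale sc t v \<in> U}"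

definition difference_factor ::
  "('k::base_ring \<Rightarrow> 'v::{plus,minus} \<Rightarrow> 'v) \<Rightarrow> ('k, 'v) tm topology \<Rightarrow> ('k, 'v) tm topology \<Rightarrow>
   ('k, 'v) tm set \<Rightarrow> (('k, 'v) tm \<Rightarrow> ('k, 'v) tm) \<Rightarrow> (('k, 'v) tm \<Rightarrow> ('k, 'v) tm) \<Rightarrow> bool" where
  "difference_factor sc E F U f g \<longleftrightarrow>
     continuous_map (subtopology (ext_space E) (ext_dom sc E U)) F g \<and>
     (\<forall>x v t. Pair x (Pair v (Scal t)) \<in> ext_dom sc E U \<longrightarrow>
        f (x + tm_scale sc t v) - f x = tm_scale sc t (g (Pair x (Pair v (Scal t)))))"

text \<open>\<open>C_class j sc E F U f\<close>: the map \<open>f\<close> from the open subset \<open>U\<close> of \<open>E\<close> to \<open>F\<close> is \<open>C\<^sup>j\<close>.\<close>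

primrec C_class ::
  "nat \<Rightarrow> ('k::base_ring \<Rightarrow> 'v::{plus,minus} \<Rightarrow> 'v) \<Rightarrow> ('k, 'v) tm topology \<Rightarrow> ('k, 'v) tm topology \<Rightarrow>
   ('k, 'v) tm set \<Rightarrow> (('k, 'v) tm \<Rightarrow> ('k, 'v) tm) \<Rightarrow> bool" where
  "C_class 0 sc E F U f \<longleftrightarrow> continuous_map (subtopology E U) F f"
| "C_class (Suc j) sc E F U f \<longleftrightarrow>
     (\<exists>g. difference_factor sc E F U f g \<and> C_class j sc (ext_space E) F (ext_dom sc E U) g)"

definition smooth ::
  "('k::base_ring \<Rightarrow> 'v::{plus,minus} \<Rightarrow> 'v) \<Rightarrow> ('k, 'v) tm topology \<Rightarrow> ('k, 'v) tm topology \<Rightarrow>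
   ('k, 'v) tm set \<Rightarrow> (('k, 'v) tm \<Rightarrow> ('k, 'v) tm) \<Rightarrow> bool" where
  "smooth sc E F U f \<longleftrightarrow> (\<forall>j. C_class j sc E F U f)"

text \<open>
  If \<open>U\<close> is open, the continuous factor is unique on \<open>ext_dom sc E U\<close> because the units of \<open>K\<close>
  are dense and all modules are Hausdorff.
\<close>

definition differential ::
  "('k::base_ring \<Rightarrow> 'v::{plus,minus} \<Rightarrow> 'v) \<Rightarrow> ('k, 'v) tm topology \<Rightarrow> ('k, 'v) tm topology \<Rightarrow>
   ('k, 'v) tm set \<Rightarrow> (('k, 'v) tm \<Rightarrow> ('k, 'v) tm) \<Rightarrow> ('k, 'v) tm \<Rightarrow> ('k, 'v) tm \<Rightarrow> ('k, 'v) tm" where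
  "differential sc E F U f x v = (SOME g. difference_factor sc E F U f g) (Pair x (Pair v (Scal 0)))"

text \<open>\<open>Pair x v\<close> stands for \<open>x + \<epsilon> v\<close>.\<close>

definition tangent_map ::
  "('k::base_ring \<Rightarrow> 'v::{plus,minus} \<Rightarrow> 'v) \<Rightarrow> ('k, 'v) tm topology \<Rightarrow> ('k, 'v) tm topology \<Rightarrow>
   ('k, 'v) tm set \<Rightarrow> (('k, 'v) tm \<Rightarrow> ('k, 'v) tm) \<Rightarrow> ('k, 'v) tm \<Rightarrow> ('k, 'v) tm" where
  "tangent_map sc E F U f p =
     Pair (f (first p)) (differential sc E F U f (first p) (second p))"


section \<open>Iterated tangent spaces in a chart\<close>

text \<open>
  \<open>T\<^sup>n\<close> has the units \<open>\<epsilon>\<^sub>0, \<dots>, \<epsilon>\<^bsub>n-1\<^esub>\<close>, and the outermost pairing of a point belongs to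
  \<open>\<epsilon>\<^bsub>n-1\<^esub>\<close>.  A multi-index is the finite set of the positions of its ones, a subset of \<open>{..<n}\<close>.
  Thus \<open>tcoord n p \<alpha>\<close> is the coefficient of \<open>\<epsilon>\<^sup>\<alpha>\<close> in \<open>p\<close>, the base point being the coefficient of
  the empty set, and \<open>tpoint n v\<close> is the point with coefficients \<open>v \<alpha>\<close>.
\<close>

primrec tspace :: "nat \<Rightarrow> ('k, 'v::topological_space) tm topology" where
  "tspace 0 = vec_space"
| "tspace (Suc n) = pair_space (tspace n) (tspace n)"

primrec tset :: "nat \<Rightarrow> 'v::topological_space set \<Rightarrow> ('k, 'v) tm set" where
  "tset 0 U = Vec ` U"
| "tset (Suc n) U = {Pair p q |p q. p \<in> tset n U \<and> q \<in> topspace (tspace n)}"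

primrec tcoord :: "nat \<Rightarrow> ('k, 'v) tm \<Rightarrow> nat set \<Rightarrow> 'v" where
  "tcoord 0 p \<alpha> = vec_of p"
| "tcoord (Suc n) p \<alpha> = (if n \<in> \<alpha> then tcoord n (second p) \<alpha> else tcoord n (first p) \<alpha>)"

primrec tpoint :: "nat \<Rightarrow> (nat set \<Rightarrow> 'v) \<Rightarrow> ('k, 'v) tm" where
  "tpoint 0 v = Vec (v {})"
| "tpoint (Suc n) v = Pair (tpoint n v) (tpoint n (\<lambda>\<alpha>. v (insert n \<alpha>)))"

primrec tmap ::
  "nat \<Rightarrow> ('k::base_ring \<Rightarrow> 'v::{plus,minus,topological_space} \<Rightarrow> 'v) \<Rightarrow> 'v set \<Rightarrow> ('v \<Rightarrow> 'v) \<Rightarrow>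
   ('k, 'v) tm \<Rightarrow> ('k, 'v) tm" where
  "tmap 0 sc U f = (\<lambda>p. Vec (f (vec_of p)))"
| "tmap (Suc n) sc U f = tangent_map sc (tspace n) (tspace n) (tset n U) (tmap n sc U f)"

definition perm_chart :: "nat \<Rightarrow> (nat \<Rightarrow> nat) \<Rightarrow> ('k, 'v) tm \<Rightarrow> ('k, 'v) tm" where
  "perm_chart n \<sigma> p = tpoint n (\<lambda>\<beta>. tcoord n p (inv \<sigma> ` \<beta>))"

text \<open>
  For \<open>i \<in> \<beta>\<close>, only \<open>\<alpha> = \<beta> - {j}\<close> can contribute to the coefficient of \<open>\<epsilon>\<^sup>\<beta>\<close> in the shifted
  point, and it does so only if \<open>j \<in> \<beta>\<close>.
\<close>

definition shift_chart :: "nat \<Rightarrow> nat \<Rightarrow> nat \<Rightarrow> ('k, 'v::zero) tm \<Rightarrow> ('k, 'v) tm" where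
  "shift_chart n i j p = tpoint n (\<lambda>\<beta>.
     if i \<notin> \<beta> then tcoord n p \<beta> else if j \<in> \<beta> then tcoord n p (\<beta> - {j}) else 0)"

text \<open>
  Over a chart, \<open>A\<^sup>nM\<close> and \<open>T\<^sup>nM\<close> have the same coordinates \<open>(x, (v\<^sub>\<alpha>)\<^sub>\<alpha>)\<close>; in both cases they
  are the points of \<open>tset n U\<close>.  \<open>Phi_chart k sc U b\<close> is the chart expression
  \<open>A\<^bsup>k+2\<^esup>U \<rightarrow> T\<^bsup>k+2\<^esup>U\<close> of the map \<open>\<Phi>\<^bsub>k+1\<^esub>\<close>; the recursion starts with the splitting map
  \<open>\<Phi>\<^sub>1\<close>, and the unit added in the step from \<open>k\<close> to \<open>Suc k\<close> has position \<open>k + 2\<close>.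
\<close>

primrec Phi_chart ::
  "nat \<Rightarrow> ('k::base_ring \<Rightarrow> 'v::{plus,minus,topological_space} \<Rightarrow> 'v) \<Rightarrow> 'v set \<Rightarrow>
   ('v \<Rightarrow> 'v \<Rightarrow> 'v \<Rightarrow> 'v) \<Rightarrow> ('k, 'v) tm \<Rightarrow> ('k, 'v) tm" where
  "Phi_chart 0 sc U b = (\<lambda>p. tpoint 2 (\<lambda>\<alpha>.
     if \<alpha> = {0, 1} then tcoord 2 p {0, 1} + b (tcoord 2 p {}) (tcoord 2 p {0}) (tcoord 2 p {1})
     else tcoord 2 p \<alpha>))"
| "Phi_chart (Suc k) sc U b = (\<lambda>p.
     tangent_map sc (tspace (k + 2)) (tspace (k + 2)) (tset (k + 2) U) (Phi_chart k sc U b)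
       (tpoint (k + 3) (\<lambda>\<beta>.
          if k + 2 \<in> \<beta> \<and> \<beta> \<noteq> {k + 2}
          then tcoord (k + 3) p \<beta>
               + b (tcoord (k + 3) p {}) (tcoord (k + 3) p (\<beta> - {k + 2})) (tcoord (k + 3) p {k + 2})
          else tcoord (k + 3) p \<beta>)))"


section \<open>Linear structures\<close>

record ('k, 'p) lin_struct =
  ladd :: "'p \<Rightarrow> 'p \<Rightarrow> 'p"
  lscale :: "'k \<Rightarrow> 'p \<Rightarrow> 'p"

definition push_forward ::
  "('p \<Rightarrow> 'p) \<Rightarrow> ('p \<Rightarrow> 'p) \<Rightarrow> ('k, 'p) lin_struct \<Rightarrow> ('k, 'p) lin_struct" where
  "push_forward F F_inv S =
     \<lparr>ladd = (\<lambda>p q. F (ladd S (F_inv p) (F_inv q))), lscale = (\<lambda>t p. F (lscale S t (F_inv p)))\<rparr>"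

definition is_module_on :: "'p set \<Rightarrow> ('k::comm_ring_1, 'p) lin_struct \<Rightarrow> bool" where
  "is_module_on S L \<longleftrightarrow>
     (\<forall>p\<in>S. \<forall>q\<in>S. ladd L p q \<in> S \<and> ladd L p q = ladd L q p) \<and>
     (\<forall>p\<in>S. \<forall>q\<in>S. \<forall>r\<in>S. ladd L (ladd L p q) r = ladd L p (ladd L q r)) \<and>
     (\<exists>z\<in>S. \<forall>p\<in>S. ladd L z p = p \<and> (\<exists>q\<in>S. ladd L p q = z)) \<and>
     (\<forall>t. \<forall>p\<in>S. lscale L t p \<in> S) \<and>
     (\<forall>p\<in>S. lscale L 1 p = p) \<and>
     (\<forall>s t. \<forall>p\<in>S. lscale L s (lscale L t p) = lscale L (s * t) p) \<and>
     (\<forall>s t. \<forall>p\<in>S. lscale L (s + t) p = ladd L (lscale L s p) (lscale L t p)) \<and>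
     (\<forall>t. \<forall>p\<in>S. \<forall>q\<in>S. lscale L t (ladd L p q) = ladd L (lscale L t p) (lscale L t q))"

text \<open>The linear structure of a chart on the fibers: the base point is kept.\<close>

definition chart_struct :: "nat \<Rightarrow> ('k \<Rightarrow> 'v::plus \<Rightarrow> 'v) \<Rightarrow> ('k, ('k, 'v) tm) lin_struct" where
  "chart_struct n sc =
     \<lparr>ladd = (\<lambda>p q. tpoint n (\<lambda>\<alpha>.
         if \<alpha> = {} then tcoord n p {} else tcoord n p \<alpha> + tcoord n q \<alpha>)),
      lscale = (\<lambda>t p. tpoint n (\<lambda>\<alpha>.
         if \<alpha> = {} then tcoord n p {} else sc t (tcoord n p \<alpha>)))\<rparr>"


section \<open>Manifolds and their iterated tangent bundles\<close>

type_synonym ('m, 'v) chart = "'m set \<times> ('m \<Rightarrow> 'v)"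

abbreviation cdom :: "('m, 'v) chart \<Rightarrow> 'm set" where "cdom \<equiv> fst"
abbreviation cmap :: "('m, 'v) chart \<Rightarrow> 'm \<Rightarrow> 'v" where "cmap \<equiv> snd"
abbreviation cimg :: "('m, 'v) chart \<Rightarrow> 'v set" where "cimg c \<equiv> cmap c ` cdom c"

definition overlap :: "('m, 'v) chart \<Rightarrow> ('m, 'v) chart \<Rightarrow> 'v set" where
  "overlap c d = cmap c ` (cdom c \<inter> cdom d)"

definition transition :: "('m, 'v) chart \<Rightarrow> ('m, 'v) chart \<Rightarrow> 'v \<Rightarrow> 'v" where
  "transition c d = cmap d \<circ> inv_into (cdom c) (cmap c)"

definition smooth_atlas ::
  "('k::base_ring \<Rightarrow> 'v::{plus,minus,topological_space} \<Rightarrow> 'v) \<Rightarrow>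
   ('m::topological_space, 'v) chart set \<Rightarrow> bool" where
  "smooth_atlas sc A \<longleftrightarrow>
     (\<Union>c\<in>A. cdom c) = UNIV \<and>
     (\<forall>c\<in>A. open (cdom c) \<and> open (cimg c) \<and> (\<exists>\<psi>. homeomorphism (cdom c) (cimg c) (cmap c) \<psi>)) \<and>
     (\<forall>c\<in>A. \<forall>d\<in>A. smooth sc vec_space vec_space (Vec ` overlap c d)
        (\<lambda>p. Vec (transition c d (vec_of p))))"

text \<open>
  A point of \<open>T\<^sup>nM\<close> over \<open>m\<close> is a pair \<open>(m, \<xi>)\<close>, where \<open>\<xi>\<close> assigns to each chart around \<open>m\<close>
  the expression of the point in this chart, compatibly with the \<open>n\<close>-fold tangent maps of the
  transition maps.  This models the gluing of the sets \<open>T\<^sup>nU\<close> along these maps.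
\<close>

type_synonym ('k, 'm, 'v) tpt = "'m \<times> (('m, 'v) chart \<Rightarrow> ('k, 'v) tm)"

definition tangent_bundle ::
  "nat \<Rightarrow> ('k::base_ring \<Rightarrow> 'v::{plus,minus,topological_space} \<Rightarrow> 'v) \<Rightarrow> ('m, 'v) chart set \<Rightarrow>
   ('k, 'm, 'v) tpt set" where
  "tangent_bundle n sc A = {(m, \<xi>).
     (\<forall>c\<in>A. m \<in> cdom c \<longrightarrow> \<xi> c \<in> tset n {cmap c m}) \<and>
     (\<forall>c\<in>A. \<forall>d\<in>A. m \<in> cdom c \<inter> cdom d \<longrightarrow>
        \<xi> d = tmap n sc (overlap c d) (transition c d) (\<xi> c)) \<and>
     (\<forall>c. \<not> (c \<in> A \<and> m \<in> cdom c) \<longrightarrow> \<xi> c = undefined)}"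

definition fiber :: "('k, 'm, 'v) tpt set \<Rightarrow> 'm \<Rightarrow> ('k, 'm, 'v) tpt set" where
  "fiber B m = {\<xi> \<in> B. fst \<xi> = m}"

text \<open>The map (binary operation) over the identity of \<open>M\<close> which is given by \<open>F c\<close> in the chart \<open>c\<close>.\<close>

definition in_charts ::
  "('m, 'v) chart set \<Rightarrow> (('m, 'v) chart \<Rightarrow> ('k, 'v) tm \<Rightarrow> ('k, 'v) tm) \<Rightarrow>
   ('k, 'm, 'v) tpt \<Rightarrow> ('k, 'm, 'v) tpt" where
  "in_charts A F \<xi> =
     (fst \<xi>, \<lambda>c. if c \<in> A \<and> fst \<xi> \<in> cdom c then F c (snd \<xi> c) else undefined)"

definition in_charts2 ::
  "('m, 'v) chart set \<Rightarrow> (('m, 'v) chart \<Rightarrow> ('k, 'v) tm \<Rightarrow> ('k, 'v) tm \<Rightarrow> ('k, 'v) tm) \<Rightarrow>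
   ('k, 'm, 'v) tpt \<Rightarrow> ('k, 'm, 'v) tpt \<Rightarrow> ('k, 'm, 'v) tpt" where
  "in_charts2 A F \<xi> \<eta> =
     (fst \<xi>, \<lambda>c. if c \<in> A \<and> fst \<xi> \<in> cdom c then F c (snd \<xi> c) (snd \<eta> c) else undefined)"

definition perm_action ::
  "nat \<Rightarrow> ('m, 'v) chart set \<Rightarrow> (nat \<Rightarrow> nat) \<Rightarrow> ('k, 'm, 'v) tpt \<Rightarrow> ('k, 'm, 'v) tpt" where
  "perm_action n A \<sigma> = in_charts A (\<lambda>c. perm_chart n \<sigma>)"

definition shift ::
  "nat \<Rightarrow> ('m, 'v::zero) chart set \<Rightarrow> nat \<Rightarrow> nat \<Rightarrow> ('k, 'm, 'v) tpt \<Rightarrow> ('k, 'm, 'v) tpt" where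
  "shift n A i j = in_charts A (\<lambda>c. shift_chart n i j)"

definition A_struct ::
  "nat \<Rightarrow> ('k \<Rightarrow> 'v::plus \<Rightarrow> 'v) \<Rightarrow> ('m, 'v) chart set \<Rightarrow> ('k, ('k, 'm, 'v) tpt) lin_struct" where
  "A_struct n sc A =
     \<lparr>ladd = in_charts2 A (\<lambda>c. ladd (chart_struct n sc)),
      lscale = (\<lambda>t. in_charts A (\<lambda>c. lscale (chart_struct n sc) t))\<rparr>"


section \<open>Linear connections\<close>

definition is_bilinear ::
  "('k::comm_ring_1 \<Rightarrow> 'v::ab_group_add \<Rightarrow> 'v) \<Rightarrow> ('v \<Rightarrow> 'v \<Rightarrow> 'v) \<Rightarrow> bool" where
  "is_bilinear sc B \<longleftrightarrow>
     (\<forall>u. module_hom sc sc (\<lambda>v. B u v)) \<and> (\<forall>v. module_hom sc sc (\<lambda>u. B u v))"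

definition is_christoffel ::
  "('k::base_ring \<Rightarrow> 'v::{ab_group_add,topological_space} \<Rightarrow> 'v) \<Rightarrow> ('m, 'v) chart set \<Rightarrow>
   ('k, ('k, 'm, 'v) tpt) lin_struct \<Rightarrow> ('m, 'v) chart \<Rightarrow> ('v \<Rightarrow> 'v \<Rightarrow> 'v \<Rightarrow> 'v) \<Rightarrow> bool" where
  "is_christoffel sc A L c b \<longleftrightarrow>
     (\<forall>x\<in>cimg c. is_bilinear sc (b x)) \<and>
     smooth sc (pair_space vec_space (pair_space vec_space vec_space)) vec_space
       {Pair (Vec x) (Pair (Vec u) (Vec v)) |x u v. x \<in> cimg c}
       (\<lambda>p. Vec (b (vec_of (first p)) (vec_of (first (second p))) (vec_of (second (second p))))) \<and>
     (let \<Phi> = Phi_chart 0 sc (cimg c) b;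
          S = push_forward \<Phi> (inv_into (tset 2 (cimg c)) \<Phi>) (chart_struct 2 sc)
      in \<forall>m\<in>cdom c. \<forall>\<xi>\<in>fiber (tangent_bundle 2 sc A) m.
           (\<forall>\<eta>\<in>fiber (tangent_bundle 2 sc A) m.
              snd (ladd L \<xi> \<eta>) c = ladd S (snd \<xi> c) (snd \<eta> c)) \<and>
           (\<forall>t. snd (lscale L t \<xi>) c = lscale S t (snd \<xi> c)))"

definition linear_connection ::
  "('k::base_ring \<Rightarrow> 'v::{ab_group_add,topological_space} \<Rightarrow> 'v) \<Rightarrow> ('m, 'v) chart set \<Rightarrow>
   ('k, ('k, 'm, 'v) tpt) lin_struct \<Rightarrow> bool" where
  "linear_connection sc A L \<longleftrightarrow>
     (\<forall>m. is_module_on (fiber (tangent_bundle 2 sc A) m) L) \<and>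
     (\<forall>c\<in>A. \<exists>b. is_christoffel sc A L c b)"

text \<open>
  On \<open>cimg c\<close> the Christoffel tensor is determined by \<open>L\<close>: if \<open>p\<close> and \<open>q\<close> have the coordinates
  \<open>(u, 0, 0)\<close> and \<open>(0, v, 0)\<close> over \<open>x\<close>, their sum with respect to \<open>L\<close> is \<open>(u, v, b x u v)\<close>.
\<close>

definition christoffel ::
  "('k::base_ring \<Rightarrow> 'v::{ab_group_add,topological_space} \<Rightarrow> 'v) \<Rightarrow> ('m, 'v) chart set \<Rightarrow>
   ('k, ('k, 'm, 'v) tpt) lin_struct \<Rightarrow> ('m, 'v) chart \<Rightarrow> 'v \<Rightarrow> 'v \<Rightarrow> 'v \<Rightarrow> 'v" where
  "christoffel sc A L c = (SOME b. is_christoffel sc A L c b)"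

definition torsionfree ::
  "('k::base_ring \<Rightarrow> 'v::{ab_group_add,topological_space} \<Rightarrow> 'v) \<Rightarrow> ('m, 'v) chart set \<Rightarrow>
   ('k, ('k, 'm, 'v) tpt) lin_struct \<Rightarrow> bool" where
  "torsionfree sc A L \<longleftrightarrow>
     (\<forall>c\<in>A. \<forall>x\<in>cimg c. \<forall>u v. christoffel sc A L c x u v = christoffel sc A L c x v u)"

text \<open>
  \<open>Phi k sc A L\<close> is \<open>\<Phi>\<^bsub>k+1\<^esub> : A\<^bsup>k+2\<^esup>M \<rightarrow> T\<^bsup>k+2\<^esup>M\<close>.  It is chart-independent and bijective in every
  chart, so its inverse is given by the inverses of its chart expressions.
\<close>

definition Phi ::
  "nat \<Rightarrow> ('k::base_ring \<Rightarrow> 'v::{ab_group_add,topological_space} \<Rightarrow> 'v) \<Rightarrow> ('m, 'v) chart set \<Rightarrow>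
   ('k, ('k, 'm, 'v) tpt) lin_struct \<Rightarrow> ('k, 'm, 'v) tpt \<Rightarrow> ('k, 'm, 'v) tpt" where
  "Phi k sc A L = in_charts A (\<lambda>c. Phi_chart k sc (cimg c) (christoffel sc A L c))"

definition Phi_inv ::
  "nat \<Rightarrow> ('k::base_ring \<Rightarrow> 'v::{ab_group_add,topological_space} \<Rightarrow> 'v) \<Rightarrow> ('m, 'v) chart set \<Rightarrow>
   ('k, ('k, 'm, 'v) tpt) lin_struct \<Rightarrow> ('k, 'm, 'v) tpt \<Rightarrow> ('k, 'm, 'v) tpt" where
  "Phi_inv k sc A L = in_charts A (\<lambda>c.
     inv_into (tset (k + 2) (cimg c)) (Phi_chart k sc (cimg c) (christoffel sc A L c)))"

definition derived_struct ::
  "nat \<Rightarrow> ('k::base_ring \<Rightarrow> 'v::{ab_group_add,topological_space} \<Rightarrow> 'v) \<Rightarrow> ('m, 'v) chart set \<Rightarrow>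
   ('k, ('k, 'm, 'v) tpt) lin_struct \<Rightarrow> ('k, ('k, 'm, 'v) tpt) lin_struct" where
  "derived_struct k sc A L =
     push_forward (Phi k sc A L) (Phi_inv k sc A L) (A_struct (k + 2) sc A)"

definition curvature_operator ::
  "('k::base_ring \<Rightarrow> 'v::{ab_group_add,topological_space} \<Rightarrow> 'v) \<Rightarrow> ('m, 'v) chart set \<Rightarrow>
   ('k, ('k, 'm, 'v) tpt) lin_struct \<Rightarrow> (nat \<Rightarrow> nat) \<Rightarrow> ('k, 'm, 'v) tpt \<Rightarrow> ('k, 'm, 'v) tpt" where
  "curvature_operator sc A L \<sigma> =
     perm_action 3 A \<sigma> \<circ> Phi 1 sc A L \<circ> perm_action 3 A (inv \<sigma>) \<circ> Phi_inv 1 sc A L"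

text \<open>
  The curvature forms are the non-trivial multilinear components of the curvature operators, so
  that they all vanish iff each curvature operator is the identity.
\<close>

definition curvature_forms_vanish ::
  "('k::base_ring \<Rightarrow> 'v::{ab_group_add,topological_space} \<Rightarrow> 'v) \<Rightarrow> ('m, 'v) chart set \<Rightarrow>
   ('k, ('k, 'm, 'v) tpt) lin_struct \<Rightarrow> bool" where
  "curvature_forms_vanish sc A L \<longleftrightarrow>
     (\<forall>\<sigma>. \<sigma> permutes {..<3} \<longrightarrow>
        (\<forall>\<xi>\<in>tangent_bundle 3 sc A. curvature_operator sc A L \<sigma> \<xi> = \<xi>))"

definition flat_connection ::
  "('k::base_ring \<Rightarrow> 'v::{ab_group_add,topological_space} \<Rightarrow> 'v) \<Rightarrow> ('m, 'v) chart set \<Rightarrow>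
   ('k, ('k, 'm, 'v) tpt) lin_struct \<Rightarrow> bool" where
  "flat_connection sc A L \<longleftrightarrow> torsionfree sc A L \<and> curvature_forms_vanish sc A L"

definition fiberwise_linear ::
  "('k, 'm, 'v) tpt set \<Rightarrow> ('k, ('k, 'm, 'v) tpt) lin_struct \<Rightarrow>
   (('k, 'm, 'v) tpt \<Rightarrow> ('k, 'm, 'v) tpt) \<Rightarrow> bool" where
  "fiberwise_linear B S F \<longleftrightarrow>
     (\<forall>m. \<forall>\<xi>\<in>fiber B m.
        (\<forall>\<eta>\<in>fiber B m. F (ladd S \<xi> \<eta>) = ladd S (F \<xi>) (F \<eta>)) \<and>
        (\<forall>t. F (lscale S t \<xi>) = lscale S t (F \<xi>)))"

definition totally_symmetric ::
  "nat \<Rightarrow> ('k::base_ring \<Rightarrow> 'v::{ab_group_add,topological_space} \<Rightarrow> 'v) \<Rightarrow> ('m, 'v) chart set \<Rightarrow>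
   ('k, ('k, 'm, 'v) tpt) lin_struct \<Rightarrow> bool" where
  "totally_symmetric n sc A S \<longleftrightarrow>
     (\<forall>\<sigma>. \<sigma> permutes {..<n} \<longrightarrow>
        fiberwise_linear (tangent_bundle n sc A) S (perm_action n A \<sigma>))"

definition shift_invariant ::
  "nat \<Rightarrow> ('k::base_ring \<Rightarrow> 'v::{ab_group_add,topological_space} \<Rightarrow> 'v) \<Rightarrow> ('m, 'v) chart set \<Rightarrow>
   ('k, ('k, 'm, 'v) tpt) lin_struct \<Rightarrow> bool" where
  "shift_invariant n sc A S \<longleftrightarrow>
     (\<forall>i<n. \<forall>j<n. i \<noteq> j \<longrightarrow> fiberwise_linear (tangent_bundle n sc A) S (shift n A i j))"

end

theory Submission
  imports Defs
begin

text \<open>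
  Push-forward under a map \<open>\<Phi>\<close> makes a map \<open>F\<close> linear as soon as \<open>F\<close> is linear for the chart
  structure and commutes with \<open>\<Phi>\<close>.  So the claim reduces to a statement in one chart: the maps
  \<open>\<Phi>\<^sup>n : A\<^sup>nU \<rightarrow> T\<^sup>nU\<close>, where \<open>\<Phi>\<^bsup>k+2\<^esup>\<close> is \<open>Phi_chart k\<close>, commute with all permutations of the units and
  with all shifts.

  In a chart \<open>\<Phi>\<^bsup>n+1\<^esup> = T\<Phi>\<^sup>n \<circ> B\<^sub>n\<close>, where \<open>B\<^sub>n\<close> (\<open>chr_map\<close>) adds the Christoffel terms
  \<open>b\<^sub>x(v\<^sub>\<alpha>, v\<^sub>n)\<close> to the coefficients of \<open>\<epsilon>\<^sub>n\<epsilon>\<^sup>\<alpha>\<close>.  Permutations and shifts both rearrange coordinates,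
  possibly inserting zeros; they are linear, hence equal to their own derivatives, and they
  commute with \<open>B\<^sub>n\<close> as long as they do not touch the last unit.  Commutation with \<open>\<Phi>\<^sup>n\<close> therefore
  passes to \<open>\<Phi>\<^bsup>n+1\<^esup>\<close> (\<open>equivariant_lift\<close>).  For the shift from \<open>\<epsilon>\<^sub>0\<close> to \<open>\<epsilon>\<^sub>1\<close> this is the whole
  induction, and all other shifts are conjugate to it under permutations.

  For the permutations one more generator is needed in each step, the exchange of the last two
  units.  By the chain rule \<open>\<Phi>\<^bsup>n+2\<^esup> = TT\<Phi>\<^sup>n \<circ> TB\<^sub>n \<circ> B\<^bsub>n+1\<^esub>\<close>.  The exchange commutes with \<open>TT\<Phi>\<^sup>n\<close>
  because second derivatives are symmetric (\<open>tangent_tangent_flip\<close>).  It commutes with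
  \<open>TB\<^sub>n \<circ> B\<^bsub>n+1\<^esub>\<close> because this map decomposes: for each non-zero \<open>\<alpha>\<close> the coefficients of
  \<open>\<epsilon>\<^sup>\<alpha>\<close> times \<open>1\<close>, \<open>\<epsilon>\<^sub>n\<close>, \<open>\<epsilon>\<^bsub>n+1\<^esub>\<close> and \<open>\<epsilon>\<^sub>n\<epsilon>\<^bsub>n+1\<^esub>\<close>, together with those which do not involve the
  first \<open>n\<close> units, transform exactly as under \<open>TB\<^sub>1 \<circ> B\<^sub>2 = \<Phi>\<^sup>3\<close> (\<open>reindex_chr_map2\<close>), and
  \<open>\<Phi>\<^sup>3\<close> commutes with the exchange because the curvature forms vanish.  So the curvature never has
  to be expressed by derivatives of the Christoffel tensor.  Vanishing torsion is the case
  \<open>n = 2\<close> of the induction.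

  Two points need the differential calculus beyond this.  The maps \<open>\<Phi>\<^sup>n\<close> are bijective because
  their inverses are smooth: \<open>B\<^sub>n\<close> is inverted by the same map for \<open>- b\<close>, and \<open>T\<Phi>\<^sup>n\<close> by the tangent map
  of the inverse.  And the
  hypothesis on the curvature speaks of points of \<open>T\<^sup>3M\<close>; to use it in a chart, every element of
  \<open>T\<^sup>3U\<close> has to be the expression of such a point, which is the functoriality of iterated tangent
  maps on overlaps of charts.
\<close>

section \<open>Modules of trees\<close>

text \<open>
  The modules on which the calculus operates.  On the points of one of them, all of which have the
  same shape, the leafwise operations satisfy the laws of a topological module.
\<close>

inductive tree_module ::
  "('k::topological_space, 'v::topological_space) tm topology \<Rightarrow> bool" where
  vec: "tree_module vec_space"
| scal: "tree_module scal_space"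
| pair: "tree_module E \<Longrightarrow> tree_module F \<Longrightarrow> tree_module (pair_space E F)"

lemma topspace_vec_space [simp]: "topspace vec_space = range Vec"
  by (auto simp: vec_space_def topspace_pullback_topology)

lemma topspace_scal_space [simp]: "topspace scal_space = range Scal"
  by (auto simp: scal_space_def topspace_pullback_topology)

lemma topspace_pair_space:
  "topspace (pair_space E F) = {Pair p q |p q. p \<in> topspace E \<and> q \<in> topspace F}"
  by (auto simp: pair_space_def topspace_pullback_topology)

lemma Pair_in_pair_space [simp]:
  "Pair p q \<in> topspace (pair_space E F) \<longleftrightarrow> p \<in> topspace E \<and> q \<in> topspace F"
  by (auto simp: topspace_pair_space)

lemma in_pair_spaceE:
  assumes "z \<in> topspace (pair_space E F)"
  obtains p q where "z = Pair p q" "p \<in> topspace E" "q \<in> topspace F"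
  using assms by (auto simp: topspace_pair_space)

lemma Pair_in_ext_space [simp]:
  "Pair x (Pair v (Scal t)) \<in> topspace (ext_space E) \<longleftrightarrow> x \<in> topspace E \<and> v \<in> topspace E"
  by (simp add: ext_space_def)

lemma in_ext_spaceE:
  assumes "z \<in> topspace (ext_space E)"
  obtains x v t where "z = Pair x (Pair v (Scal t))" "x \<in> topspace E" "v \<in> topspace E"
  using assms by (auto simp: ext_space_def topspace_pair_space)

lemma tree_module_ext_space: "tree_module E \<Longrightarrow> tree_module (ext_space E)"
  unfolding ext_space_def by (intro tree_module.intros)

lemma tree_module_tspace: "tree_module (tspace n)"
  by (induction n) (auto intro: tree_module.intros)

lemma continuous_map_vec_space:
  "continuous_map X vec_space (\<lambda>x. Vec (f x)) \<longleftrightarrow> continuous_map X euclidean f"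
proof
  assume "continuous_map X vec_space (\<lambda>x. Vec (f x))"
  then have "continuous_map X euclidean (vec_of \<circ> (\<lambda>x. Vec (f x)))"
    using continuous_map_compose
      continuous_map_pullback[of euclidean euclidean "\<lambda>x. x" "range Vec" vec_of]
    unfolding vec_space_def by (fastforce simp: o_def)
  then show "continuous_map X euclidean f" by (simp add: o_def)
qed (auto simp: vec_space_def o_def intro!: continuous_map_pullback')

lemma continuous_map_scal_space:
  "continuous_map X scal_space (\<lambda>x. Scal (f x)) \<longleftrightarrow> continuous_map X euclidean f"
proof
  assume "continuous_map X scal_space (\<lambda>x. Scal (f x))"
  then have "continuous_map X euclidean (scal_of \<circ> (\<lambda>x. Scal (f x)))"
    using continuous_map_compose
      continuous_map_pullback[of euclidean euclidean "\<lambda>x. x" "range Scal" scal_of]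
    unfolding scal_space_def by (fastforce simp: o_def)
  then show "continuous_map X euclidean f" by (simp add: o_def)
qed (auto simp: scal_space_def o_def intro!: continuous_map_pullback')

lemma continuous_map_Pair:
  assumes "continuous_map X E f" "continuous_map X F g"
  shows "continuous_map X (pair_space E F) (\<lambda>x. Pair (f x) (g x))"
  unfolding pair_space_def
  using assms
  by (intro continuous_map_pullback')
    (auto simp: o_def continuous_map_paired dest: continuous_map_image_subset_topspace)

lemma continuous_map_first: "continuous_map (pair_space E F) E first"
  and continuous_map_second: "continuous_map (pair_space E F) F second"
  using continuous_map_pullback[OF continuous_map_fst, of "{Pair p q |p q. p \<in> topspace E \<and> q \<in> topspace F}" "\<lambda>z. (first z, second z)" E F]
    continuous_map_pullback[OF continuous_map_snd, of "{Pair p q |p q. p \<in> topspace E \<and> q \<in> topspace F}" "\<lambda>z. (first z, second z)" E F]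
  unfolding pair_space_def by (auto simp: o_def)

lemma continuous_map_first_of:
  "continuous_map X (pair_space E F) f \<Longrightarrow> continuous_map X E (\<lambda>x. first (f x))"
  and continuous_map_second_of:
  "continuous_map X (pair_space E F) f \<Longrightarrow> continuous_map X F (\<lambda>x. second (f x))"
  using continuous_map_compose[OF _ continuous_map_first]
    continuous_map_compose[OF _ continuous_map_second] by (auto simp: o_def)

lemma continuous_map_vec_of: "continuous_map vec_space euclidean vec_of"
  using continuous_map_pullback[of euclidean euclidean "\<lambda>x. x" "range Vec" vec_of]
  by (simp add: vec_space_def o_def)

lemma continuous_map_scal_of: "continuous_map scal_space euclidean scal_of"
  using continuous_map_pullback[of euclidean euclidean "\<lambda>x. x" "range Scal" scal_of]
  by (simp add: scal_space_def o_def)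

lemma tm_sum_closed:
  assumes "tree_module E" "p \<in> topspace E" "q \<in> topspace E"
  shows "p + q \<in> topspace E"
  using assms by (induction E arbitrary: p q) (auto simp: topspace_pair_space)

lemma tm_diff_closed:
  assumes "tree_module E" "p \<in> topspace E" "q \<in> topspace E"
  shows "p - q \<in> topspace E"
  using assms by (induction E arbitrary: p q) (auto simp: topspace_pair_space)

lemma tm_scale_closed:
  assumes "tree_module E" "p \<in> topspace E"
  shows "tm_scale sc t p \<in> topspace E"
  using assms by (induction E arbitrary: p) (auto simp: topspace_pair_space)

lemma continuous_map_binop:
  assumes "continuous_on UNIV (\<lambda>(a, b). h a b)"
    and "continuous_map X euclidean f" "continuous_map X euclidean g"
  shows "continuous_map X euclidean (\<lambda>x. h (f x) (g x))"
proof -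
  have "continuous_map X euclidean (\<lambda>x. (f x, g x))"
    using assms(2,3) continuous_map_paired[of X euclidean euclidean f g] by simp
  then show ?thesis
    using continuous_map_compose[of X euclidean "\<lambda>x. (f x, g x)" euclidean "\<lambda>(a, b). h a b"] assms(1)
    by (simp add: o_def)
qed

lemma continuous_map_in_topspace:
  "continuous_map X Y f \<Longrightarrow> x \<in> topspace X \<Longrightarrow> f x \<in> topspace Y"
  using continuous_map_image_subset_topspace by blast

lemma continuous_map_vec_of_comp:
  "continuous_map X vec_space f \<Longrightarrow> continuous_map X euclidean (\<lambda>x. vec_of (f x))"
  using continuous_map_compose[OF _ continuous_map_vec_of] by (simp add: o_def)

lemma continuous_map_scal_of_comp:
  "continuous_map X scal_space f \<Longrightarrow> continuous_map X euclidean (\<lambda>x. scal_of (f x))"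
  using continuous_map_compose[OF _ continuous_map_scal_of] by (simp add: o_def)

lemma continuous_map_tm_sum:
  fixes E :: "('k::topological_ab_group_add, 'v::topological_ab_group_add) tm topology"
  assumes "tree_module E"
  shows "continuous_map X E f \<Longrightarrow> continuous_map X E g \<Longrightarrow> continuous_map X E (\<lambda>x. f x + g x)"
  using assms
proof (induction E arbitrary: f g)
  case vec
  have "continuous_on UNIV (\<lambda>(a, b). a + b :: 'v)"
    unfolding split_beta by (intro continuous_intros)
  then have "continuous_map X vec_space (\<lambda>x. Vec (vec_of (f x) + vec_of (g x)))"
    unfolding continuous_map_vec_space
    by (rule continuous_map_binop) (use vec in \<open>auto intro: continuous_map_vec_of_comp\<close>)
  then show ?case
  proof (rule continuous_map_eq)
    fix x assume "x \<in> topspace X"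
    then show "Vec (vec_of (f x) + vec_of (g x)) = f x + g x"
      using vec[THEN continuous_map_in_topspace] by fastforce
  qed
next
  case scal
  have "continuous_on UNIV (\<lambda>(a, b). a + b :: 'k)"
    unfolding split_beta by (intro continuous_intros)
  then have "continuous_map X scal_space (\<lambda>x. Scal (scal_of (f x) + scal_of (g x)))"
    unfolding continuous_map_scal_space
    by (rule continuous_map_binop) (use scal in \<open>auto intro: continuous_map_scal_of_comp\<close>)
  then show ?case
  proof (rule continuous_map_eq)
    fix x assume "x \<in> topspace X"
    then show "Scal (scal_of (f x) + scal_of (g x)) = f x + g x"
      using scal[THEN continuous_map_in_topspace] by fastforce
  qed
next
  case (pair E F)
  have "continuous_map X (pair_space E F)
      (\<lambda>x. Pair (first (f x) + first (g x)) (second (f x) + second (g x)))"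
    using pair.prems
    by (intro continuous_map_Pair pair.IH continuous_map_first_of continuous_map_second_of)
  then show ?case
  proof (rule continuous_map_eq)
    fix x assume "x \<in> topspace X"
    then show "Pair (first (f x) + first (g x)) (second (f x) + second (g x)) = f x + g x"
      using pair.prems[THEN continuous_map_in_topspace] by (metis in_pair_spaceE plus_tm.simps(3) tm.sel(3,4))
  qed
qed

lemma Hausdorff_space_euclidean_t2: "Hausdorff_space (euclidean :: 'a::t2_space topology)"
  unfolding Hausdorff_space_def disjnt_def by simp (metis hausdorff)

lemma Hausdorff_tree_module:
  fixes E :: "('k::t2_space, 'v::t2_space) tm topology"
  assumes "tree_module E"
  shows "Hausdorff_space E"
  using assms
proof induction
  case vec
  show ?case
    by (rule Hausdorff_space_injective_preimage[OF _ continuous_map_vec_of])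
      (auto simp: inj_on_def Hausdorff_space_euclidean_t2)
next
  case scal
  show ?case
    by (rule Hausdorff_space_injective_preimage[OF _ continuous_map_scal_of])
      (auto simp: inj_on_def Hausdorff_space_euclidean_t2)
next
  case (pair E F)
  have "continuous_map (pair_space E F) (prod_topology E F) (\<lambda>z. (first z, second z))"
    by (intro continuous_map_pairedI continuous_map_first continuous_map_second)
  then show ?case
    by (rule Hausdorff_space_injective_preimage[rotated])
      (use pair in \<open>auto simp: inj_on_def topspace_pair_space Hausdorff_space_prod_topology\<close>)
qed

text \<open>
  The principle behind all identities between derivatives: such an identity is checked at the units
  of \<open>K\<close>, where one can divide, and extends to \<open>0\<close> by density and continuity.
\<close>

lemma eq_if_eq_on_units:
  fixes D :: "'k::base_ring set"
  assumes "open D" and "Hausdorff_space F"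
    and f: "continuous_map (top_of_set D) F f" and g: "continuous_map (top_of_set D) F g"
    and eq: "\<And>t. t \<in> D \<Longrightarrow> t dvd 1 \<Longrightarrow> f t = g t" and t: "t \<in> D"
  shows "f t = g t"
proof (rule ccontr)
  assume "f t \<noteq> g t"
  moreover have "f t \<in> topspace F" "g t \<in> topspace F"
    using f g t by (auto dest: continuous_map_in_topspace)
  ultimately obtain A B where AB: "openin F A" "openin F B" "f t \<in> A" "g t \<in> B" "disjnt A B"
    using \<open>Hausdorff_space F\<close> unfolding Hausdorff_space_def by metis
  \<comment> \<open>the open set of parameters at which the two maps are still separated contains a unit\<close>
  let ?N = "{s \<in> topspace (top_of_set D). f s \<in> A} \<inter> {s \<in> topspace (top_of_set D). g s \<in> B}"
  have "openin (top_of_set D) ?N"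
    using AB f g by (intro openin_Int openin_continuous_map_preimage)
  then have "open ?N" using \<open>open D\<close> by (simp add: openin_open_eq)
  moreover have "?N \<noteq> {}" using AB t by auto
  ultimately obtain s where "s \<in> ?N" "s dvd 1" by (meson dense_units)
  then show False using eq[of s] AB(5) by (auto simp: disjnt_def)
qed

context topological_module
begin

abbreviation tscale :: "'k \<Rightarrow> ('k, 'v) tm \<Rightarrow> ('k, 'v) tm" (infixr "\<bullet>\<^sub>t" 75) where
  "t \<bullet>\<^sub>t p \<equiv> tm_scale sc t p"

lemmas tm_simps = scale_right_distrib scale_left_distrib distrib_left distrib_right mult.assoc

context
  fixes E :: "('k, 'v) tm topology" and p q :: "('k, 'v) tm"
  assumes E: "tree_module E" and pq: "p \<in> topspace E" "q \<in> topspace E"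
begin

lemma tm_scale_zero_right: "p + 0 \<bullet>\<^sub>t q = p"
  using E pq by (induction E arbitrary: p q) (auto simp: topspace_pair_space tm_simps)

lemma tm_add_diff_cancel: "(p + q) - p = q"
  using E pq by (induction E arbitrary: p q) (auto simp: topspace_pair_space tm_simps)

lemma tm_diff_add_cancel: "p + (q - p) = q"
  using E pq by (induction E arbitrary: p q) (auto simp: topspace_pair_space tm_simps)

lemma tm_scale_add: "s \<bullet>\<^sub>t (p + q) = s \<bullet>\<^sub>t p + s \<bullet>\<^sub>t q"
  using E pq by (induction E arbitrary: p q) (auto simp: topspace_pair_space tm_simps)

lemma tm_scale_scale: "s \<bullet>\<^sub>t t \<bullet>\<^sub>t p = (s * t) \<bullet>\<^sub>t p"
  using E pq by (induction E arbitrary: p q) (auto simp: topspace_pair_space tm_simps)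

lemma tm_scale_one: "1 \<bullet>\<^sub>t p = p"
  using E pq by (induction E arbitrary: p q) (auto simp: topspace_pair_space tm_simps)

lemma tm_diff_conv: "p - q = p + (- 1) \<bullet>\<^sub>t q"
  using E pq by (induction E arbitrary: p q) (auto simp: topspace_pair_space tm_simps)

end

lemma tm_add_commute: "p + q = q + (p :: ('k, 'v) tm)"
  by (induction p q rule: plus_tm.induct) (auto simp: add.commute)

lemma tm_scale_diff:
  assumes "tree_module E" "p \<in> topspace E" "q \<in> topspace E"
  shows "t \<bullet>\<^sub>t p - t \<bullet>\<^sub>t q = t \<bullet>\<^sub>t (p - q)"
  using assms by (induction E arbitrary: p q)
    (auto simp: topspace_pair_space scale_right_diff_distrib right_diff_distrib)

lemma tm_diff_diff_swap:
  assumes "tree_module E" "p \<in> topspace E" "q \<in> topspace E" "p' \<in> topspace E" "q' \<in> topspace E"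
  shows "(p - q) - (p' - q') = (p - p') - (q - (q' :: ('k, 'v) tm))"
  using assms by (induction E arbitrary: p q p' q') (auto simp: topspace_pair_space)

lemma continuous_map_tscale:
  assumes "tree_module E"
  shows "continuous_map X euclidean s \<Longrightarrow> continuous_map X E f \<Longrightarrow>
    continuous_map X E (\<lambda>x. s x \<bullet>\<^sub>t f x)"
  using assms
proof (induction E arbitrary: f)
  case vec
  have "continuous_map X vec_space (\<lambda>x. Vec (sc (s x) (vec_of (f x))))"
    unfolding continuous_map_vec_space
    by (rule continuous_map_binop[OF continuous_scale vec(1)])
      (rule continuous_map_vec_of_comp[OF vec(2)])
  then show ?case
  proof (rule continuous_map_eq)
    fix x assume "x \<in> topspace X"
    then show "Vec (sc (s x) (vec_of (f x))) = s x \<bullet>\<^sub>t f x"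
      by (auto dest!: continuous_map_in_topspace[OF vec(2)])
  qed
next
  case scal
  have "continuous_on UNIV (\<lambda>(a, b). a * b :: 'k)"
    unfolding split_beta by (intro continuous_intros)
  then have "continuous_map X scal_space (\<lambda>x. Scal (s x * scal_of (f x)))"
    unfolding continuous_map_scal_space
    by (rule continuous_map_binop) (use scal in \<open>auto intro: continuous_map_scal_of_comp\<close>)
  then show ?case
  proof (rule continuous_map_eq)
    fix x assume "x \<in> topspace X"
    then show "Scal (s x * scal_of (f x)) = s x \<bullet>\<^sub>t f x"
      by (auto dest!: continuous_map_in_topspace[OF scal(2)])
  qed
next
  case (pair E F)
  have "continuous_map X (pair_space E F)
      (\<lambda>x. Pair (s x \<bullet>\<^sub>t first (f x)) (s x \<bullet>\<^sub>t second (f x)))"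
    using pair.prems
    by (intro continuous_map_Pair pair.IH continuous_map_first_of continuous_map_second_of)
  then show ?case
  proof (rule continuous_map_eq)
    fix x assume "x \<in> topspace X"
    then show "Pair (s x \<bullet>\<^sub>t first (f x)) (s x \<bullet>\<^sub>t second (f x)) = s x \<bullet>\<^sub>t f x"
      using pair.prems(2)[THEN continuous_map_in_topspace] by (metis in_pair_spaceE tm_scale.simps(3) tm.sel(3,4))
  qed
qed

lemma continuous_map_tm_diff:
  fixes E :: "('k, 'v) tm topology"
  assumes "tree_module E" "continuous_map X E f" "continuous_map X E g"
  shows "continuous_map X E (\<lambda>x. f x - g x)"
proof (rule continuous_map_eq)
  show "continuous_map X E (\<lambda>x. f x + (- 1) \<bullet>\<^sub>t g x)"
    using assms by (intro continuous_map_tm_sum continuous_map_tscale) auto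
  show "f x + (- 1) \<bullet>\<^sub>t g x = f x - g x" if "x \<in> topspace X" for x
    using tm_diff_conv assms that by (metis continuous_map_in_topspace)
qed

lemma openin_line:
  assumes "tree_module E" "openin E U" "x \<in> topspace E" "v \<in> topspace E"
  shows "open {t. x + t \<bullet>\<^sub>t v \<in> U}"
proof -
  have "continuous_map euclidean E (\<lambda>t. x + t \<bullet>\<^sub>t v)"
    using assms by (intro continuous_map_tm_sum continuous_map_tscale) auto
  from openin_continuous_map_preimage[OF this \<open>openin E U\<close>] show ?thesis by simp
qed

end


section \<open>Differential calculus on modules of trees\<close>

definition tangent_dom ::
  "('k, 'v) tm topology \<Rightarrow> ('k, 'v) tm set \<Rightarrow> ('k, 'v) tm set" where
  "tangent_dom E U = {Pair p q |p q. p \<in> U \<and> q \<in> topspace E}"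

text \<open>
  The canonical flip of a second tangent bundle, exchanging the two outermost units.  It is only
  meaningful on trees which are pairs of pairs; elsewhere the identity is a default value.
\<close>

fun flip :: "('k, 'v) tm \<Rightarrow> ('k, 'v) tm" where
  "flip (Pair (Pair x u) (Pair v w)) = Pair (Pair x v) (Pair u w)"
| "flip p = p"

lemma Pair_in_tangent_dom [simp]: "Pair p q \<in> tangent_dom E U \<longleftrightarrow> p \<in> U \<and> q \<in> topspace E"
  by (simp add: tangent_dom_def)

lemma in_tangent_domE:
  assumes "z \<in> tangent_dom E U"
  obtains p q where "z = Pair p q" "p \<in> U" "q \<in> topspace E"
  using assms by (auto simp: tangent_dom_def)

lemma tangent_dom_subset: "U \<subseteq> topspace E \<Longrightarrow> tangent_dom E U \<subseteq> topspace (pair_space E E)"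
  by (auto simp: tangent_dom_def)

lemma openin_tangent_dom: "openin E U \<Longrightarrow> openin (pair_space E E) (tangent_dom E U)"
proof -
  assume U: "openin E U"
  have "tangent_dom E U = {z \<in> topspace (pair_space E E). first z \<in> U}"
    using openin_subset[OF U] by (auto simp: tangent_dom_def topspace_pair_space)
  then show ?thesis using openin_continuous_map_preimage[OF continuous_map_first U] by simp
qed

text \<open>
  In the definition of a difference factor the map itself is not required to take values in the
  target.  That it does follows from the case \<open>t = 0\<close>, where the difference \<open>f x - f x\<close> lies there.
\<close>

lemma tm_diff_self_closedD:
  assumes "tree_module E" "p - p \<in> topspace E"
  shows "p \<in> topspace E"
  using assms
proof (induction E arbitrary: p)
  case vec then show ?case by (cases p) auto
next
  case scal then show ?case by (cases p) auto
next
  case (pair E F)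
  from pair.prems obtain a b where p: "p = Pair a b" by (cases p) (auto simp: topspace_pair_space)
  then have "a - a \<in> topspace E" "b - b \<in> topspace F"
    using pair.prems by auto
  from pair.IH(1)[OF this(1)] pair.IH(2)[OF this(2)] show ?case by (simp add: p)
qed

context topological_module
begin

abbreviation ext where "ext \<equiv> ext_dom sc"

lemma in_ext_dom [simp]:
  "Pair x (Pair v (Scal t)) \<in> ext E U \<longleftrightarrow> x \<in> U \<and> v \<in> topspace E \<and> x + t \<bullet>\<^sub>t v \<in> U"
  by (simp add: ext_dom_def)

lemma in_ext_domE:
  assumes "z \<in> ext E U"
  obtains x v t where "z = Pair x (Pair v (Scal t))" "x \<in> U" "v \<in> topspace E" "x + t \<bullet>\<^sub>t v \<in> U"
  using assms by (auto simp: ext_dom_def)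

lemma ext_dom_subset: "U \<subseteq> topspace E \<Longrightarrow> ext E U \<subseteq> topspace (ext_space E)"
  by (auto elim!: in_ext_domE)

lemma ext_dom_mono: "U \<subseteq> W \<Longrightarrow> ext E U \<subseteq> ext E W"
  by (auto elim!: in_ext_domE)

lemma topspace_ext_subtopology:
  "U \<subseteq> topspace E \<Longrightarrow> topspace (subtopology (ext_space E) (ext E U)) = ext E U"
  by (rule topspace_subtopology_subset) (rule ext_dom_subset)

lemma difference_factorD:
  assumes "difference_factor sc E F U f g" "x \<in> U" "v \<in> topspace E" "x + t \<bullet>\<^sub>t v \<in> U"
  shows "f (x + t \<bullet>\<^sub>t v) - f x = t \<bullet>\<^sub>t g (Pair x (Pair v (Scal t)))"
  using assms unfolding difference_factor_def by simp

lemma difference_factor_value: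
  assumes "difference_factor sc E F U f g" "U \<subseteq> topspace E" "z \<in> ext E U"
  shows "g z \<in> topspace F"
  using assms continuous_map_in_topspace[of "subtopology (ext_space E) (ext E U)" F g z]
  by (simp add: difference_factor_def topspace_ext_subtopology del: topspace_subtopology)

lemma difference_factor_maps:
  assumes "difference_factor sc E F U f g" "tree_module E" "tree_module F" "U \<subseteq> topspace E" "x \<in> U"
  shows "f x \<in> topspace F"
proof -
  have x: "x \<in> topspace E" "x + 0 \<bullet>\<^sub>t x = x" using assms tm_scale_zero_right by auto
  have "g (Pair x (Pair x (Scal 0))) \<in> topspace F"
    by (rule difference_factor_value[OF assms(1,4)]) (use x assms in auto)
  moreover have "f x - f x = 0 \<bullet>\<^sub>t g (Pair x (Pair x (Scal 0)))"
    using difference_factorD[OF assms(1), of x x 0] x assms by simp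
  ultimately show ?thesis
    using tm_scale_closed[OF \<open>tree_module F\<close>] tm_diff_self_closedD[OF \<open>tree_module F\<close>] by metis
qed

lemma difference_factor_step:
  assumes "difference_factor sc E F U f g" "tree_module E" "tree_module F" "U \<subseteq> topspace E"
    and "x \<in> U" "v \<in> topspace E" "x + t \<bullet>\<^sub>t v \<in> U"
  shows "f x + t \<bullet>\<^sub>t g (Pair x (Pair v (Scal t))) = f (x + t \<bullet>\<^sub>t v)"
  using difference_factorD[OF assms(1,5,6,7)] tm_diff_add_cancel[OF assms(3)]
    difference_factor_maps[OF assms(1-4)] assms(5,7) by metis

text \<open>
  A difference factor is continuous, and the values of \<open>f\<close> are recovered from it by taking a
  difference with a fixed base point and \<open>t = 1\<close>.
\<close>

lemma difference_factor_continuous: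
  assumes g: "difference_factor sc E F U f g"
    and EF: "tree_module E" "tree_module F" and U: "U \<subseteq> topspace E"
  shows "continuous_map (subtopology E U) F f"
proof (cases "U = {}")
  case True
  then show ?thesis by (simp add: continuous_map_def)
next
  case False
  then obtain x where x: "x \<in> U" "x \<in> topspace E" using U by auto
  have y: "y \<in> topspace E" "x + 1 \<bullet>\<^sub>t (y - x) = y" if "y \<in> U" for y
    using that U x EF by (auto simp: tm_scale_one tm_diff_closed tm_diff_add_cancel)
  have tr: "continuous_map (subtopology E U) E (\<lambda>y. y)"
    by (rule continuous_map_from_subtopology) (rule continuous_map_id[unfolded id_def])
  have "continuous_map (subtopology E U) (ext_space E) (\<lambda>y. Pair x (Pair (y - x) (Scal 1)))"
    unfolding ext_space_def
    using x EF tr by (intro continuous_map_Pair continuous_map_tm_diff) auto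
  then have "continuous_map (subtopology E U) (subtopology (ext_space E) (ext E U))
      (\<lambda>y. Pair x (Pair (y - x) (Scal 1)))"
    using y x EF by (auto simp: continuous_map_in_subtopology tm_diff_closed)
  moreover have "continuous_map (subtopology (ext_space E) (ext E U)) F g"
    using g by (simp add: difference_factor_def)
  ultimately have "continuous_map (subtopology E U) F (\<lambda>y. g (Pair x (Pair (y - x) (Scal 1))))"
    using continuous_map_compose by (force simp: o_def)
  then have "continuous_map (subtopology E U) F
      (\<lambda>y. f x + 1 \<bullet>\<^sub>t g (Pair x (Pair (y - x) (Scal 1))))"
    using EF difference_factor_maps[OF g EF U] x
    by (intro continuous_map_tm_sum continuous_map_tscale) auto
  then show ?thesis
  proof (rule continuous_map_eq)
    fix z assume "z \<in> topspace (subtopology E U)"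
    then have z: "z \<in> U" by simp
    then show "f x + 1 \<bullet>\<^sub>t g (Pair x (Pair (z - x) (Scal 1))) = f z"
      using difference_factor_step[OF g EF U, of x "z - x" 1] y[OF z] x EF
      by (simp add: tm_diff_closed)
  qed
qed

lemma C_class_SucD:
  assumes "C_class (Suc j) sc E F U f" "tree_module E" "tree_module F" "U \<subseteq> topspace E"
  shows "C_class j sc E F U f"
  using assms
proof (induction j arbitrary: E U f)
  case 0
  then show ?case using difference_factor_continuous by auto
next
  case (Suc j)
  then obtain g where g: "difference_factor sc E F U f g"
    "C_class (Suc j) sc (ext_space E) F (ext E U) g" by auto
  then have "C_class j sc (ext_space E) F (ext E U) g"
    using Suc tree_module_ext_space ext_dom_subset by blast
  then show ?case using g by auto
qed

lemma C_class_continuous: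
  assumes "C_class j sc E F U f" "tree_module E" "tree_module F" "U \<subseteq> topspace E"
  shows "continuous_map (subtopology E U) F f"
  using assms(1)
proof (induction j)
  case (Suc j)
  show ?case by (rule Suc.IH[OF C_class_SucD[OF Suc.prems assms(2-4)]])
qed simp

lemma C_class_maps:
  assumes "C_class j sc E F U f" "tree_module E" "tree_module F" "U \<subseteq> topspace E" "x \<in> U"
  shows "f x \<in> topspace F"
  using continuous_map_in_topspace[OF C_class_continuous[OF assms(1-4)], of x] assms by auto

lemma C_class_SucI:
  assumes g: "C_class j sc (ext_space E) F (ext E U) g"
    and EF: "tree_module E" "tree_module F" "U \<subseteq> topspace E"
    and eq: "\<And>x v t. x \<in> U \<Longrightarrow> v \<in> topspace E \<Longrightarrow> x + t \<bullet>\<^sub>t v \<in> U \<Longrightarrow>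
      f (x + t \<bullet>\<^sub>t v) - f x = t \<bullet>\<^sub>t g (Pair x (Pair v (Scal t)))"
  shows "difference_factor sc E F U f g" and "C_class (Suc j) sc E F U f"
proof -
  show "difference_factor sc E F U f g"
    unfolding difference_factor_def
    using eq C_class_continuous[OF g tree_module_ext_space] ext_dom_subset EF by auto
  then show "C_class (Suc j) sc E F U f" using g by auto
qed

lemma difference_factor_cong_subset:
  assumes "difference_factor sc E F U f g" "W \<subseteq> U" "\<And>x. x \<in> W \<Longrightarrow> f' x = f x"
  shows "difference_factor sc E F W f' g"
proof -
  have "continuous_map (subtopology (ext_space E) (ext E W)) F g"
    using assms(1) ext_dom_mono[OF assms(2)] unfolding difference_factor_def
    by (blast intro: continuous_map_from_subtopology_mono)
  then show ?thesis
    using assms unfolding difference_factor_def by (auto simp: subset_iff)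
qed

lemma C_class_cong_subset:
  assumes "C_class j sc E F U f" "W \<subseteq> U" "\<And>x. x \<in> W \<Longrightarrow> f' x = f x" "U \<subseteq> topspace E"
  shows "C_class j sc E F W f'"
  using assms
proof (induction j arbitrary: E U W f f')
  case 0
  then have "continuous_map (subtopology E W) F f"
    using continuous_map_from_subtopology_mono by auto
  then show ?case using 0 by (auto intro: continuous_map_eq)
next
  case (Suc j)
  then obtain g where g: "difference_factor sc E F U f g"
    "C_class j sc (ext_space E) F (ext E U) g" by auto
  have "C_class j sc (ext_space E) F (ext E W) g"
    using Suc.IH[OF g(2) ext_dom_mono[OF Suc.prems(2)]] ext_dom_subset Suc.prems by blast
  moreover have "difference_factor sc E F W f' g"
    by (rule difference_factor_cong_subset[OF g(1) Suc.prems(2,3)])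
  ultimately show ?case by auto
qed

definition tm_linear ::
  "('k, 'v) tm topology \<Rightarrow> ('k, 'v) tm topology \<Rightarrow> (('k, 'v) tm \<Rightarrow> ('k, 'v) tm) \<Rightarrow> bool" where
  "tm_linear E F f \<longleftrightarrow> continuous_map E F f \<and>
     (\<forall>p\<in>topspace E. \<forall>q\<in>topspace E. f (p + q) = f p + f q) \<and>
     (\<forall>t. \<forall>p\<in>topspace E. f (t \<bullet>\<^sub>t p) = t \<bullet>\<^sub>t f p)"

lemma tm_linearD:
  assumes "tm_linear E F f"
  shows "continuous_map E F f" "p \<in> topspace E \<Longrightarrow> f p \<in> topspace F"
    "p \<in> topspace E \<Longrightarrow> q \<in> topspace E \<Longrightarrow> f (p + q) = f p + f q"
    "p \<in> topspace E \<Longrightarrow> f (t \<bullet>\<^sub>t p) = t \<bullet>\<^sub>t f p"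
  using assms by (auto simp: tm_linear_def intro: continuous_map_in_topspace)

lemma tm_linear_id: "tm_linear E E (\<lambda>p. p)"
  using continuous_map_id[of E] by (simp add: tm_linear_def id_def)

lemma tm_linear_comp:
  assumes "tm_linear E F f" "tm_linear F G g"
  shows "tm_linear E G (\<lambda>p. g (f p))"
  using continuous_map_compose[OF tm_linearD(1)[OF assms(1)] tm_linearD(1)[OF assms(2)]]
    tm_linearD[OF assms(1)] tm_linearD[OF assms(2)]
  by (simp add: tm_linear_def o_def)

lemma tm_linear_first: "tm_linear (pair_space E F) E first"
  and tm_linear_second: "tm_linear (pair_space E F) F second"
  by (auto simp: tm_linear_def continuous_map_first continuous_map_second topspace_pair_space)

lemma tm_linear_Pair:
  assumes "tm_linear E F f" "tm_linear E G g"
  shows "tm_linear E (pair_space F G) (\<lambda>p. Pair (f p) (g p))"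
  using tm_linearD[OF assms(1)] tm_linearD[OF assms(2)]
  by (simp add: tm_linear_def continuous_map_Pair)

lemma tm_linear_zero_Vec: "tm_linear E vec_space (\<lambda>p. Vec 0)"
  and tm_linear_zero_Scal: "tm_linear E scal_space (\<lambda>p. Scal 0)"
  by (auto simp: tm_linear_def)

lemma tm_linear_sum:
  assumes "tree_module E"
  shows "tm_linear (pair_space E E) E (\<lambda>z. first z + second z)"
proof -
  have "p + q + (p' + q') = p + p' + (q + q')"
    if "p \<in> topspace E" "p' \<in> topspace E" "q \<in> topspace E" "q' \<in> topspace E" for p p' q q'
    using assms that
    by (induction E arbitrary: p p' q q') (auto simp: topspace_pair_space algebra_simps)
  then show ?thesis
    using assms unfolding tm_linear_def
    by (auto simp: topspace_pair_space tm_scale_add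
        intro!: continuous_map_tm_sum continuous_map_first continuous_map_second)
qed

text \<open>
  The factor \<open>(x, v, t) \<mapsto> f v\<close> of a linear map is again linear, so the induction on the class closes.
\<close>

lemma C_class_linear:
  assumes "tm_linear E F f" "tree_module E" "tree_module F" "U \<subseteq> topspace E"
  shows "C_class j sc E F U f"
  using assms
proof (induction j arbitrary: E U f)
  case 0
  then show ?case by (auto simp: tm_linear_def intro: continuous_map_from_subtopology)
next
  case (Suc j)
  have "tm_linear (ext_space E) F (\<lambda>z. f (first (second z)))"
    unfolding ext_space_def
    by (intro tm_linear_comp[OF tm_linear_second] tm_linear_comp[OF tm_linear_first] Suc.prems(1))
  then have "C_class j sc (ext_space E) F (ext E U) (\<lambda>z. f (first (second z)))"
    by (intro Suc.IH tree_module_ext_space ext_dom_subset Suc.prems)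
  then show ?case
  proof (rule C_class_SucI(2)[OF _ Suc.prems(2-4)])
    fix x v t assume "x \<in> U" "v \<in> topspace E"
    then have xv: "x \<in> topspace E" "v \<in> topspace E" "t \<bullet>\<^sub>t v \<in> topspace E"
      using Suc.prems(2,4) by (auto intro: tm_scale_closed)
    have "f (x + t \<bullet>\<^sub>t v) = f x + t \<bullet>\<^sub>t f v"
      using xv tm_linearD(3,4)[OF Suc.prems(1)] by simp
    moreover have "f x \<in> topspace F" "t \<bullet>\<^sub>t f v \<in> topspace F"
      using xv tm_linearD(2)[OF Suc.prems(1)] Suc.prems(3) by (auto intro: tm_scale_closed)
    ultimately show "f (x + t \<bullet>\<^sub>t v) - f x = t \<bullet>\<^sub>t f (first (second (Pair x (Pair v (Scal t)))))"
      using Suc.prems(3) by (simp add: tm_add_diff_cancel)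
  qed
qed

lemma C_class_Pair:
  assumes "C_class j sc E F U f" "C_class j sc E G U g"
    and "tree_module E" "tree_module F" "tree_module G" "U \<subseteq> topspace E"
  shows "C_class j sc E (pair_space F G) U (\<lambda>x. Pair (f x) (g x))"
  using assms
proof (induction j arbitrary: E U f g)
  case 0
  then show ?case by (simp add: continuous_map_Pair)
next
  case (Suc j)
  then obtain f' g' where
    f': "difference_factor sc E F U f f'" "C_class j sc (ext_space E) F (ext E U) f'" and
    g': "difference_factor sc E G U g g'" "C_class j sc (ext_space E) G (ext E U) g'" by auto
  then have "C_class j sc (ext_space E) (pair_space F G) (ext E U) (\<lambda>z. Pair (f' z) (g' z))"
    by (intro Suc.IH tree_module_ext_space ext_dom_subset Suc.prems)
  then show ?case
    by (rule C_class_SucI(2))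
      (use Suc.prems f' g' in \<open>auto intro: tree_module.intros dest: difference_factorD\<close>)
qed

text \<open>
  If \<open>f'\<close> and \<open>h'\<close> are factors of \<open>f\<close> and \<open>h\<close>, then \<open>h' (f x, f' (x, v, t), t)\<close> is a factor of the
  composition, because \<open>f (x + t v) = f x + t f' (x, v, t)\<close> is again a point on a line.
\<close>

lemma difference_factor_comp:
  assumes f': "difference_factor sc E F U f f'" and h': "difference_factor sc F G U' h h'"
    and EFG: "tree_module E" "tree_module F" and U: "U \<subseteq> topspace E"
    and sub: "f ` U \<subseteq> U'"
    and xv: "x \<in> U" "v \<in> topspace E" "x + t \<bullet>\<^sub>t v \<in> U"
  shows "Pair (f x) (Pair (f' (Pair x (Pair v (Scal t)))) (Scal t)) \<in> ext F U'"
    and "h (f (x + t \<bullet>\<^sub>t v)) - h (f x) =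
      t \<bullet>\<^sub>t h' (Pair (f x) (Pair (f' (Pair x (Pair v (Scal t)))) (Scal t)))"
proof -
  have *: "f x + t \<bullet>\<^sub>t f' (Pair x (Pair v (Scal t))) = f (x + t \<bullet>\<^sub>t v)"
    by (rule difference_factor_step[OF f' EFG U xv])
  have **: "f' (Pair x (Pair v (Scal t))) \<in> topspace F"
    by (rule difference_factor_value[OF f' U]) (use xv in simp)
  show "Pair (f x) (Pair (f' (Pair x (Pair v (Scal t)))) (Scal t)) \<in> ext F U'"
    using * ** xv sub by auto
  then show "h (f (x + t \<bullet>\<^sub>t v)) - h (f x) =
      t \<bullet>\<^sub>t h' (Pair (f x) (Pair (f' (Pair x (Pair v (Scal t)))) (Scal t)))"
    using difference_factorD[OF h', of "f x" "f' (Pair x (Pair v (Scal t)))" t] * by simp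
qed

text \<open>
  The induction runs over all modules at once, since the factor of a composition is a composition
  of maps between larger modules; it has one class less than the given maps.
\<close>

lemma C_class_comp:
  assumes "C_class j sc E F U f" "C_class j sc F G U' h" "f ` U \<subseteq> U'"
    and "tree_module E" "tree_module F" "tree_module G" "U \<subseteq> topspace E" "U' \<subseteq> topspace F"
  shows "C_class j sc E G U (\<lambda>x. h (f x))"
  using assms
proof (induction j arbitrary: E F G U f U' h)
  case 0
  then have "continuous_map (subtopology E U) (subtopology F U') f"
    by (auto simp: continuous_map_in_subtopology)
  then show ?case using 0 continuous_map_compose by (fastforce simp: o_def)
next
  case (Suc j)
  note prems = Suc.prems
  obtain f' h' where
    f': "difference_factor sc E F U f f'" "C_class j sc (ext_space E) F (ext E U) f'" and
    h': "difference_factor sc F G U' h h'" "C_class j sc (ext_space F) G (ext F U') h'"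
    using prems by auto
  note ext = tree_module_ext_space[OF prems(4)] ext_dom_subset[OF prems(7)]
  have "C_class j sc (ext_space E) F (ext E U) (\<lambda>z. f (first z))"
  proof (rule Suc.IH[where f = first and h = f and F = E and U' = U])
    show "C_class j sc (ext_space E) E (ext E U) first"
      by (rule C_class_linear) (use ext prems in \<open>auto simp: ext_space_def tm_linear_first\<close>)
    show "C_class j sc E F U f" by (rule C_class_SucD) (use prems in auto)
  qed (use ext prems in \<open>auto elim!: in_ext_domE\<close>)
  moreover have "C_class j sc (ext_space E) scal_space (ext E U) (\<lambda>z. second (second z))"
    by (rule C_class_linear)
      (use ext in \<open>auto simp: ext_space_def intro: tm_linear_comp[OF tm_linear_second] tm_linear_second tree_module.intros\<close>)
  ultimately have "C_class j sc (ext_space E) (ext_space F) (ext E U)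
      (\<lambda>z. Pair (f (first z)) (Pair (f' z) (second (second z))))"
    using f'(2) ext prems unfolding ext_space_def[of F]
    by (intro C_class_Pair tree_module.intros)
  moreover have "(\<lambda>z. Pair (f (first z)) (Pair (f' z) (second (second z)))) ` ext E U \<subseteq> ext F U'"
    using difference_factor_comp(1)[OF f'(1) h'(1) prems(4,5,7,3)] by (auto elim!: in_ext_domE)
  ultimately have "C_class j sc (ext_space E) G (ext E U)
      (\<lambda>z. h' (Pair (f (first z)) (Pair (f' z) (second (second z)))))"
    using ext prems h'(2) tree_module_ext_space ext_dom_subset by (intro Suc.IH[OF _ h'(2)]) auto
  then show ?case
    by (rule C_class_SucI(2)[OF _ prems(4,6,7)])
      (use difference_factor_comp(2)[OF f'(1) h'(1) prems(4,5,7,3)] in simp)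
qed

end


section \<open>Tangent maps: chain rule and symmetry of second derivatives\<close>

context topological_module
begin

lemma continuous_map_on_line:
  assumes "continuous_map (subtopology X D) F g" "continuous_map euclidean X l"
    and "\<And>t. t \<in> T \<Longrightarrow> l t \<in> D"
  shows "continuous_map (top_of_set T) F (\<lambda>t. g (l t))"
proof -
  have "continuous_map (top_of_set T) (subtopology X D) l"
    using assms(2,3) by (auto simp: continuous_map_in_subtopology continuous_map_from_subtopology)
  from continuous_map_compose[OF this assms(1)] show ?thesis by (simp add: o_def)
qed

lemma unit_scale_cancel:
  assumes "tree_module E" "p \<in> topspace E" "q \<in> topspace E" "t dvd 1" "t \<bullet>\<^sub>t p = t \<bullet>\<^sub>t q"
  shows "p = q"
proof -
  obtain s where "1 = s * t" using assms(4) by (metis dvdE mult.commute)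
  then show ?thesis
    using assms tm_scale_scale[of E p p s t] tm_scale_scale[of E q q s t] tm_scale_one[of E p p]
      tm_scale_one[of E q q] by metis
qed

text \<open>
  For a unit \<open>t\<close> the factor is the difference quotient; along the line of all \<open>t\<close> for fixed \<open>x\<close> and
  \<open>v\<close>, density of the units extends the equality to every \<open>t\<close>.
\<close>

lemma difference_factor_unique:
  assumes g: "difference_factor sc E F U f g" and h: "difference_factor sc E F U f h"
    and EF: "tree_module E" "tree_module F" and U: "openin E U" and z: "z \<in> ext E U"
  shows "g z = h z"
proof -
  have sub: "U \<subseteq> topspace E" using U openin_subset by blast
  obtain x v t0 where z': "z = Pair x (Pair v (Scal t0))"
    and x: "x \<in> U" and v: "v \<in> topspace E" and "x + t0 \<bullet>\<^sub>t v \<in> U"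
    using z by (rule in_ext_domE)
  define T where "T = {t. x + t \<bullet>\<^sub>t v \<in> U}"
  have xv: "x \<in> topspace E" using x sub by auto
  have t0: "t0 \<in> T" using \<open>x + t0 \<bullet>\<^sub>t v \<in> U\<close> by (simp add: T_def)
  have l: "continuous_map euclidean (ext_space E) (\<lambda>t. Pair x (Pair v (Scal t)))"
    unfolding ext_space_def using xv v
    by (intro continuous_map_Pair) (auto simp: continuous_map_scal_space)
  have "open T" unfolding T_def by (rule openin_line[OF EF(1) U xv v])
  moreover have "Hausdorff_space F" by (rule Hausdorff_tree_module[OF EF(2)])
  moreover have "continuous_map (top_of_set T) F (\<lambda>t. g (Pair x (Pair v (Scal t))))"
    and "continuous_map (top_of_set T) F (\<lambda>t. h (Pair x (Pair v (Scal t))))"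
    using g h x v
    by (auto simp: difference_factor_def T_def intro!: continuous_map_on_line[OF _ l])
  moreover have "g (Pair x (Pair v (Scal t))) = h (Pair x (Pair v (Scal t)))"
    if "t \<in> T" "t dvd 1" for t
  proof (rule unit_scale_cancel[OF EF(2) _ _ that(2)])
    have e: "Pair x (Pair v (Scal t)) \<in> ext E U" and t: "x + t \<bullet>\<^sub>t v \<in> U"
      using that x v by (auto simp: T_def)
    show "g (Pair x (Pair v (Scal t))) \<in> topspace F" "h (Pair x (Pair v (Scal t))) \<in> topspace F"
      using difference_factor_value[OF g sub e] difference_factor_value[OF h sub e] .
    show "t \<bullet>\<^sub>t g (Pair x (Pair v (Scal t))) = t \<bullet>\<^sub>t h (Pair x (Pair v (Scal t)))"
      using difference_factorD[OF g x v t] difference_factorD[OF h x v t] by simp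
  qed
  ultimately show ?thesis unfolding z' using t0 by (rule eq_if_eq_on_units)
qed

lemma zero_direction:
  assumes "tree_module E" "U \<subseteq> topspace E" "x \<in> U" "v \<in> topspace E"
  shows "Pair x (Pair v (Scal 0)) \<in> ext E U"
  using tm_scale_zero_right[of E x v] assms by auto

lemma differential_eq:
  assumes "difference_factor sc E F U f g" "tree_module E" "tree_module F" "openin E U"
    and "x \<in> U" "v \<in> topspace E"
  shows "differential sc E F U f x v = g (Pair x (Pair v (Scal 0)))"
  unfolding differential_def
  by (rule difference_factor_unique[OF someI[where P = "difference_factor sc E F U f", OF assms(1)]
        assms(1-4) zero_direction[OF assms(2) openin_subset[OF assms(4)] assms(5,6)]])

lemma smooth_maps:
  assumes "smooth sc E F U f" "tree_module E" "tree_module F" "U \<subseteq> topspace E" "x \<in> U"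
  shows "f x \<in> topspace F"
  using C_class_maps[of 0, OF _ assms(2-5)] assms(1) unfolding smooth_def by blast

lemma smooth_linear:
  assumes "tm_linear E F f" "tree_module E" "tree_module F" "U \<subseteq> topspace E"
  shows "smooth sc E F U f"
  using C_class_linear[OF assms] by (simp add: smooth_def)

lemma smooth_Pair:
  assumes "smooth sc E F U f" "smooth sc E G U g"
    and "tree_module E" "tree_module F" "tree_module G" "U \<subseteq> topspace E"
  shows "smooth sc E (pair_space F G) U (\<lambda>x. Pair (f x) (g x))"
  using C_class_Pair[OF _ _ assms(3-6)] assms(1,2) by (simp add: smooth_def)

lemma smooth_comp:
  assumes "smooth sc E F U f" "smooth sc F G U' h" "f ` U \<subseteq> U'"
    and "tree_module E" "tree_module F" "tree_module G" "U \<subseteq> topspace E" "U' \<subseteq> topspace F"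
  shows "smooth sc E G U (\<lambda>x. h (f x))"
  using C_class_comp[OF _ _ assms(3-8)] assms(1,2) by (simp add: smooth_def)

lemma smooth_cong_subset:
  assumes "smooth sc E F U f" "W \<subseteq> U" "\<And>x. x \<in> W \<Longrightarrow> f' x = f x" "U \<subseteq> topspace E"
  shows "smooth sc E F W f'"
  using C_class_cong_subset[OF _ assms(2-4)] assms(1) by (simp add: smooth_def)

lemma openin_ext_dom:
  assumes "tree_module E" "openin E U"
  shows "openin (ext_space E) (ext E U)"
proof -
  have 1: "continuous_map (ext_space E) E first"
    unfolding ext_space_def by (rule continuous_map_first)
  have 2: "continuous_map (ext_space E) E (\<lambda>z. first (second z))"
    and 3: "continuous_map (ext_space E) scal_space (\<lambda>z. second (second z))"
    unfolding ext_space_def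
    by (auto intro: continuous_map_first_of continuous_map_second_of continuous_map_second)
  have "continuous_map (ext_space E) E
      (\<lambda>z. first z + scal_of (second (second z)) \<bullet>\<^sub>t first (second z))"
    using assms 1 2 3 by (intro continuous_map_tm_sum continuous_map_tscale continuous_map_scal_of_comp)
  from openin_Int[OF openin_continuous_map_preimage[OF 1 assms(2)]
      openin_continuous_map_preimage[OF this assms(2)]]
  show ?thesis
    by (rule back_subst[of "openin (ext_space E)"])
      (use openin_subset[OF assms(2)] in \<open>auto elim!: in_ext_spaceE in_ext_domE\<close>)
qed

text \<open>
  The definition of \<open>C\<^sup>j\<close> provides a factor for each \<open>j\<close> separately.  By uniqueness they agree, so one
  factor is of every class.
\<close>

lemma smooth_obtain_factor:
  assumes "smooth sc E F U f" "tree_module E" "tree_module F" "openin E U"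
  obtains g where "difference_factor sc E F U f g" "smooth sc (ext_space E) F (ext E U) g"
proof -
  have C: "\<exists>g. difference_factor sc E F U f g \<and> C_class j sc (ext_space E) F (ext E U) g" for j
    using assms(1) C_class.simps(2) unfolding smooth_def by blast
  then obtain g where g: "difference_factor sc E F U f g" by blast
  have "C_class j sc (ext_space E) F (ext E U) g" for j
  proof -
    obtain h where h: "difference_factor sc E F U f h" "C_class j sc (ext_space E) F (ext E U) h"
      using C by blast
    show ?thesis
      by (rule C_class_cong_subset[OF h(2) subset_refl])
        (use difference_factor_unique[OF g h(1) assms(2-4)] ext_dom_subset openin_subset[OF assms(4)] in auto)
  qed
  with g that show ?thesis by (simp add: smooth_def)
qed

lemma smooth_difference_factorI:
  assumes "smooth sc (ext_space E) F (ext E U) g"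
    and "tree_module E" "tree_module F" "U \<subseteq> topspace E"
    and "\<And>x v t. x \<in> U \<Longrightarrow> v \<in> topspace E \<Longrightarrow> x + t \<bullet>\<^sub>t v \<in> U \<Longrightarrow>
      f (x + t \<bullet>\<^sub>t v) - f x = t \<bullet>\<^sub>t g (Pair x (Pair v (Scal t)))"
  shows "difference_factor sc E F U f g"
  using C_class_SucI(1)[OF _ assms(2-5)] assms(1) unfolding smooth_def by blast

lemma differential_linear:
  assumes "tm_linear E F f" "tree_module E" "tree_module F" "openin E U" "x \<in> U" "v \<in> topspace E"
  shows "differential sc E F U f x v = f v"
proof -
  have U: "U \<subseteq> topspace E" using assms(4) openin_subset by blast
  have "tm_linear (ext_space E) F (\<lambda>z. f (first (second z)))"
    unfolding ext_space_def
    by (intro tm_linear_comp[OF tm_linear_second] tm_linear_comp[OF tm_linear_first] assms(1))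
  then have "smooth sc (ext_space E) F (ext E U) (\<lambda>z. f (first (second z)))"
    by (rule smooth_linear[OF _ tree_module_ext_space[OF assms(2)] assms(3) ext_dom_subset[OF U]])
  then have "difference_factor sc E F U f (\<lambda>z. f (first (second z)))"
  proof (rule smooth_difference_factorI)
    fix x v t assume "x \<in> U" and v: "v \<in> topspace E"
    then have x: "x \<in> topspace E" using U by auto
    have "f (x + t \<bullet>\<^sub>t v) = f x + t \<bullet>\<^sub>t f v"
      using x v tm_linearD(3,4)[OF assms(1)] tm_scale_closed[OF assms(2)] by simp
    then show "f (x + t \<bullet>\<^sub>t v) - f x = t \<bullet>\<^sub>t f (first (second (Pair x (Pair v (Scal t)))))"
      using tm_linearD(2)[OF assms(1)] x v tm_scale_closed[OF assms(3)]
        tm_add_diff_cancel[OF assms(3), of "f x" "t \<bullet>\<^sub>t f v"] by simp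
  qed (use assms U in auto)
  from differential_eq[OF this assms(2-6)] show ?thesis by simp
qed

lemma differential_maps:
  assumes "smooth sc E F U f" "tree_module E" "tree_module F" "openin E U" "x \<in> U" "v \<in> topspace E"
  shows "differential sc E F U f x v \<in> topspace F"
proof -
  obtain g where g: "difference_factor sc E F U f g"
    using smooth_obtain_factor[OF assms(1-4)] by metis
  have U: "U \<subseteq> topspace E" using assms(4) openin_subset by blast
  show ?thesis
    unfolding differential_eq[OF g assms(2-6)]
    by (rule difference_factor_value[OF g U zero_direction[OF assms(2) U assms(5,6)]])
qed

abbreviation tangent where "tangent \<equiv> tangent_map sc"

abbreviation at_zero :: "('k, 'v) tm \<Rightarrow> ('k, 'v) tm" where
  "at_zero \<equiv> \<lambda>z. Pair (first z) (Pair (second z) (Scal 0))"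

lemma tm_linear_at_zero: "tm_linear (pair_space E E) (ext_space E) at_zero"
  unfolding ext_space_def
  by (intro tm_linear_Pair tm_linear_first tm_linear_second tm_linear_zero_Scal)

lemma at_zero_maps:
  assumes "tree_module E" "U \<subseteq> topspace E"
  shows "at_zero ` tangent_dom E U \<subseteq> ext E U"
  using zero_direction[OF assms] by (auto elim!: in_tangent_domE)

lemma smooth_differential:
  assumes f: "smooth sc E F U f" and EF: "tree_module E" "tree_module F" and U: "openin E U"
  shows "smooth sc (pair_space E E) F (tangent_dom E U)
    (\<lambda>z. differential sc E F U f (first z) (second z))"
proof -
  have sub: "U \<subseteq> topspace E" using U openin_subset by blast
  obtain g where g: "difference_factor sc E F U f g" "smooth sc (ext_space E) F (ext E U) g"
    using smooth_obtain_factor[OF f EF U] by metis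
  have "smooth sc (pair_space E E) (ext_space E) (tangent_dom E U) at_zero"
    by (rule smooth_linear[OF tm_linear_at_zero])
      (use EF tangent_dom_subset[OF sub] in \<open>auto intro: tree_module.intros tree_module_ext_space\<close>)
  then have "smooth sc (pair_space E E) F (tangent_dom E U) (\<lambda>z. g (at_zero z))"
    by (rule smooth_comp[OF _ g(2) at_zero_maps[OF EF(1) sub]])
      (use EF tangent_dom_subset[OF sub] ext_dom_subset[OF sub] in
        \<open>auto intro: tree_module.intros tree_module_ext_space\<close>)
  then show ?thesis
    by (rule smooth_cong_subset[OF _ subset_refl])
      (use differential_eq[OF g(1) EF U] tangent_dom_subset[OF sub] in \<open>auto elim!: in_tangent_domE\<close>)
qed

lemma smooth_tangent:
  assumes f: "smooth sc E F U f" and EF: "tree_module E" "tree_module F" and U: "openin E U"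
  shows "smooth sc (pair_space E E) (pair_space F F) (tangent_dom E U) (tangent E F U f)"
proof -
  have sub: "U \<subseteq> topspace E" using U openin_subset by blast
  note sub' = tangent_dom_subset[OF sub]
  have "smooth sc (pair_space E E) E (tangent_dom E U) first"
    using EF sub' by (intro smooth_linear tm_linear_first tree_module.intros)
  then have "smooth sc (pair_space E E) F (tangent_dom E U) (\<lambda>z. f (first z))"
    by (rule smooth_comp[OF _ f])
      (use EF sub sub' in \<open>auto intro: tree_module.intros elim!: in_tangent_domE\<close>)
  then have "smooth sc (pair_space E E) (pair_space F F) (tangent_dom E U)
      (\<lambda>z. Pair (f (first z)) (differential sc E F U f (first z) (second z)))"
    by (intro smooth_Pair smooth_differential f EF U tree_module.intros sub')
  then show ?thesis by (simp add: tangent_map_def[abs_def])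
qed

lemma tangent_maps:
  assumes "smooth sc E F U f" "tree_module E" "tree_module F" "openin E U"
    and "f ` U \<subseteq> U'" "z \<in> tangent_dom E U"
  shows "tangent E F U f z \<in> tangent_dom F U'"
  using assms(5,6) differential_maps[OF assms(1-4)]
  by (auto simp: tangent_map_def elim!: in_tangent_domE)

text \<open>
  The chain rule.  The three maps have their own domains and need to be related on a smaller open
  set \<open>W\<close> only, which makes this also the statement that differentials are local.  Changes of
  charts need this form: the transition maps between three charts compose on a triple overlap only.
\<close>

lemma differential_chain:
  assumes f: "smooth sc E F U f" and g: "smooth sc F G U' g" and h: "smooth sc E G W' h"
    and tree: "tree_module E" "tree_module F" "tree_module G"
    and opens: "openin E U" "openin F U'" "openin E W'" "openin E W"
    and sub: "W \<subseteq> U" "W \<subseteq> W'" "f ` W \<subseteq> U'"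
    and eq: "\<And>y. y \<in> W \<Longrightarrow> h y = g (f y)"
    and xv: "x \<in> W" "v \<in> topspace E"
  shows "differential sc E G W' h x v =
    differential sc F G U' g (f x) (differential sc E F U f x v)"
proof -
  have tops: "U \<subseteq> topspace E" "U' \<subseteq> topspace F" "W' \<subseteq> topspace E" "W \<subseteq> topspace E"
    using opens openin_subset by blast+
  have fW: "smooth sc E F W f" by (rule smooth_cong_subset[OF f sub(1) refl tops(1)])
  obtain f' where f': "difference_factor sc E F U f f'" "smooth sc (ext_space E) F (ext E U) f'"
    using smooth_obtain_factor[OF f tree(1,2) opens(1)] by metis
  obtain g' where g': "difference_factor sc F G U' g g'" "smooth sc (ext_space F) G (ext F U') g'"
    using smooth_obtain_factor[OF g tree(2,3) opens(2)] by metis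
  obtain h' where h': "difference_factor sc E G W' h h'"
    using smooth_obtain_factor[OF h tree(1,3) opens(3)] by metis
  have f'W: "difference_factor sc E F W f f'" "smooth sc (ext_space E) F (ext E W) f'"
    by (rule difference_factor_cong_subset[OF f'(1) sub(1) refl],
        rule smooth_cong_subset[OF f'(2) ext_dom_mono[OF sub(1)] refl ext_dom_subset[OF tops(1)]])
  note comp = difference_factor_comp[OF f'W(1) g'(1) tree(1,2) tops(4) sub(3)]
  note ext = tree_module_ext_space[OF tree(1)] ext_dom_subset[OF tops(4)]
  let ?i = "\<lambda>z. Pair (f (first z)) (Pair (f' z) (second (second z)))"
  have "smooth sc (ext_space E) E (ext E W) first"
    by (rule smooth_linear) (use ext tree in \<open>auto simp: ext_space_def tm_linear_first\<close>)
  then have "smooth sc (ext_space E) F (ext E W) (\<lambda>z. f (first z))"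
    by (rule smooth_comp[OF _ fW]) (use ext tree tops in \<open>auto elim!: in_ext_domE\<close>)
  moreover have "smooth sc (ext_space E) scal_space (ext E W) (\<lambda>z. second (second z))"
    by (rule smooth_linear)
      (use ext in \<open>auto simp: ext_space_def intro: tm_linear_comp[OF tm_linear_second] tm_linear_second tree_module.intros\<close>)
  ultimately have "smooth sc (ext_space E) (ext_space F) (ext E W) ?i"
    using f'W(2) ext tree unfolding ext_space_def[of F]
    by (intro smooth_Pair tree_module.intros)
  moreover have "?i ` ext E W \<subseteq> ext F U'" using comp(1) by (auto elim!: in_ext_domE)
  ultimately have "smooth sc (ext_space E) G (ext E W) (\<lambda>z. g' (?i z))"
    using ext tree tops tree_module_ext_space ext_dom_subset by (intro smooth_comp[OF _ g'(2)]) auto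
  then have 1: "difference_factor sc E G W (\<lambda>y. g (f y)) (\<lambda>z. g' (?i z))"
    by (rule smooth_difference_factorI[OF _ tree(1,3) tops(4)]) (use comp(2) in simp)
  have 2: "difference_factor sc E G W (\<lambda>y. g (f y)) h'"
    by (rule difference_factor_cong_subset[OF h' sub(2)]) (simp add: eq)
  have x0: "Pair x (Pair v (Scal 0)) \<in> ext E W"
    by (rule zero_direction[OF tree(1) tops(4) xv])
  have "h' (Pair x (Pair v (Scal 0))) =
      g' (Pair (f x) (Pair (f' (Pair x (Pair v (Scal 0)))) (Scal 0)))"
    using difference_factor_unique[OF 2 1 tree(1,3) opens(4) x0] by simp
  moreover have "x \<in> U" "x \<in> W'" "f x \<in> U'" using sub xv by auto
  moreover have "f' (Pair x (Pair v (Scal 0))) \<in> topspace F"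
    by (rule difference_factor_value[OF f'W(1) tops(4) x0])
  ultimately show ?thesis
    using differential_eq[OF f'(1) tree(1,2) opens(1)] differential_eq[OF g'(1) tree(2,3) opens(2)]
      differential_eq[OF h' tree(1,3) opens(3)] xv by simp
qed

lemma tangent_chain:
  assumes f: "smooth sc E F U f" and g: "smooth sc F G U' g" and h: "smooth sc E G W' h"
    and tree: "tree_module E" "tree_module F" "tree_module G"
    and opens: "openin E U" "openin F U'" "openin E W'" "openin E W"
    and sub: "W \<subseteq> U" "W \<subseteq> W'" "f ` W \<subseteq> U'"
    and eq: "\<And>y. y \<in> W \<Longrightarrow> h y = g (f y)"
    and z: "z \<in> tangent_dom E W"
  shows "tangent E G W' h z = tangent F G U' g (tangent E F U f z)"
proof -
  obtain x v where xv: "z = Pair x v" "x \<in> W" "v \<in> topspace E"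
    using z by (rule in_tangent_domE)
  then show ?thesis
    using differential_chain[OF f g h tree opens sub eq, of x v] eq
    by (simp add: tangent_map_def)
qed

lemma tangent_linear:
  assumes "tm_linear E F f" "tree_module E" "tree_module F" "openin E U" "x \<in> U" "v \<in> topspace E"
  shows "tangent E F U f (Pair x v) = Pair (f x) (f v)"
  using differential_linear[OF assms] by (simp add: tangent_map_def)

text \<open>
  Schwarz's theorem.  The iterated difference quotient is, up to the factor \<open>s\<^sup>2\<close>, the alternating
  sum of \<open>f\<close> over the vertices \<open>x\<close>, \<open>x + s u\<close>, \<open>x + s v\<close> and \<open>x + s (u + v + s w)\<close>, where both
  steps use the same parameter \<open>s\<close>; so one parameter suffices for the density argument.  The sum is
  symmetric in \<open>u\<close> and \<open>v\<close> for every unit \<open>s\<close>, hence the derivative is at \<open>s = 0\<close>.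
\<close>

lemma second_differential_symmetric:
  assumes f: "smooth sc E F U f" and EF: "tree_module E" "tree_module F" and U: "openin E U"
    and x: "x \<in> U" and uvw: "u \<in> topspace E" "v \<in> topspace E" "w \<in> topspace E"
  defines "D \<equiv> differential sc (pair_space E E) F (tangent_dom E U)
    (\<lambda>z. differential sc E F U f (first z) (second z))"
  shows "D (Pair x u) (Pair v w) = D (Pair x v) (Pair u w)"
proof -
  have sub: "U \<subseteq> topspace E" using U openin_subset by blast
  have xE: "x \<in> topspace E" using x sub by auto
  obtain g where g: "difference_factor sc E F U f g" "smooth sc (ext_space E) F (ext E U) g"
    using smooth_obtain_factor[OF f EF U] by metis
  note ext = tree_module_ext_space[OF EF(1)] ext_dom_subset[OF sub] openin_ext_dom[OF EF(1) U]
  obtain k where k: "difference_factor sc (ext_space E) F (ext E U) g k"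
    using smooth_obtain_factor[OF g(2) ext(1) EF(2) ext(3)] by metis
  \<comment> \<open>the second factor on the diagonal; at \<open>s = 0\<close> it is the second derivative\<close>
  define K where "K u v s = k (Pair (Pair x (Pair u (Scal s)))
      (Pair (Pair v (Pair w (Scal 0))) (Scal s)))" for u v s
  have D: "D (Pair x u) (Pair v w) = K u v 0"
    if "u \<in> topspace E" "v \<in> topspace E" for u v
  proof -
    have "D (Pair x u) (Pair v w) = differential sc (ext_space E) F (ext E U) g (at_zero (Pair x u))
       (differential sc (pair_space E E) (ext_space E) (tangent_dom E U) at_zero (Pair x u) (Pair v w))"
      unfolding D_def
    proof (rule differential_chain[where W = "tangent_dom E U"])
      show "smooth sc (pair_space E E) (ext_space E) (tangent_dom E U) at_zero"
        by (rule smooth_linear[OF tm_linear_at_zero])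
          (use EF ext tangent_dom_subset[OF sub] in \<open>auto intro: tree_module.intros\<close>)
      show "at_zero ` tangent_dom E U \<subseteq> ext E U" by (rule at_zero_maps[OF EF(1) sub])
      show "differential sc E F U f (first y) (second y) = g (at_zero y)" if "y \<in> tangent_dom E U" for y
        using that differential_eq[OF g(1) EF U] by (auto elim!: in_tangent_domE)
    qed (use EF g ext x that uvw in
        \<open>auto intro: smooth_differential[OF f EF U] tree_module.intros openin_tangent_dom[OF U]\<close>)
    also have "differential sc (pair_space E E) (ext_space E) (tangent_dom E U) at_zero
        (Pair x u) (Pair v w) = at_zero (Pair v w)"
      by (rule differential_linear[OF tm_linear_at_zero])
        (use EF ext x that uvw in \<open>auto intro: tree_module.intros openin_tangent_dom[OF U]\<close>)
    also have "differential sc (ext_space E) F (ext E U) g (at_zero (Pair x u)) (at_zero (Pair v w)) =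
        k (Pair (at_zero (Pair x u)) (Pair (at_zero (Pair v w)) (Scal 0)))"
      by (rule differential_eq[OF k ext(1) EF(2) ext(3)])
        (use zero_direction[OF EF(1) sub x] that uvw in auto)
    finally show ?thesis by (simp add: K_def)
  qed
  define T where "T = {s. x + s \<bullet>\<^sub>t u \<in> U} \<inter> {s. x + s \<bullet>\<^sub>t v \<in> U} \<inter>
    {s. x + s \<bullet>\<^sub>t (u + v + s \<bullet>\<^sub>t w) \<in> U}"
  have corner: "x + s \<bullet>\<^sub>t v + s \<bullet>\<^sub>t (u + s \<bullet>\<^sub>t w) = x + s \<bullet>\<^sub>t (u + v + s \<bullet>\<^sub>t w)"
    "x + s \<bullet>\<^sub>t u + s \<bullet>\<^sub>t (v + s \<bullet>\<^sub>t w) = x + s \<bullet>\<^sub>t (u + v + s \<bullet>\<^sub>t w)" for s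
    using EF(1) xE uvw
    by (induction E arbitrary: x u v w)
      (auto simp: topspace_pair_space tm_simps scale_left_commute algebra_simps)
  have "K u v 0 = K v u 0"
  proof (rule eq_if_eq_on_units[where D = T and F = F])
    have "continuous_map euclidean E (\<lambda>s. x + s \<bullet>\<^sub>t (u + v + s \<bullet>\<^sub>t w))"
      using EF xE uvw by (intro continuous_map_tm_sum continuous_map_tscale) (auto simp: tm_sum_closed)
    from openin_continuous_map_preimage[OF this U]
    show "open T" unfolding T_def using openin_line[OF EF(1) U xE] uvw by (intro open_Int) auto
    show "Hausdorff_space F" by (rule Hausdorff_tree_module[OF EF(2)])
    have dom: "Pair (Pair x (Pair u (Scal s))) (Pair (Pair v (Pair w (Scal 0))) (Scal s))
        \<in> ext (ext_space E) (ext E U)"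
      if "s \<in> {s. x + s \<bullet>\<^sub>t u \<in> U} \<inter> {s. x + s \<bullet>\<^sub>t v \<in> U}"
        "x + s \<bullet>\<^sub>t v + s \<bullet>\<^sub>t (u + s \<bullet>\<^sub>t w) \<in> U"
        "u \<in> topspace E" "v \<in> topspace E" for s u v
      using that x uvw EF by (auto simp: tm_sum_closed tm_scale_closed)
    have line: "continuous_map euclidean (ext_space (ext_space E)) (\<lambda>s.
        Pair (Pair x (Pair u (Scal s))) (Pair (Pair v (Pair w (Scal 0))) (Scal s)))"
      if "u \<in> topspace E" "v \<in> topspace E" for u v
      unfolding ext_space_def using that xE uvw
      by (intro continuous_map_Pair) (auto simp: continuous_map_scal_space)
    have k': "continuous_map (subtopology (ext_space (ext_space E)) (ext (ext_space E) (ext E U))) F k"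
      using k by (simp add: difference_factor_def)
    show "continuous_map (top_of_set T) F (K u v)"
      unfolding K_def
      by (rule continuous_map_on_line[OF k' line[OF uvw(1,2)] dom]) (use uvw in \<open>auto simp: T_def corner\<close>)
    show "continuous_map (top_of_set T) F (K v u)"
      unfolding K_def
      by (rule continuous_map_on_line[OF k' line[OF uvw(2,1)] dom]) (use uvw in \<open>auto simp: T_def corner\<close>)
    show "0 \<in> T"
      using tm_scale_zero_right[OF EF(1) xE] x uvw EF(1) by (auto simp: T_def tm_sum_closed tm_scale_closed)
    have quotient: "s \<bullet>\<^sub>t s \<bullet>\<^sub>t K u v s =
        (f (x + s \<bullet>\<^sub>t (u + v + s \<bullet>\<^sub>t w)) - f (x + s \<bullet>\<^sub>t v)) - (f (x + s \<bullet>\<^sub>t u) - f x)"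
      and K_closed: "K u v s \<in> topspace F"
      if s: "x + s \<bullet>\<^sub>t u \<in> U" "x + s \<bullet>\<^sub>t v \<in> U" "x + s \<bullet>\<^sub>t (u + v + s \<bullet>\<^sub>t w) \<in> U"
        and uv: "u \<in> topspace E" "v \<in> topspace E"
        and c: "x + s \<bullet>\<^sub>t v + s \<bullet>\<^sub>t (u + s \<bullet>\<^sub>t w) = x + s \<bullet>\<^sub>t (u + v + s \<bullet>\<^sub>t w)" for s u v
    proof -
      have uw: "u + s \<bullet>\<^sub>t w \<in> topspace E" using uv uvw EF by (auto intro: tm_sum_closed tm_scale_closed)
      let ?a = "Pair (x + s \<bullet>\<^sub>t v) (Pair (u + s \<bullet>\<^sub>t w) (Scal s))" and ?b = "Pair x (Pair u (Scal s))"
      have ab: "?a \<in> ext E U" "?b \<in> ext E U" using s uv uw x c by auto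
      have "g ?a - g ?b = s \<bullet>\<^sub>t K u v s"
        using difference_factorD[OF k, of ?b "Pair v (Pair w (Scal 0))" s] ab uv uvw
        by (simp add: K_def)
      moreover have "s \<bullet>\<^sub>t g ?a - s \<bullet>\<^sub>t g ?b = s \<bullet>\<^sub>t (g ?a - g ?b)"
        by (rule tm_scale_diff[OF EF(2)]) (use ab in \<open>auto intro: difference_factor_value[OF g(1) sub]\<close>)
      moreover have "s \<bullet>\<^sub>t g ?a = f (x + s \<bullet>\<^sub>t (u + v + s \<bullet>\<^sub>t w)) - f (x + s \<bullet>\<^sub>t v)"
        using difference_factorD[OF g(1), of "x + s \<bullet>\<^sub>t v" "u + s \<bullet>\<^sub>t w" s] ab c by simp
      moreover have "s \<bullet>\<^sub>t g ?b = f (x + s \<bullet>\<^sub>t u) - f x"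
        using difference_factorD[OF g(1), of x u s] ab by simp
      ultimately show "s \<bullet>\<^sub>t s \<bullet>\<^sub>t K u v s =
        (f (x + s \<bullet>\<^sub>t (u + v + s \<bullet>\<^sub>t w)) - f (x + s \<bullet>\<^sub>t v)) - (f (x + s \<bullet>\<^sub>t u) - f x)" by simp
      show "K u v s \<in> topspace F"
        unfolding K_def by (rule difference_factor_value[OF k ext(2) dom]) (use s uv c in auto)
    qed
    show "K u v s = K v u s" if s: "s \<in> T" "s dvd 1" for s
    proof (rule unit_scale_cancel[OF EF(2) _ _ s(2)], rule_tac [3] unit_scale_cancel[OF EF(2) _ _ s(2)])
      have T: "x + s \<bullet>\<^sub>t u \<in> U" "x + s \<bullet>\<^sub>t v \<in> U" "x + s \<bullet>\<^sub>t (u + v + s \<bullet>\<^sub>t w) \<in> U"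
        using s by (auto simp: T_def)
      have vu: "v + u = u + v" by (rule tm_add_commute)
      show K: "K u v s \<in> topspace F" "K v u s \<in> topspace F"
        using K_closed[of s u v] K_closed[of s v u] T uvw corner[of s] vu by auto
      then show "s \<bullet>\<^sub>t K u v s \<in> topspace F" "s \<bullet>\<^sub>t K v u s \<in> topspace F"
        using tm_scale_closed[OF EF(2)] by auto
      show "s \<bullet>\<^sub>t s \<bullet>\<^sub>t K u v s = s \<bullet>\<^sub>t s \<bullet>\<^sub>t K v u s"
        using quotient[of s u v] quotient[of s v u] T uvw corner[of s] vu
          tm_diff_diff_swap[OF EF(2)] smooth_maps[OF f EF sub] x by auto
    qed
  qed
  then show ?thesis using D uvw by simp
qed

text \<open>
  In components, \<open>TTf\<close> maps \<open>((x, u), (v, w))\<close> to \<open>((f x, df x u), (df x v, d(df) (x, u) (v, w)))\<close>.  The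
  flip exchanges \<open>u\<close> and \<open>v\<close>, and the last component is symmetric in them.
\<close>

lemma tangent_tangent_flip:
  assumes f: "smooth sc E F U f" and EF: "tree_module E" "tree_module F" and U: "openin E U"
    and z: "z \<in> tangent_dom (pair_space E E) (tangent_dom E U)"
  defines "TT \<equiv> tangent (pair_space E E) (pair_space F F) (tangent_dom E U) (tangent E F U f)"
  shows "TT (flip z) = flip (TT z)"
proof -
  have sub: "U \<subseteq> topspace E" using U openin_subset by blast
  note tree = EF tree_module.pair[OF EF(1) EF(1)] tree_module.pair[OF EF(2) EF(2)]
  note Tf = smooth_tangent[OF f EF U] and TU = openin_tangent_dom[OF U]
  note subT = tangent_dom_subset[OF sub]
  let ?Df = "\<lambda>z. differential sc E F U f (first z) (second z)"
  let ?D = "differential sc (pair_space E E) (pair_space F F) (tangent_dom E U) (tangent E F U f)"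
  let ?DD = "differential sc (pair_space E E) F (tangent_dom E U) ?Df"
  have maps: "tangent E F U f ` tangent_dom E U \<subseteq> topspace (pair_space F F)"
    using smooth_maps[OF Tf tree(3,4) subT] by blast
  have first: "smooth sc (pair_space E E) E (tangent_dom E U) first"
    by (rule smooth_linear[OF tm_linear_first tree(3,1) subT])
  have fst: "first ` tangent_dom E U \<subseteq> U" by (auto elim!: in_tangent_domE)
  have f_first: "smooth sc (pair_space E E) F (tangent_dom E U) (\<lambda>z. f (first z))"
    by (rule smooth_comp[OF first f fst tree(3,1,2) subT sub])
  have D: "?D (Pair x u) (Pair v w) =
      Pair (differential sc E F U f x v) (?DD (Pair x u) (Pair v w))"
    if x: "x \<in> U" and uvw: "u \<in> topspace E" "v \<in> topspace E" "w \<in> topspace E" for x u v w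
  proof -
    have xu: "Pair x u \<in> tangent_dom E U" and vw: "Pair v w \<in> topspace (pair_space E E)"
      using x uvw by auto
    have p: "?D (Pair x u) (Pair v w) \<in> topspace (pair_space F F)"
      by (rule differential_maps[OF Tf tree(3,4) TU xu vw])
    have q: "tangent E F U f (Pair x u) \<in> topspace (pair_space F F)" using maps xu by auto
    have "differential sc (pair_space E E) F (tangent_dom E U) (\<lambda>z. f (first z)) (Pair x u) (Pair v w) =
      differential sc (pair_space F F) F (topspace (pair_space F F)) first
        (tangent E F U f (Pair x u)) (?D (Pair x u) (Pair v w))"
      by (rule differential_chain[OF Tf smooth_linear[OF tm_linear_first tree(4,2) subset_refl] f_first
            tree(3,4,2) TU openin_topspace TU TU subset_refl subset_refl maps _ xu vw])
        (simp add: tangent_map_def)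
    also have "\<dots> = first (?D (Pair x u) (Pair v w))"
      by (rule differential_linear[OF tm_linear_first tree(4,2) openin_topspace q p])
    finally have 1: "differential sc (pair_space E E) F (tangent_dom E U) (\<lambda>z. f (first z))
      (Pair x u) (Pair v w) = first (?D (Pair x u) (Pair v w))" .
    have "differential sc (pair_space E E) F (tangent_dom E U) (\<lambda>z. f (first z)) (Pair x u) (Pair v w) =
      differential sc E F U f (first (Pair x u))
        (differential sc (pair_space E E) E (tangent_dom E U) first (Pair x u) (Pair v w))"
      by (rule differential_chain[OF first f f_first tree(3,1,2) TU U TU TU subset_refl subset_refl
            fst refl xu vw])
    then have 2: "differential sc (pair_space E E) F (tangent_dom E U) (\<lambda>z. f (first z))
      (Pair x u) (Pair v w) = differential sc E F U f x v"
      using differential_linear[OF tm_linear_first tree(3,1) TU xu vw] by simp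
    have "?DD (Pair x u) (Pair v w) =
      differential sc (pair_space F F) F (topspace (pair_space F F)) second
        (tangent E F U f (Pair x u)) (?D (Pair x u) (Pair v w))"
      by (rule differential_chain[OF Tf smooth_linear[OF tm_linear_second tree(4,2) subset_refl]
            smooth_differential[OF f EF U]
            tree(3,4,2) TU openin_topspace TU TU subset_refl subset_refl maps _ xu vw])
        (simp add: tangent_map_def)
    also have "\<dots> = second (?D (Pair x u) (Pair v w))"
      by (rule differential_linear[OF tm_linear_second tree(4,2) openin_topspace q p])
    finally show ?thesis using 1 2 p by (auto simp: topspace_pair_space)
  qed
  obtain x u v w where "z = Pair (Pair x u) (Pair v w)" "x \<in> U" "u \<in> topspace E"
    "v \<in> topspace E" "w \<in> topspace E"
    using z by (auto elim!: in_tangent_domE in_pair_spaceE)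
  then show ?thesis
    using D second_differential_symmetric[OF f EF U, of x u v w]
    by (simp add: TT_def tangent_map_def)
qed

end


section \<open>Coordinates of iterated tangent spaces\<close>

lemma tcoord_cong: "\<alpha> \<inter> {..<n} = \<beta> \<inter> {..<n} \<Longrightarrow> tcoord n p \<alpha> = tcoord n p \<beta>"
proof (induction n arbitrary: p)
  case (Suc n)
  then have "\<alpha> \<inter> {..<n} = \<beta> \<inter> {..<n}" "n \<in> \<alpha> \<longleftrightarrow> n \<in> \<beta>"
    by (auto simp: lessThan_Suc set_eq_iff)
  then show ?case using Suc.IH by simp
qed simp

lemma tpoint_cong: "(\<And>\<alpha>. \<alpha> \<subseteq> {..<n} \<Longrightarrow> v \<alpha> = w \<alpha>) \<Longrightarrow> tpoint n v = tpoint n w"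
proof (induction n arbitrary: v w)
  case (Suc n)
  show ?case by (auto intro!: Suc.IH Suc.prems)
qed simp

lemma tcoord_tpoint: "tcoord n (tpoint n v) \<alpha> = v (\<alpha> \<inter> {..<n})"
proof (induction n arbitrary: v)
  case (Suc n)
  have "insert n (\<alpha> \<inter> {..<n}) = \<alpha> \<inter> {..<Suc n}" if "n \<in> \<alpha>" using that by auto
  moreover have "\<alpha> \<inter> {..<n} = \<alpha> \<inter> {..<Suc n}" if "n \<notin> \<alpha>" using that by (auto simp: less_Suc_eq)
  ultimately show ?case using Suc.IH by simp
qed simp

lemma tpoint_in_tspace [simp]: "tpoint n v \<in> topspace (tspace n)"
  by (induction n arbitrary: v) auto

lemma tpoint_tcoord: "p \<in> topspace (tspace n) \<Longrightarrow> tpoint n (tcoord n p) = p"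
proof (induction n arbitrary: p)
  case (Suc n)
  then obtain q r where p: "p = Pair q r" "q \<in> topspace (tspace n)" "r \<in> topspace (tspace n)"
    by (auto elim: in_pair_spaceE)
  have "tpoint n (tcoord (Suc n) p) = q"
    by (subst Suc.IH[OF p(2), symmetric], rule tpoint_cong) (auto simp: p(1))
  moreover have "tpoint n (\<lambda>\<alpha>. tcoord (Suc n) p (insert n \<alpha>)) = r"
    by (subst Suc.IH[OF p(3), symmetric], rule tpoint_cong) (auto simp: p(1) intro: tcoord_cong)
  ultimately show ?case using p(1) by (simp del: tcoord.simps)
qed auto

lemma tset_iff: "p \<in> tset n U \<longleftrightarrow> p \<in> topspace (tspace n) \<and> tcoord n p {} \<in> U"
proof (induction n arbitrary: p)
  case 0
  show ?case by (cases p) auto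
next
  case (Suc n)
  show ?case by (cases p) (auto simp: Suc.IH topspace_pair_space)
qed

lemma tset_Suc_tangent_dom: "tset (Suc n) U = tangent_dom (tspace n) (tset n U)"
  by (simp add: tangent_dom_def)

lemma tset_subset: "tset n U \<subseteq> topspace (tspace n)"
  by (auto simp: tset_iff)

lemma openin_tset: "open U \<Longrightarrow> openin (tspace n) (tset n U)"
proof (induction n)
  case 0
  then have "openin vec_space {p \<in> topspace vec_space. vec_of p \<in> U}"
    by (intro openin_continuous_map_preimage[OF continuous_map_vec_of]) simp
  moreover have "{p \<in> topspace vec_space. vec_of p \<in> U} = Vec ` U" by auto
  ultimately show ?case by (metis tset.simps(1) tspace.simps(1))
next
  case (Suc n)
  then show ?case unfolding tset_Suc_tangent_dom by (simp add: openin_tangent_dom)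
qed

lemma tpoint_eqI:
  assumes "p \<in> topspace (tspace n)" "\<And>\<alpha>. \<alpha> \<subseteq> {..<n} \<Longrightarrow> v \<alpha> = tcoord n p \<alpha>"
  shows "tpoint n v = p"
  by (subst tpoint_tcoord[OF assms(1), symmetric]) (rule tpoint_cong, rule assms(2))

lemma tcoord_eqI:
  assumes "p \<in> topspace (tspace n)" "q \<in> topspace (tspace n)"
    and "\<And>\<alpha>. \<alpha> \<subseteq> {..<n} \<Longrightarrow> tcoord n p \<alpha> = tcoord n q \<alpha>"
  shows "p = q"
  using tpoint_eqI[OF assms(2), of "tcoord n p"] tpoint_tcoord[OF assms(1)] assms(3) by simp


section \<open>Reindexing of coordinates\<close>

text \<open>
  The coefficient of \<open>\<epsilon>\<^sup>\<gamma>\<close> in the new point is the coefficient with index \<open>\<phi> \<gamma>\<close> of the old one, and \<open>0\<close>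
  if \<open>\<phi> \<gamma>\<close> is \<open>None\<close>.  Permutations of the units, shifts and the selection of some of the
  coefficients are all of this form, and all that is needed about them holds for this form.
\<close>

definition reindex ::
  "nat \<Rightarrow> nat \<Rightarrow> (nat set \<Rightarrow> nat set option) \<Rightarrow> ('k, 'v::zero) tm \<Rightarrow> ('k, 'v) tm" where
  "reindex m n \<phi> p = tpoint m (\<lambda>\<gamma>. case \<phi> \<gamma> of None \<Rightarrow> 0 | Some \<alpha> \<Rightarrow> tcoord n p \<alpha>)"

text \<open>
  The base point is kept, and it is not used as a coefficient elsewhere; it is the only coordinate in
  which the Christoffel tensor is not linear.
\<close>

definition index_map :: "nat \<Rightarrow> nat \<Rightarrow> (nat set \<Rightarrow> nat set option) \<Rightarrow> bool" where
  "index_map m n \<phi> \<longleftrightarrow> \<phi> {} = Some {} \<and>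
     (\<forall>\<gamma> \<alpha>. \<gamma> \<subseteq> {..<m} \<longrightarrow> \<phi> \<gamma> = Some \<alpha> \<longrightarrow> \<alpha> \<subseteq> {..<n} \<and> (\<alpha> = {} \<longrightarrow> \<gamma> = {}))"

text \<open>
  A new last unit is added on both sides, with position \<open>m\<close> in the new indices and \<open>n\<close> in the old ones,
  and the map of indices is extended by keeping this unit.
\<close>

definition lift_index ::
  "nat \<Rightarrow> nat \<Rightarrow> (nat set \<Rightarrow> nat set option) \<Rightarrow> nat set \<Rightarrow> nat set option" where
  "lift_index m n \<phi> \<gamma> = (if m \<in> \<gamma> then map_option (insert n) (\<phi> (\<gamma> - {m})) else \<phi> \<gamma>)"

lemma index_mapD:
  assumes "index_map m n \<phi>"
  shows "\<phi> {} = Some {}" "\<gamma> \<subseteq> {..<m} \<Longrightarrow> \<phi> \<gamma> = Some \<alpha> \<Longrightarrow> \<alpha> \<subseteq> {..<n}"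
    "\<gamma> \<subseteq> {..<m} \<Longrightarrow> \<phi> \<gamma> = Some {} \<Longrightarrow> \<gamma> = {}"
  using assms unfolding index_map_def by blast+

lemma subset_lessThan_Suc_cases:
  assumes "\<gamma> \<subseteq> {..<Suc n}"
  obtains "\<gamma> \<subseteq> {..<n}" "n \<notin> \<gamma>"
    | \<delta> where "\<gamma> = insert n \<delta>" "\<delta> \<subseteq> {..<n}" "n \<notin> \<delta>"
proof (cases "n \<in> \<gamma>")
  case True
  then have "\<gamma> = insert n (\<gamma> - {n})" "\<gamma> - {n} \<subseteq> {..<n}" "n \<notin> \<gamma> - {n}"
    using assms by auto
  with that(2) show ?thesis by blast
next
  case False
  then show ?thesis using assms that(1) by (auto simp: lessThan_Suc)
qed

lemma lift_index_insert: "n' \<notin> \<delta> \<Longrightarrow> lift_index n' n \<phi> (insert n' \<delta>) = map_option (insert n) (\<phi> \<delta>)"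
  by (simp add: lift_index_def)

lemma index_map_lift:
  assumes "index_map m n \<phi>"
  shows "index_map (Suc m) (Suc n) (lift_index m n \<phi>)"
  unfolding index_map_def
proof (intro conjI allI impI)
  show "lift_index m n \<phi> {} = Some {}"
    using index_mapD(1)[OF assms] by (simp add: lift_index_def)
  fix \<gamma> \<alpha> assume "\<gamma> \<subseteq> {..<Suc m}" and \<alpha>: "lift_index m n \<phi> \<gamma> = Some \<alpha>"
  then have "\<alpha> \<subseteq> {..<Suc n} \<and> (\<alpha> = {} \<longrightarrow> \<gamma> = {})"
  proof (cases rule: subset_lessThan_Suc_cases)
    case 1
    then show ?thesis
      using \<alpha> index_mapD(2)[OF assms, of \<gamma> \<alpha>] index_mapD(3)[OF assms, of \<gamma>]
      by (auto simp: lift_index_def lessThan_Suc)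
  next
    case (2 \<delta>)
    with \<alpha> obtain \<beta> where "\<phi> \<delta> = Some \<beta>" "\<alpha> = insert n \<beta>" by (auto simp: lift_index_insert)
    then show ?thesis using index_mapD(2)[OF assms, of \<delta> \<beta>] 2 by (auto simp: lessThan_Suc)
  qed
  then show "\<alpha> \<subseteq> {..<Suc n}" "\<alpha> = {} \<Longrightarrow> \<gamma> = {}" by auto
qed

lemma reindex_cong:
  "(\<And>\<gamma>. \<gamma> \<subseteq> {..<m} \<Longrightarrow> \<phi> \<gamma> = \<psi> \<gamma>) \<Longrightarrow> reindex m n \<phi> = reindex m n \<psi>"
  unfolding reindex_def by (auto intro!: ext tpoint_cong)

lemma reindex_in_tspace [simp]: "reindex m n \<phi> p \<in> topspace (tspace m)"
  by (simp add: reindex_def)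

lemma tcoord_reindex:
  "\<gamma> \<subseteq> {..<m} \<Longrightarrow>
    tcoord m (reindex m n \<phi> p) \<gamma> = (case \<phi> \<gamma> of None \<Rightarrow> 0 | Some \<alpha> \<Rightarrow> tcoord n p \<alpha>)"
  by (simp add: reindex_def tcoord_tpoint Int_absorb2)

text \<open>
  Since the outermost pairing belongs to the last unit, keeping this unit means acting on both
  components separately.  For a linear map this is also the tangent map, as used in
  \<open>tangent_reindex\<close> below.
\<close>

lemma reindex_lift_Pair:
  assumes "index_map m n \<phi>"
  shows "reindex (Suc m) (Suc n) (lift_index m n \<phi>) (Pair p q) =
    Pair (reindex m n \<phi> p) (reindex m n \<phi> q)"
proof -
  have 1: "tpoint m (\<lambda>\<gamma>. case lift_index m n \<phi> \<gamma> of None \<Rightarrow> 0 | Some \<alpha> \<Rightarrow> tcoord (Suc n) (Pair p q) \<alpha>)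
    = reindex m n \<phi> p"
    unfolding reindex_def
  proof (rule tpoint_cong)
    fix \<gamma> assume "\<gamma> \<subseteq> {..<m}"
    then show "(case lift_index m n \<phi> \<gamma> of None \<Rightarrow> 0 | Some \<alpha> \<Rightarrow> tcoord (Suc n) (Pair p q) \<alpha>) =
        (case \<phi> \<gamma> of None \<Rightarrow> 0 | Some \<alpha> \<Rightarrow> tcoord n p \<alpha>)"
      using index_mapD(2)[OF assms, of \<gamma>] by (fastforce simp: lift_index_def split: option.split)
  qed
  have 2: "tpoint m (\<lambda>\<gamma>. case lift_index m n \<phi> (insert m \<gamma>) of
      None \<Rightarrow> 0 | Some \<alpha> \<Rightarrow> tcoord (Suc n) (Pair p q) \<alpha>) = reindex m n \<phi> q"
    unfolding reindex_def
  proof (rule tpoint_cong)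
    fix \<gamma> assume "\<gamma> \<subseteq> {..<m}"
    then have "m \<notin> \<gamma>" by auto
    then show "(case lift_index m n \<phi> (insert m \<gamma>) of
        None \<Rightarrow> 0 | Some \<alpha> \<Rightarrow> tcoord (Suc n) (Pair p q) \<alpha>) =
        (case \<phi> \<gamma> of None \<Rightarrow> 0 | Some \<alpha> \<Rightarrow> tcoord n q \<alpha>)"
      by (auto simp: lift_index_insert split: option.split intro: tcoord_cong)
  qed
  show ?thesis by (simp add: reindex_def[of "Suc m"] 1 2)
qed

lemma reindex_tset:
  assumes "index_map m n \<phi>" "p \<in> tset n U"
  shows "reindex m n \<phi> p \<in> tset m U"
  using assms(2) index_mapD(1)[OF assms(1)] by (simp add: tset_iff tcoord_reindex)

lemma reindex_flip:
  assumes "index_map m n \<phi>" "p \<in> topspace (tspace (Suc (Suc n)))"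
  shows "reindex (Suc (Suc m)) (Suc (Suc n)) (lift_index (Suc m) (Suc n) (lift_index m n \<phi>)) (flip p) =
    flip (reindex (Suc (Suc m)) (Suc (Suc n)) (lift_index (Suc m) (Suc n) (lift_index m n \<phi>)) p)"
proof -
  obtain x u v w where "p = Pair (Pair x u) (Pair v w)"
    using assms(2) by (auto elim!: in_pair_spaceE)
  then show ?thesis
    by (simp add: reindex_lift_Pair[OF assms(1)] reindex_lift_Pair[OF index_map_lift[OF assms(1)]])
qed

lemma flip_tset: "p \<in> tset (Suc (Suc n)) U \<Longrightarrow> flip p \<in> tset (Suc (Suc n)) U"
  by (auto simp: tset_iff elim!: in_pair_spaceE)

context topological_module
begin

lemma tm_linear_tcoord: "tm_linear (tspace n) vec_space (\<lambda>p. Vec (tcoord n p \<alpha>))"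
proof (induction n)
  case 0
  show ?case
    by (auto simp: tm_linear_def continuous_map_vec_space continuous_map_vec_of)
next
  case (Suc n)
  then show ?case
    using tm_linear_comp[OF tm_linear_first Suc] tm_linear_comp[OF tm_linear_second Suc]
    by (cases "n \<in> \<alpha>") simp_all
qed

lemma tm_linear_tpoint:
  "(\<And>\<alpha>. \<alpha> \<subseteq> {..<n} \<Longrightarrow> tm_linear E vec_space (\<lambda>p. Vec (v p \<alpha>))) \<Longrightarrow>
    tm_linear E (tspace n) (\<lambda>p. tpoint n (v p))"
proof (induction n arbitrary: v)
  case (Suc n)
  have "tm_linear E (tspace n) (\<lambda>p. tpoint n (v p))"
    and "tm_linear E (tspace n) (\<lambda>p. tpoint n (\<lambda>\<alpha>. v p (insert n \<alpha>)))"
    by (rule Suc.IH; rule Suc.prems; auto)+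
  then show ?case by (simp add: tm_linear_Pair)
qed simp

lemma smooth_tpoint:
  "tree_module E \<Longrightarrow> U \<subseteq> topspace E \<Longrightarrow>
   (\<And>\<alpha>. \<alpha> \<subseteq> {..<n} \<Longrightarrow> smooth sc E vec_space U (\<lambda>p. Vec (v p \<alpha>))) \<Longrightarrow>
    smooth sc E (tspace n) U (\<lambda>p. tpoint n (v p))"
proof (induction n arbitrary: v)
  case (Suc n)
  have "smooth sc E (tspace n) U (\<lambda>p. tpoint n (v p))"
    and "smooth sc E (tspace n) U (\<lambda>p. tpoint n (\<lambda>\<alpha>. v p (insert n \<alpha>)))"
    by (rule Suc.IH; (rule Suc.prems)?; auto)+
  then show ?case using Suc.prems by (simp add: smooth_Pair tree_module_tspace)
qed simp

lemma tm_linear_reindex: "tm_linear (tspace n) (tspace m) (reindex m n \<phi>)"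
  unfolding reindex_def[abs_def]
proof (rule tm_linear_tpoint)
  fix \<gamma>
  show "tm_linear (tspace n) vec_space (\<lambda>p. Vec (case \<phi> \<gamma> of None \<Rightarrow> 0 | Some \<alpha> \<Rightarrow> tcoord n p \<alpha>))"
    by (cases "\<phi> \<gamma>") (auto intro: tm_linear_zero_Vec tm_linear_tcoord)
qed

lemma tangent_reindex:
  assumes "index_map m n \<phi>" "open U" "z \<in> tset (Suc n) U"
  shows "tangent (tspace n) (tspace m) (tset n U) (reindex m n \<phi>) z =
    reindex (Suc m) (Suc n) (lift_index m n \<phi>) z"
proof -
  obtain p q where z: "z = Pair p q" "p \<in> tset n U" "q \<in> topspace (tspace n)"
    using assms(3) by auto
  show ?thesis
    unfolding z(1) reindex_lift_Pair[OF assms(1)]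
    by (rule tangent_linear[OF tm_linear_reindex tree_module_tspace tree_module_tspace
          openin_tset[OF assms(2)] z(2,3)])
qed

end


section \<open>The derived splitting maps in a chart\<close>

text \<open>
  The inner map \<open>A\<^bsup>n+1\<^esup>U \<rightarrow> T(A\<^sup>nU)\<close> in the recursion for the derived splitting maps.
\<close>

definition chr_map ::
  "nat \<Rightarrow> ('v \<Rightarrow> 'v \<Rightarrow> 'v \<Rightarrow> 'v::plus) \<Rightarrow> ('k, 'v) tm \<Rightarrow> ('k, 'v) tm" where
  "chr_map n b p = tpoint (Suc n) (\<lambda>\<beta>.
     if n \<in> \<beta> \<and> \<beta> \<noteq> {n}
     then tcoord (Suc n) p \<beta> + b (tcoord (Suc n) p {}) (tcoord (Suc n) p (\<beta> - {n})) (tcoord (Suc n) p {n})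
     else tcoord (Suc n) p \<beta>)"

lemma tcoord_chr_map:
  assumes "\<beta> \<subseteq> {..<Suc n}"
  shows "tcoord (Suc n) (chr_map n b p) \<beta> =
    (if n \<in> \<beta> \<and> \<beta> \<noteq> {n}
     then tcoord (Suc n) p \<beta> + b (tcoord (Suc n) p {}) (tcoord (Suc n) p (\<beta> - {n})) (tcoord (Suc n) p {n})
     else tcoord (Suc n) p \<beta>)"
  unfolding chr_map_def tcoord_tpoint using assms by (simp add: Int_absorb2)

lemma chr_map_tset: "p \<in> tset (Suc n) U \<Longrightarrow> chr_map n b p \<in> tset (Suc n) U"
proof -
  assume "p \<in> tset (Suc n) U"
  then have "tcoord (Suc n) p {} \<in> U" unfolding tset_iff by blast
  moreover have "tcoord (Suc n) (chr_map n b p) {} = tcoord (Suc n) p {}"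
    by (subst tcoord_chr_map) auto
  moreover have "chr_map n b p \<in> topspace (tspace (Suc n))"
    unfolding chr_map_def by (rule tpoint_in_tspace)
  ultimately show ?thesis unfolding tset_iff by simp
qed

lemma chr_map_inverse:
  fixes b :: "'v::topological_ab_group_add \<Rightarrow> 'v \<Rightarrow> 'v \<Rightarrow> 'v"
  assumes p: "p \<in> tset (Suc n) U"
    and inverse: "\<And>x u v. b' x u v = - b x u v"
  shows "chr_map n b' (chr_map n b p) = p"
proof (rule tcoord_eqI[where n = "Suc n"])
  show "chr_map n b' (chr_map n b p) \<in> topspace (tspace (Suc n))"
    unfolding chr_map_def[of n b'] by (rule tpoint_in_tspace)
  show "p \<in> topspace (tspace (Suc n))" using p tset_subset by blast
  fix \<alpha> assume \<alpha>: "\<alpha> \<subseteq> {..<Suc n}"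
  then have "\<alpha> - {n} \<subseteq> {..<Suc n}" "{} \<subseteq> {..<Suc n}" "{n} \<subseteq> {..<Suc n}" by auto
  then show "tcoord (Suc n) (chr_map n b' (chr_map n b p)) \<alpha> = tcoord (Suc n) p \<alpha>"
    using \<alpha> by (simp add: tcoord_chr_map inverse del: tcoord.simps)
qed

text \<open>
  The splitting map is itself such an inner map, with one old unit; the recursion could start with
  the identity of \<open>TU\<close>.
\<close>

lemma Phi_chart_0: "Phi_chart 0 sc U b = chr_map 1 b"
proof -
  have *: "\<alpha> = {0, 1} \<longleftrightarrow> 1 \<in> \<alpha> \<and> \<alpha> \<noteq> {1}" if "\<alpha> \<subseteq> {..<2}" for \<alpha> :: "nat set"
    using that by (auto simp: subset_iff less_2_cases_iff)
  have "{0, 1} - {1} = {0::nat}" by auto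
  then show ?thesis
    unfolding Phi_chart.simps chr_map_def Suc_1 one_add_one plus_1_eq_Suc
    by (intro ext tpoint_cong) (simp add: *[symmetric] del: tcoord.simps One_nat_def)
qed

lemma Phi_chart_Suc:
  "Phi_chart (Suc k) sc U b p =
    tangent_map sc (tspace (k + 2)) (tspace (k + 2)) (tset (k + 2) U) (Phi_chart k sc U b)
      (chr_map (k + 2) b p)"
proof -
  have "k + 3 = Suc (k + 2)" by simp
  then show ?thesis by (simp only: Phi_chart.simps chr_map_def)
qed

text \<open>
  From here on points are handled through their coordinates, not as trees.
\<close>

declare tcoord.simps [simp del] tpoint.simps [simp del] tspace.simps [simp del] tset.simps [simp del]
  Phi_chart.simps [simp del]

text \<open>
  What a connection provides in one chart.  It is a locale of its own so that it can be used for
  \<open>- b\<close> as well, which gives the inverse maps.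
\<close>

locale chart_connection = topological_module sc
  for sc :: "'k::base_ring \<Rightarrow> 'v::{topological_ab_group_add,t2_space} \<Rightarrow> 'v" +
  fixes U :: "'v set" and b :: "'v \<Rightarrow> 'v \<Rightarrow> 'v \<Rightarrow> 'v"
  assumes open_U: "open U"
    and bilinear: "x \<in> U \<Longrightarrow> is_bilinear sc (b x)"
    and smooth_b: "smooth sc (pair_space vec_space (pair_space vec_space vec_space)) vec_space
      {Pair (Vec x) (Pair (Vec u) (Vec v)) |x u v. x \<in> U}
      (\<lambda>p. Vec (b (vec_of (first p)) (vec_of (first (second p))) (vec_of (second (second p)))))"
begin

abbreviation \<Phi> :: "nat \<Rightarrow> ('k, 'v) tm \<Rightarrow> ('k, 'v) tm" where "\<Phi> k \<equiv> Phi_chart k sc U b"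
abbreviation T :: "nat \<Rightarrow> (('k, 'v) tm \<Rightarrow> ('k, 'v) tm) \<Rightarrow> ('k, 'v) tm \<Rightarrow> ('k, 'v) tm" where
  "T n \<equiv> tangent (tspace n) (tspace n) (tset n U)"
abbreviation smooth_map :: "nat \<Rightarrow> nat \<Rightarrow> (('k, 'v) tm \<Rightarrow> ('k, 'v) tm) \<Rightarrow> bool" where
  "smooth_map n m \<equiv> smooth sc (tspace n) (tspace m) (tset n U)"

lemma b_zero: "x \<in> U \<Longrightarrow> b x 0 v = 0"
  using bilinear unfolding is_bilinear_def by (meson module_hom.zero)

lemmas open_tset = openin_tset[OF open_U]

lemma connection_minus: "chart_connection sc U (\<lambda>x u v. - b x u v)"
proof
  show "is_bilinear sc (\<lambda>u v. - b x u v)" if "x \<in> U" for x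
    using bilinear[OF that] unfolding is_bilinear_def
    by (auto simp: module_hom_iff scale_minus_right)
  let ?E = "pair_space vec_space (pair_space vec_space vec_space)"
  let ?D = "{Pair (Vec x) (Pair (Vec u) (Vec v)) |x u v. x \<in> U}"
  have "tm_linear vec_space vec_space (\<lambda>p. Vec (- vec_of p))"
    using continuous_map_compose[OF continuous_map_vec_of, of euclidean uminus]
      continuous_on_minus[OF continuous_on_id, of UNIV]
    by (auto simp: tm_linear_def continuous_map_vec_space scale_minus_right o_def)
  then have "smooth sc vec_space vec_space (range Vec) (\<lambda>p. Vec (- vec_of p))"
    by (intro smooth_linear tree_module.intros) auto
  then have "smooth sc ?E vec_space ?D (\<lambda>p. Vec (- vec_of (Vec
      (b (vec_of (first p)) (vec_of (first (second p))) (vec_of (second (second p)))) :: ('k, 'v) tm)))"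
    by (rule smooth_comp[OF smooth_b]) (auto intro: tree_module.intros)
  then show "smooth sc ?E vec_space ?D
      (\<lambda>p. Vec (- b (vec_of (first p)) (vec_of (first (second p))) (vec_of (second (second p)))))"
    by simp
qed (rule open_U)

lemma smooth_chr_map: "smooth_map (Suc n) (Suc n) (chr_map n b)"
  unfolding chr_map_def[abs_def]
proof (rule smooth_tpoint[OF tree_module_tspace tset_subset])
  fix \<beta>
  let ?c = "\<lambda>\<alpha> p. Vec (tcoord (Suc n) p \<alpha>)"
  have c: "smooth sc (tspace (Suc n)) vec_space (tset (Suc n) U) (?c \<alpha>)" for \<alpha>
    by (rule smooth_linear[OF tm_linear_tcoord tree_module_tspace tree_module.vec tset_subset])
  let ?V2 = "pair_space vec_space vec_space"
  let ?t = "\<lambda>p. Pair (?c {} p) (Pair (?c (\<beta> - {n}) p) (?c {n} p))"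
  have V3: "tree_module (pair_space vec_space ?V2)" and V2: "tree_module ?V2"
    by (intro tree_module.intros)+
  have "smooth sc (tspace (Suc n)) (pair_space vec_space ?V2) (tset (Suc n) U) ?t"
    by (intro smooth_Pair c tree_module_tspace V2 tree_module.vec tset_subset)
  from smooth_comp[OF this smooth_b]
  have "smooth sc (tspace (Suc n)) vec_space (tset (Suc n) U)
     (\<lambda>p. Vec (b (tcoord (Suc n) p {}) (tcoord (Suc n) p (\<beta> - {n})) (tcoord (Suc n) p {n})))"
    using V3 by (force simp: tset_iff intro: tree_module_tspace tree_module.vec)
  from smooth_Pair[OF c[of \<beta>] this tree_module_tspace tree_module.vec tree_module.vec tset_subset]
  have "smooth sc (tspace (Suc n)) ?V2 (tset (Suc n) U) (\<lambda>p. Pair (?c \<beta> p)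
     (Vec (b (tcoord (Suc n) p {}) (tcoord (Suc n) p (\<beta> - {n})) (tcoord (Suc n) p {n}))))" .
  from smooth_comp[OF this smooth_linear[OF tm_linear_sum[OF tree_module.vec] V2 tree_module.vec subset_refl]]
  have "smooth sc (tspace (Suc n)) vec_space (tset (Suc n) U) (\<lambda>p. Vec (tcoord (Suc n) p \<beta> +
     b (tcoord (Suc n) p {}) (tcoord (Suc n) p (\<beta> - {n})) (tcoord (Suc n) p {n})))"
    using V2 tset_subset by (auto simp: image_subset_iff intro: tree_module_tspace tree_module.vec)
  then show "smooth sc (tspace (Suc n)) vec_space (tset (Suc n) U) (\<lambda>p. Vec (
     if n \<in> \<beta> \<and> \<beta> \<noteq> {n} then tcoord (Suc n) p \<beta> +
       b (tcoord (Suc n) p {}) (tcoord (Suc n) p (\<beta> - {n})) (tcoord (Suc n) p {n})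
     else tcoord (Suc n) p \<beta>))"
    using c[of \<beta>] by (cases "n \<in> \<beta> \<and> \<beta> \<noteq> {n}") (simp_all only: if_True if_False simp_thms)
qed

text \<open>
  The Christoffel term of an index \<open>\<gamma>\<close> involves \<open>x\<close>, the coefficient of \<open>\<gamma>\<close> and that of the last
  unit.  The first and the last are preserved, and the middle one is rearranged like the coefficient
  it is added to; where a zero is inserted, the term vanishes by linearity.
\<close>

lemma reindex_chr_map:
  assumes \<phi>: "index_map m n \<phi>" and p: "p \<in> tset (Suc n) U"
  defines "R \<equiv> reindex (Suc m) (Suc n) (lift_index m n \<phi>)"
  shows "R (chr_map n b p) = chr_map m b (R p)"
proof (rule tcoord_eqI[where n = "Suc m"])
  show "R (chr_map n b p) \<in> topspace (tspace (Suc m))" by (simp add: R_def)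
  show "chr_map m b (R p) \<in> topspace (tspace (Suc m))"
    unfolding chr_map_def by (rule tpoint_in_tspace)
  fix \<gamma> assume \<gamma>: "\<gamma> \<subseteq> {..<Suc m}"
  have x: "tcoord (Suc n) p {} \<in> U" using p by (simp add: tset_iff)
  note lift = index_map_lift[OF \<phi>]
  have base: "tcoord (Suc m) (R p) {} = tcoord (Suc n) p {}"
    "tcoord (Suc m) (R p) {m} = tcoord (Suc n) p {n}"
    using index_mapD(1)[OF \<phi>] by (simp_all add: R_def tcoord_reindex lift_index_def)
  show "tcoord (Suc m) (R (chr_map n b p)) \<gamma> = tcoord (Suc m) (chr_map m b (R p)) \<gamma>"
    using \<gamma>
  proof (cases rule: subset_lessThan_Suc_cases)
    case 1
    then have "lift_index m n \<phi> \<gamma> = \<phi> \<gamma>" by (simp add: lift_index_def)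
    moreover have "n \<notin> \<alpha>" "\<alpha> \<subseteq> {..<Suc n}" if "\<phi> \<gamma> = Some \<alpha>" for \<alpha>
      using index_mapD(2)[OF \<phi> 1(1) that] by auto
    ultimately show ?thesis
      using 1 \<gamma> by (auto simp: tcoord_chr_map R_def tcoord_reindex split: option.split)
  next
    case (2 \<delta>)
    show ?thesis
    proof (cases "\<phi> \<delta>")
      case None
      then have "\<delta> \<noteq> {}" using index_mapD(1)[OF \<phi>] by auto
      moreover have "lift_index m n \<phi> \<gamma> = None" "lift_index m n \<phi> \<delta> = None"
        using 2 None by (auto simp: lift_index_insert lift_index_def)
      moreover have "\<gamma> - {m} = \<delta>" "\<gamma> \<noteq> {m}" "\<delta> \<subseteq> {..<Suc m}" using 2 \<open>\<delta> \<noteq> {}\<close> by auto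
      ultimately show ?thesis
        using \<gamma> 2(1) x b_zero
        by (simp add: tcoord_chr_map base) (simp add: R_def tcoord_reindex)
    next
      case (Some \<alpha>)
      then have \<alpha>: "\<alpha> \<subseteq> {..<n}" "\<alpha> = {} \<longleftrightarrow> \<delta> = {}"
        using index_mapD[OF \<phi>] 2(2) by auto
      then have \<alpha>': "insert n \<alpha> \<subseteq> {..<Suc n}" "insert n \<alpha> - {n} = \<alpha>" "insert n \<alpha> \<noteq> {n} \<longleftrightarrow> \<delta> \<noteq> {}"
        by auto
      have l: "lift_index m n \<phi> \<gamma> = Some (insert n \<alpha>)" "lift_index m n \<phi> \<delta> = Some \<alpha>"
        using 2 Some by (auto simp: lift_index_insert lift_index_def)
      have \<gamma>': "\<gamma> - {m} = \<delta>" "\<gamma> \<noteq> {m} \<longleftrightarrow> \<delta> \<noteq> {}" "\<delta> \<subseteq> {..<Suc m}" "m \<in> \<gamma>" using 2 by auto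
      have "tcoord (Suc m) (R (chr_map n b p)) \<gamma> = tcoord (Suc n) (chr_map n b p) (insert n \<alpha>)"
        using \<gamma> l by (simp add: R_def tcoord_reindex)
      moreover have "tcoord (Suc m) (R p) \<gamma> = tcoord (Suc n) p (insert n \<alpha>)"
        "tcoord (Suc m) (R p) \<delta> = tcoord (Suc n) p \<alpha>"
        using \<gamma> \<gamma>' l by (simp_all add: R_def tcoord_reindex)
      ultimately show ?thesis
        unfolding tcoord_chr_map[OF \<alpha>'(1)] tcoord_chr_map[OF \<gamma>] base \<gamma>'(1,2) \<alpha>'(2,3)
        using \<gamma>'(4) by simp
    qed
  qed
qed

text \<open>
  Smoothness and the smooth inverse are proved together, since the inverse of a tangent map is the
  tangent map of the inverse, which presupposes that the latter is smooth.
\<close>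

lemma Phi_properties:
  "smooth_map (k + 2) (k + 2) (\<Phi> k) \<and> \<Phi> k ` tset (k + 2) U \<subseteq> tset (k + 2) U \<and>
   (\<exists>\<Psi>. smooth_map (k + 2) (k + 2) \<Psi> \<and> \<Psi> ` tset (k + 2) U \<subseteq> tset (k + 2) U \<and>
     (\<forall>p\<in>tset (k + 2) U. \<Psi> (\<Phi> k p) = p \<and> \<Phi> k (\<Psi> p) = p))"
proof (induction k)
  case 0
  interpret minus: chart_connection sc U "\<lambda>x u v. - b x u v" by (rule connection_minus)
  show ?case
    unfolding Phi_chart_0
    using smooth_chr_map[of 1] minus.smooth_chr_map[of 1] chr_map_tset[of _ 1 U]
      chr_map_inverse[of _ 1 U "\<lambda>x u v. - b x u v" b] chr_map_inverse[of _ 1 U b "\<lambda>x u v. - b x u v"]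
    by (intro conjI exI[of _ "chr_map 1 (\<lambda>x u v. - b x u v)"])
      (auto simp: numeral_2_eq_2)
next
  case (Suc k)
  interpret minus: chart_connection sc U "\<lambda>x u v. - b x u v" by (rule connection_minus)
  let ?n = "k + 2" and ?b' = "\<lambda>x u v. - b x u v"
  obtain \<Psi> where S: "smooth_map ?n ?n (\<Phi> k)" "smooth_map ?n ?n \<Psi>"
    and maps: "\<Phi> k ` tset ?n U \<subseteq> tset ?n U" "\<Psi> ` tset ?n U \<subseteq> tset ?n U"
    and inv: "\<And>p. p \<in> tset ?n U \<Longrightarrow> \<Psi> (\<Phi> k p) = p" "\<And>p. p \<in> tset ?n U \<Longrightarrow> \<Phi> k (\<Psi> p) = p"
    using Suc.IH by blast
  note tree = tree_module_tspace[of ?n, where ?'a = 'k and ?'b = 'v]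
  have tset: "tset (Suc ?n) U = (tangent_dom (tspace ?n) (tset ?n U) :: ('k, 'v) tm set)"
    and tsp: "tspace (Suc ?n) = (pair_space (tspace ?n) (tspace ?n) :: ('k, 'v) tm topology)"
    by (simp_all add: tset_Suc_tangent_dom tspace.simps)
  have ST: "smooth_map (Suc ?n) (Suc ?n) (T ?n f)" "T ?n f ` tset (Suc ?n) U \<subseteq> tset (Suc ?n) U"
    if "smooth_map ?n ?n f" "f ` tset ?n U \<subseteq> tset ?n U" for f
    using smooth_tangent[OF that(1) tree tree open_tset]
      tangent_maps[OF that(1) tree tree open_tset that(2)] unfolding tset tsp by auto
  have T_inv: "T ?n g (T ?n f z) = z"
    if "smooth_map ?n ?n f" "smooth_map ?n ?n g" "f ` tset ?n U \<subseteq> tset ?n U"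
      "\<And>p. p \<in> tset ?n U \<Longrightarrow> g (f p) = p" "z \<in> tset (Suc ?n) U" for f g z
  proof -
    have z: "z \<in> tangent_dom (tspace ?n) (tset ?n U)" using that(5) tset by simp
    have id: "smooth_map ?n ?n (\<lambda>p. p)" by (rule smooth_linear[OF tm_linear_id tree tree tset_subset])
    have "T ?n (\<lambda>p. p) z = T ?n g (T ?n f z)"
      by (rule tangent_chain[OF that(1,2) id tree tree tree open_tset open_tset open_tset open_tset
            subset_refl subset_refl that(3) _ z]) (simp add: that(4))
    moreover have "T ?n (\<lambda>p. p) z = z"
      using z tangent_linear[OF tm_linear_id tree tree open_tset] by (auto elim!: in_tangent_domE)
    ultimately show ?thesis by simp
  qed
  have n: "Suc k + 2 = Suc ?n" by simp
  let ?\<Psi> = "\<lambda>p. chr_map ?n ?b' (T ?n \<Psi> p)"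
  note chr = smooth_chr_map[of ?n] minus.smooth_chr_map[of ?n]
  have chr_maps: "chr_map ?n c ` tset (Suc ?n) U \<subseteq> tset (Suc ?n) U" for c
    using chr_map_tset by blast
  have \<Phi>: "\<Phi> (Suc k) = (\<lambda>p. T ?n (\<Phi> k) (chr_map ?n b p))" by (rule ext) (rule Phi_chart_Suc)
  note tree' = tree_module_tspace[of "Suc ?n", where ?'a = 'k and ?'b = 'v]
  show ?case
    unfolding n \<Phi>
  proof (intro conjI exI[of _ ?\<Psi>] ballI)
    show "smooth_map (Suc ?n) (Suc ?n) (\<lambda>p. T ?n (\<Phi> k) (chr_map ?n b p))"
      by (rule smooth_comp[OF chr(1) ST(1)[OF S(1) maps(1)] chr_maps tree' tree' tree' tset_subset tset_subset])
    show "smooth_map (Suc ?n) (Suc ?n) ?\<Psi>"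
      by (rule smooth_comp[OF ST(1)[OF S(2) maps(2)] chr(2) ST(2)[OF S(2) maps(2)]
            tree' tree' tree' tset_subset tset_subset])
    show "(\<lambda>p. T ?n (\<Phi> k) (chr_map ?n b p)) ` tset (Suc ?n) U \<subseteq> tset (Suc ?n) U"
      "?\<Psi> ` tset (Suc ?n) U \<subseteq> tset (Suc ?n) U"
      using ST(2)[OF S(1) maps(1)] ST(2)[OF S(2) maps(2)] chr_maps by blast+
    fix p :: "('k, 'v) tm" assume p: "p \<in> tset (Suc ?n) U"
    show "?\<Psi> (T ?n (\<Phi> k) (chr_map ?n b p)) = p"
      by (subst T_inv[OF S maps(1) inv(1) chr_map_tset[OF p]]) (assumption, rule chr_map_inverse[OF p], simp)
    have "T ?n \<Psi> p \<in> tset (Suc ?n) U" using ST(2)[OF S(2) maps(2)] p by blast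
    then have "chr_map ?n b (?\<Psi> p) = T ?n \<Psi> p" by (rule chr_map_inverse) simp
    then show "T ?n (\<Phi> k) (chr_map ?n b (?\<Psi> p)) = p"
      using T_inv[OF S(2,1) maps(2) inv(2) p] by simp
  qed
qed

lemma smooth_Phi: "smooth_map (k + 2) (k + 2) (\<Phi> k)"
  and Phi_tset: "p \<in> tset (k + 2) U \<Longrightarrow> \<Phi> k p \<in> tset (k + 2) U"
  using Phi_properties[of k] by blast+

lemma Phi_bij_betw: "bij_betw (\<Phi> k) (tset (k + 2) U) (tset (k + 2) U)"
proof -
  obtain \<Psi> where "\<Psi> ` tset (k + 2) U \<subseteq> tset (k + 2) U" "\<Phi> k ` tset (k + 2) U \<subseteq> tset (k + 2) U"
     "\<forall>p\<in>tset (k + 2) U. \<Psi> (\<Phi> k p) = p \<and> \<Phi> k (\<Psi> p) = p"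
    using Phi_properties[of k] by blast
  then show ?thesis by (intro bij_betwI[of _ _ _ \<Psi>]) auto
qed

end


section \<open>Permutations and shifts as reindexings\<close>

lemma perm_chart_reindex: "perm_chart n \<sigma> = reindex n n (\<lambda>\<beta>. Some (inv \<sigma> ` \<beta>))"
  by (simp add: fun_eq_iff perm_chart_def reindex_def)

lemma shift_chart_reindex:
  "shift_chart n i j = reindex n n (\<lambda>\<beta>. if i \<notin> \<beta> then Some \<beta> else if j \<in> \<beta> then Some (\<beta> - {j}) else None)"
  by (auto simp: fun_eq_iff shift_chart_def reindex_def intro!: tpoint_cong)

lemma image_subset_permutes: "\<sigma> permutes {..<n} \<Longrightarrow> \<beta> \<subseteq> {..<n} \<Longrightarrow> \<sigma> ` \<beta> \<subseteq> {..<n::nat}"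
  using permutes_image by blast

lemma tcoord_perm_chart:
  "\<beta> \<subseteq> {..<n} \<Longrightarrow> tcoord n (perm_chart n \<sigma> p) \<beta> = tcoord n p (inv \<sigma> ` \<beta>)"
  by (simp add: perm_chart_def tcoord_tpoint Int_absorb2)

lemma index_map_perm:
  "\<sigma> permutes {..<n} \<Longrightarrow> index_map n n (\<lambda>\<beta>. Some (inv \<sigma> ` \<beta>))"
  using image_subset_permutes[OF permutes_inv] by (auto simp: index_map_def)

lemma index_map_shift:
  "i \<noteq> j \<Longrightarrow>
   index_map n n (\<lambda>\<beta>. if i \<notin> \<beta> then Some \<beta> else if j \<in> \<beta> then Some (\<beta> - {j}) else None)"
  by (auto simp: index_map_def split: if_splits)

lemma perm_chart_lift:
  assumes "\<sigma> permutes {..<n}"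
  shows "reindex (Suc n) (Suc n) (lift_index n n (\<lambda>\<beta>. Some (inv \<sigma> ` \<beta>))) = perm_chart (Suc n) \<sigma>"
  unfolding perm_chart_reindex
proof (rule reindex_cong)
  fix \<gamma> assume "\<gamma> \<subseteq> {..<Suc n}"
  moreover have "inv \<sigma> n = n" using permutes_inv[OF assms] permutes_not_in by fastforce
  moreover from this have "insert n (inv \<sigma> ` (\<gamma> - {n})) = inv \<sigma> ` \<gamma>" if "n \<in> \<gamma>"
    using image_insert[of "inv \<sigma>" n "\<gamma> - {n}"] that by (simp add: insert_absorb)
  ultimately show "lift_index n n (\<lambda>\<beta>. Some (inv \<sigma> ` \<beta>)) \<gamma> = Some (inv \<sigma> ` \<gamma>)"
    by (simp add: lift_index_def)
qed

lemma shift_chart_lift: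
  assumes "i < n" "j < n"
  shows "reindex (Suc n) (Suc n) (lift_index n n
    (\<lambda>\<beta>. if i \<notin> \<beta> then Some \<beta> else if j \<in> \<beta> then Some (\<beta> - {j}) else None)) = shift_chart (Suc n) i j"
  unfolding shift_chart_reindex
  by (rule reindex_cong) (use assms in \<open>auto simp: lift_index_def\<close>)

lemma perm_chart_comp:
  assumes "\<sigma> permutes {..<n}" "\<tau> permutes {..<n}"
  shows "perm_chart n (\<sigma> \<circ> \<tau>) p = perm_chart n \<sigma> (perm_chart n \<tau> p)"
  unfolding perm_chart_def[of n "\<sigma> \<circ> \<tau>"] perm_chart_def[of n \<sigma>]
proof (rule tpoint_cong)
  fix \<beta> assume "\<beta> \<subseteq> {..<n}"
  then have "inv \<sigma> ` \<beta> \<subseteq> {..<n}" by (rule image_subset_permutes[OF permutes_inv[OF assms(1)]])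
  moreover have "inv (\<sigma> \<circ> \<tau>) = inv \<tau> \<circ> inv \<sigma>"
    using assms by (intro o_inv_distrib permutes_bij)
  ultimately show "tcoord n p (inv (\<sigma> \<circ> \<tau>) ` \<beta>) = tcoord n (perm_chart n \<tau> p) (inv \<sigma> ` \<beta>)"
    by (simp add: tcoord_perm_chart image_comp)
qed

lemma perm_chart_id: "p \<in> topspace (tspace n) \<Longrightarrow> perm_chart n id p = p"
  unfolding perm_chart_def by (rule tpoint_eqI) auto

lemma tspace_SucSucE:
  assumes "p \<in> topspace (tspace (Suc (Suc n)))"
  obtains x u v w where "p = Pair (Pair x u) (Pair v w)"
    "x \<in> topspace (tspace n)" "u \<in> topspace (tspace n)"
    "v \<in> topspace (tspace n)" "w \<in> topspace (tspace n)"
  using assms by (auto simp: tspace.simps elim!: in_pair_spaceE)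

lemma perm_chart_transpose_last:
  assumes "p \<in> topspace (tspace (Suc (Suc n)))"
  shows "perm_chart (Suc (Suc n)) (Transposition.transpose n (Suc n)) p = flip p"
proof -
  obtain x u v w where p: "p = Pair (Pair x u) (Pair v w)"
    and xuvw: "x \<in> topspace (tspace n)" "u \<in> topspace (tspace n)"
      "v \<in> topspace (tspace n)" "w \<in> topspace (tspace n)"
    by (rule tspace_SucSucE[OF assms])
  show ?thesis
    unfolding perm_chart_def
  proof (rule tpoint_eqI)
    show "flip p \<in> topspace (tspace (Suc (Suc n)))" using xuvw by (simp add: p tspace.simps)
    fix \<beta> :: "nat set" assume "\<beta> \<subseteq> {..<Suc (Suc n)}"
    let ?\<tau> = "Transposition.transpose n (Suc n)"
    have mem: "i \<in> ?\<tau> ` \<beta> \<longleftrightarrow> ?\<tau> i \<in> \<beta>" for i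
      by (metis imageE image_eqI transpose_involutory)
    have "i \<in> ?\<tau> ` \<beta> \<and> i < n \<longleftrightarrow> i \<in> \<beta> \<and> i < n" for i
      using mem[of i] by (cases "i < n") (simp_all add: Transposition.transpose_def)
    then have "?\<tau> ` \<beta> \<inter> {..<n} = \<beta> \<inter> {..<n}"
      by (intro set_eqI) (simp only: Int_iff lessThan_iff)
    then have "tcoord n q (?\<tau> ` \<beta>) = tcoord n q \<beta>" for q :: "('a, 'b) tm"
      by (rule tcoord_cong)
    then show "tcoord (Suc (Suc n)) p (inv ?\<tau> ` \<beta>) = tcoord (Suc (Suc n)) (flip p) \<beta>"
      using mem[of n] mem[of "Suc n"] by (simp add: p tcoord.simps)
  qed
qed

text \<open>
  The permutations which fix the last number and the exchange of the last two numbers generate all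
  permutations: if \<open>\<sigma>\<close> maps the last number to \<open>i\<close>, then \<open>\<sigma>\<close> is the exchange of \<open>i\<close> with the last
  number after a permutation fixing the last number, and this exchange is conjugate to the given one.
\<close>

lemma permutes_lessThan_Suc_induct:
  assumes "\<sigma> permutes {..<Suc (Suc n)}"
    and fixing: "\<And>\<sigma>. \<sigma> permutes {..<Suc n} \<Longrightarrow> P \<sigma>"
    and swap: "P (Transposition.transpose n (Suc n))"
    and comp: "\<And>\<sigma> \<tau>. \<sigma> permutes {..<Suc (Suc n)} \<Longrightarrow> \<tau> permutes {..<Suc (Suc n)} \<Longrightarrow>
      P \<sigma> \<Longrightarrow> P \<tau> \<Longrightarrow> P (\<sigma> \<circ> \<tau>)"
  shows "P \<sigma>"
proof -
  define i where "i = \<sigma> (Suc n)"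
  define \<tau> where "\<tau> = Transposition.transpose i (Suc n)"
  have i: "i < Suc (Suc n)" unfolding i_def using permutes_in_image[OF assms(1), of "Suc n"] by simp
  have perm: "Transposition.transpose j k permutes {..<Suc (Suc n)}" if "j < Suc (Suc n)" "k < Suc (Suc n)" for j k
    using that by (intro permutes_swap_id) auto
  have "\<tau> \<circ> \<sigma> permutes {..<Suc (Suc n)}"
    unfolding \<tau>_def using assms(1) perm i by (intro permutes_compose) auto
  then have "\<tau> \<circ> \<sigma> permutes {..<Suc n}"
    by (rule permutes_superset) (auto simp: \<tau>_def i_def)
  moreover have "P \<tau>"
  proof -
    consider "i = Suc n" | "i = n" | "i < n" using i by linarith
    then show ?thesis
    proof cases
      case 1
      then show ?thesis using fixing[OF permutes_id] by (simp add: \<tau>_def id_def)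
    next
      case 2
      then show ?thesis using swap by (simp add: \<tau>_def)
    next
      case 3
      have in_perm: "Transposition.transpose i n permutes {..<Suc n}" using 3 by (intro permutes_swap_id) auto
      have "\<tau> = Transposition.transpose i n \<circ> (Transposition.transpose n (Suc n) \<circ> Transposition.transpose i n)"
        using 3 by (auto simp: \<tau>_def fun_eq_iff Transposition.transpose_def)
      moreover have "P (Transposition.transpose n (Suc n) \<circ> Transposition.transpose i n)"
        using 3 by (intro comp perm swap fixing[OF in_perm]) auto
      ultimately show ?thesis
        using 3 fixing[OF in_perm] by (auto intro!: comp perm permutes_compose)
    qed
  qed
  moreover have "\<sigma> = \<tau> \<circ> (\<tau> \<circ> \<sigma>)" by (simp add: fun_eq_iff \<tau>_def)
  ultimately show ?thesis
    using fixing comp[of \<tau> "\<tau> \<circ> \<sigma>"] perm i \<open>\<tau> \<circ> \<sigma> permutes {..<Suc (Suc n)}\<close>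
    by (metis \<tau>_def lessI)
qed


section \<open>Equivariance of the derived splitting maps\<close>

context chart_connection
begin

definition equivariant :: "nat \<Rightarrow> (('k, 'v) tm \<Rightarrow> ('k, 'v) tm) \<Rightarrow> bool" where
  "equivariant k F \<longleftrightarrow> (\<forall>p\<in>tset (k + 2) U. \<Phi> k (F p) = F (\<Phi> k p))"

lemma tree_tspace: "tree_module (tspace n :: ('k, 'v) tm topology)"
  by (rule tree_module_tspace)

lemma tset_tangent: "tset (Suc n) U = (tangent_dom (tspace n) (tset n U) :: ('k, 'v) tm set)"
  by (rule tset_Suc_tangent_dom)

text \<open>
  In \<open>\<Phi>\<^bsup>n+1\<^esup> = T\<Phi>\<^sup>n \<circ> B\<^sub>n\<close> the reindexing passes through \<open>B\<^sub>n\<close> by naturality and through \<open>T\<Phi>\<^sup>n\<close> by the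
  chain rule, because its tangent map is the lifted reindexing.
\<close>

lemma equivariant_lift:
  assumes \<phi>: "index_map (k + 2) (k + 2) \<phi>"
    and eq: "equivariant k (reindex (k + 2) (k + 2) \<phi>)"
  shows "equivariant (Suc k) (reindex (Suc (k + 2)) (Suc (k + 2)) (lift_index (k + 2) (k + 2) \<phi>))"
  unfolding equivariant_def add_Suc
proof
  let ?n = "k + 2"
  let ?R = "reindex ?n ?n \<phi>" and ?R' = "reindex (Suc ?n) (Suc ?n) (lift_index ?n ?n \<phi>)"
  fix p :: "('k, 'v) tm" assume p: "p \<in> tset (Suc ?n) U"
  define z where "z = chr_map ?n b p"
  have z: "z \<in> tset (Suc ?n) U" unfolding z_def by (rule chr_map_tset[OF p])
  have R: "?R ` tset ?n U \<subseteq> tset ?n U" using reindex_tset[OF \<phi>] by blast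
  have R_smooth: "smooth_map ?n ?n ?R"
    by (rule smooth_linear[OF tm_linear_reindex tree_tspace tree_tspace tset_subset])
  have \<Phi>: "\<Phi> k ` tset ?n U \<subseteq> tset ?n U" using Phi_tset by blast
  have \<Phi>R: "smooth_map ?n ?n (\<lambda>p. \<Phi> k (?R p))"
    by (rule smooth_comp[OF R_smooth smooth_Phi R tree_tspace tree_tspace tree_tspace tset_subset tset_subset])
  note chain = tangent_chain[OF _ _ \<Phi>R tree_tspace tree_tspace tree_tspace open_tset open_tset open_tset
      open_tset subset_refl subset_refl _ _ z[unfolded tset_tangent]]
  have T: "T ?n ?R y = ?R' y" if "y \<in> tset (Suc ?n) U" for y
    by (rule tangent_reindex[OF \<phi> open_U that])
  have Tz: "T ?n (\<Phi> k) z \<in> tset (Suc ?n) U"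
    using tangent_maps[OF smooth_Phi tree_tspace tree_tspace open_tset \<Phi>] z unfolding tset_tangent by blast
  have "\<Phi> (Suc k) (?R' p) = T ?n (\<Phi> k) (?R' z)"
    unfolding Phi_chart_Suc z_def reindex_chr_map[OF \<phi> p] ..
  also have "\<dots> = T ?n (\<lambda>p. \<Phi> k (?R p)) z"
    using chain[OF R_smooth smooth_Phi R refl] T[OF z] by simp
  also have "\<dots> = T ?n ?R (T ?n (\<Phi> k) z)"
    by (rule chain[OF smooth_Phi R_smooth \<Phi>]) (use eq in \<open>simp add: equivariant_def\<close>)
  also have "\<dots> = ?R' (\<Phi> (Suc k) p)"
    using T[OF Tz] by (simp only: z_def Phi_chart_Suc)
  finally show "\<Phi> (Suc k) (?R' p) = ?R' (\<Phi> (Suc k) p)" .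
qed

text \<open>
  The composition \<open>TB\<^sub>n \<circ> B\<^bsub>n+1\<^esub>\<close>, all Christoffel terms which the last two units contribute.
\<close>

definition chr_map2 :: "nat \<Rightarrow> ('k, 'v) tm \<Rightarrow> ('k, 'v) tm" where
  "chr_map2 n p = T (Suc n) (chr_map n b) (chr_map (Suc n) b p)"

lemma chr_map_image: "chr_map n b ` tset (Suc n) U \<subseteq> tset (Suc n) U"
  using chr_map_tset by blast

lemma chr_map2_tset: "p \<in> tset (Suc (Suc n)) U \<Longrightarrow> chr_map2 n p \<in> tset (Suc (Suc n)) U"
  unfolding chr_map2_def
  using tangent_maps[OF smooth_chr_map tree_tspace tree_tspace open_tset chr_map_image]
    chr_map_tset[of p "Suc n" U b] unfolding tset_tangent[of "Suc n"] by blast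

lemma Phi_chart_1: "\<Phi> 1 = chr_map2 1"
  unfolding fun_eq_iff chr_map2_def using Phi_chart_Suc[of 0 sc U b]
  by (simp add: Phi_chart_0 numeral_2_eq_2)

text \<open>
  Here the numbers of units on the two sides differ: taking \<open>m = 1\<close>, this compares the map for
  arbitrary \<open>n\<close> with the one for three units, on which the curvature hypothesis can be used.
\<close>

lemma reindex_chr_map2:
  assumes \<phi>: "index_map m n \<phi>" and p: "p \<in> tset (Suc (Suc n)) U"
  defines "R \<equiv> reindex (Suc (Suc m)) (Suc (Suc n)) (lift_index (Suc m) (Suc n) (lift_index m n \<phi>))"
  shows "R (chr_map2 n p) = chr_map2 m (R p)"
proof -
  let ?R = "reindex (Suc m) (Suc n) (lift_index m n \<phi>)"
  note \<phi>' = index_map_lift[OF \<phi>]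
  define z where "z = chr_map (Suc n) b p"
  have z: "z \<in> tset (Suc (Suc n)) U" unfolding z_def by (rule chr_map_tset[OF p])
  have R_smooth: "smooth sc (tspace (Suc n)) (tspace (Suc m)) (tset (Suc n) U) ?R"
    by (rule smooth_linear[OF tm_linear_reindex tree_tspace tree_tspace tset_subset])
  have R_tset: "?R ` tset (Suc n) U \<subseteq> tset (Suc m) U" using reindex_tset[OF \<phi>'] by blast
  have h: "smooth sc (tspace (Suc n)) (tspace (Suc m)) (tset (Suc n) U) (\<lambda>p. ?R (chr_map n b p))"
    by (rule smooth_comp[OF smooth_chr_map R_smooth chr_map_image
          tree_tspace tree_tspace tree_tspace tset_subset tset_subset])
  note chain = tangent_chain[OF _ _ h tree_tspace tree_tspace tree_tspace open_tset open_tset open_tset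
      open_tset subset_refl subset_refl _ _ z[unfolded tset_tangent[of "Suc n"]]]
  have T: "tangent (tspace (Suc n)) (tspace (Suc m)) (tset (Suc n) U) ?R y = R y"
    if "y \<in> tset (Suc (Suc n)) U" for y
    unfolding R_def by (rule tangent_reindex[OF \<phi>' open_U that])
  have "R (chr_map2 n p) = tangent (tspace (Suc n)) (tspace (Suc m)) (tset (Suc n) U) ?R
      (T (Suc n) (chr_map n b) z)"
    using T[OF chr_map2_tset[OF p]] by (simp add: chr_map2_def z_def)
  also have "\<dots> = tangent (tspace (Suc n)) (tspace (Suc m)) (tset (Suc n) U) (\<lambda>p. ?R (chr_map n b p)) z"
    by (rule chain[OF smooth_chr_map R_smooth chr_map_image refl, symmetric])
  also have "\<dots> = T (Suc m) (chr_map m b) (tangent (tspace (Suc n)) (tspace (Suc m)) (tset (Suc n) U) ?R z)"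
    by (rule chain[OF R_smooth smooth_chr_map R_tset]) (rule reindex_chr_map[OF \<phi>])
  also have "\<dots> = chr_map2 m (R p)"
    unfolding T[OF z] chr_map2_def by (simp only: z_def R_def reindex_chr_map[OF \<phi>' p])
  finally show ?thesis .
qed

text \<open>
  Of the first \<open>n\<close> units, only the product belonging to \<open>\<alpha>\<close> is retained, as a single unit.
\<close>

definition component :: "nat set \<Rightarrow> nat set \<Rightarrow> nat set option" where
  "component \<alpha> \<gamma> = Some (if 0 \<in> \<gamma> then \<alpha> else {})"

lemma index_map_component: "\<alpha> \<subseteq> {..<n} \<Longrightarrow> \<alpha> \<noteq> {} \<Longrightarrow> index_map 1 n (component \<alpha>)"
  by (auto simp: index_map_def component_def split: if_splits)

lemma eq_if_components_eq:
  assumes pq: "p \<in> topspace (tspace n)" "q \<in> topspace (tspace n)" and n: "n > 0"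
    and eq: "\<And>\<alpha>. \<alpha> \<subseteq> {..<n} \<Longrightarrow> \<alpha> \<noteq> {} \<Longrightarrow> reindex 1 n (component \<alpha>) p = reindex 1 n (component \<alpha>) q"
  shows "p = q"
proof (rule tcoord_eqI[OF pq])
  have c: "tcoord n p (if 0 \<in> \<gamma> then \<alpha> else {}) = tcoord n q (if 0 \<in> \<gamma> then \<alpha> else {})"
    if "\<alpha> \<subseteq> {..<n}" "\<alpha> \<noteq> {}" "\<gamma> \<subseteq> {..<1}" for \<alpha> \<gamma> :: "nat set"
    using arg_cong[OF eq[OF that(1,2)], of "\<lambda>p. tcoord 1 p \<gamma>"] that(3)
    by (simp add: tcoord_reindex component_def)
  fix \<alpha> assume "\<alpha> \<subseteq> {..<n}"
  then show "tcoord n p \<alpha> = tcoord n q \<alpha>"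
    using c[of \<alpha> "{0}"] c[of "{0}" "{}"] n by (cases "\<alpha> = {}") auto
qed

text \<open>
  The components belonging to the non-zero \<open>\<alpha>\<close> determine a point, and each of them reduces the claim
  to the case \<open>n = 1\<close>, which is the hypothesis on the curvature.
\<close>

lemma chr_map2_flip:
  assumes p: "p \<in> tset (Suc (Suc n)) U" and n: "n > 0"
    and curv: "\<And>q. q \<in> tset 3 U \<Longrightarrow> \<Phi> 1 (flip q) = flip (\<Phi> 1 q)"
  shows "chr_map2 n (flip p) = flip (chr_map2 n p)"
proof -
  let ?R = "\<lambda>\<alpha>. reindex 1 n (component \<alpha>)"
  let ?R2 = "\<lambda>\<alpha>. reindex (Suc (Suc 1)) (Suc (Suc n)) (lift_index (Suc 1) (Suc n) (lift_index 1 n (component \<alpha>)))"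
  have three: "Suc (Suc 1) = 3" by simp
  have Q: "chr_map2 n (flip p) \<in> tset (Suc (Suc n)) U" "flip (chr_map2 n p) \<in> tset (Suc (Suc n)) U"
    using p by (auto intro: chr_map2_tset flip_tset)
  have R2_eq: "?R2 \<alpha> (chr_map2 n (flip p)) = ?R2 \<alpha> (flip (chr_map2 n p))"
    if \<alpha>: "\<alpha> \<subseteq> {..<n}" "\<alpha> \<noteq> {}" for \<alpha>
  proof -
    note \<phi> = index_map_component[OF \<alpha>]
    have "?R2 \<alpha> (chr_map2 n (flip p)) = chr_map2 1 (?R2 \<alpha> (flip p))"
      by (rule reindex_chr_map2[OF \<phi> flip_tset[OF p]])
    also have "?R2 \<alpha> (flip p) = flip (?R2 \<alpha> p)"
      by (rule reindex_flip[OF \<phi>]) (use p tset_subset in blast)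
    also have "chr_map2 1 (flip (?R2 \<alpha> p)) = flip (chr_map2 1 (?R2 \<alpha> p))"
      using curv[of "?R2 \<alpha> p"] reindex_tset[OF index_map_lift[OF index_map_lift[OF \<phi>]] p]
      unfolding Phi_chart_1 three by blast
    also have "chr_map2 1 (?R2 \<alpha> p) = ?R2 \<alpha> (chr_map2 n p)"
      by (rule reindex_chr_map2[OF \<phi> p, symmetric])
    also have "flip \<dots> = ?R2 \<alpha> (flip (chr_map2 n p))"
      by (rule reindex_flip[OF \<phi>, symmetric]) (use chr_map2_tset[OF p] tset_subset in blast)
    finally show ?thesis .
  qed
  obtain x u v w where 1: "chr_map2 n (flip p) = Pair (Pair x u) (Pair v w)"
    and in1: "x \<in> topspace (tspace n)" "u \<in> topspace (tspace n)"
      "v \<in> topspace (tspace n)" "w \<in> topspace (tspace n)"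
    by (rule tspace_SucSucE[OF subsetD[OF tset_subset Q(1)]])
  obtain x' u' v' w' where 2: "flip (chr_map2 n p) = Pair (Pair x' u') (Pair v' w')"
    and in2: "x' \<in> topspace (tspace n)" "u' \<in> topspace (tspace n)"
      "v' \<in> topspace (tspace n)" "w' \<in> topspace (tspace n)"
    by (rule tspace_SucSucE[OF subsetD[OF tset_subset Q(2)]])
  have R_eq: "?R \<alpha> x = ?R \<alpha> x'" "?R \<alpha> u = ?R \<alpha> u'" "?R \<alpha> v = ?R \<alpha> v'" "?R \<alpha> w = ?R \<alpha> w'"
    if "\<alpha> \<subseteq> {..<n}" "\<alpha> \<noteq> {}" for \<alpha>
    using R2_eq[OF that]
    unfolding 1 2 reindex_lift_Pair[OF index_map_lift[OF index_map_component[OF that]]]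
      reindex_lift_Pair[OF index_map_component[OF that]]
    by (simp_all del: One_nat_def)
  then show ?thesis
    unfolding 1 2
    using eq_if_components_eq[OF in1(1) in2(1) n R_eq(1)] eq_if_components_eq[OF in1(2) in2(2) n R_eq(2)]
      eq_if_components_eq[OF in1(3) in2(3) n R_eq(3)] eq_if_components_eq[OF in1(4) in2(4) n R_eq(4)]
    by simp
qed

text \<open>
  The flip commutes with both factors of \<open>TT\<Phi>\<^sup>n \<circ> (TB\<^sub>n \<circ> B\<^bsub>n+1\<^esub>)\<close>: with the first by the symmetry of
  second derivatives, with the second by the vanishing of the curvature.
\<close>

lemma Phi_flip:
  assumes p: "p \<in> tset (Suc (Suc (k + 2))) U"
    and curv: "\<And>q. q \<in> tset 3 U \<Longrightarrow> \<Phi> 1 (flip q) = flip (\<Phi> 1 q)"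
  shows "\<Phi> (Suc (Suc k)) (flip p) = flip (\<Phi> (Suc (Suc k)) p)"
proof -
  let ?n = "k + 2"
  have TS: "smooth_map (Suc ?n) (Suc ?n) (T ?n (\<Phi> k))"
    and tsp: "tspace (Suc ?n) = (pair_space (tspace ?n) (tspace ?n) :: ('k, 'v) tm topology)"
    using smooth_tangent[OF smooth_Phi tree_tspace tree_tspace open_tset]
    by (simp_all add: tspace.simps tset_tangent)
  have S: "smooth_map (Suc ?n) (Suc ?n) (\<Phi> (Suc k))" using smooth_Phi[of "Suc k"] by simp
  have eq: "\<Phi> (Suc (Suc k)) q = T (Suc ?n) (T ?n (\<Phi> k)) (chr_map2 ?n q)"
    if q: "q \<in> tset (Suc (Suc ?n)) U" for q
  proof -
    have "T (Suc ?n) (\<Phi> (Suc k)) (chr_map (Suc ?n) b q) =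
      T (Suc ?n) (T ?n (\<Phi> k)) (T (Suc ?n) (chr_map ?n b) (chr_map (Suc ?n) b q))"
      by (rule tangent_chain[OF smooth_chr_map TS S tree_tspace tree_tspace tree_tspace
            open_tset open_tset open_tset open_tset subset_refl subset_refl chr_map_image Phi_chart_Suc
            chr_map_tset[OF q, unfolded tset_tangent[of "Suc ?n"]]])
    then show ?thesis
      using Phi_chart_Suc[of "Suc k" sc U b q] by (simp add: chr_map2_def)
  qed
  have "chr_map2 ?n p \<in> tangent_dom (pair_space (tspace ?n) (tspace ?n)) (tangent_dom (tspace ?n) (tset ?n U))"
    using chr_map2_tset[OF p] by (simp only: tset_tangent tsp)
  from tangent_tangent_flip[OF smooth_Phi tree_tspace tree_tspace open_tset this]
  have "T (Suc ?n) (T ?n (\<Phi> k)) (flip (chr_map2 ?n p)) = flip (T (Suc ?n) (T ?n (\<Phi> k)) (chr_map2 ?n p))"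
    by (simp only: tset_tangent tsp)
  then show ?thesis
    using eq[OF p] eq[OF flip_tset[OF p]] chr_map2_flip[OF p _ curv] by simp
qed

lemma equivariant_comp:
  assumes "equivariant k F" "equivariant k G" "\<And>p. p \<in> tset (k + 2) U \<Longrightarrow> G p \<in> tset (k + 2) U"
  shows "equivariant k (\<lambda>p. F (G p))"
  using assms by (simp add: equivariant_def)

lemma equivariant_cong:
  assumes "equivariant k F" "\<And>p. p \<in> tset (k + 2) U \<Longrightarrow> G p = F p"
  shows "equivariant k G"
  using assms Phi_tset by (simp add: equivariant_def)

lemma perm_chart_tset:
  fixes V :: "'v set"
  shows "\<sigma> permutes {..<n} \<Longrightarrow> p \<in> tset n V \<Longrightarrow> perm_chart n \<sigma> p \<in> tset n V"
  unfolding perm_chart_reindex by (rule reindex_tset[OF index_map_perm])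

text \<open>
  For two units the only coefficient which changes contains \<open>b\<^sub>x(v\<^sub>0, v\<^sub>1)\<close>.
\<close>

lemma equivariant_perm_0:
  assumes sym: "\<And>x u v. x \<in> U \<Longrightarrow> b x u v = b x v u" and \<sigma>: "\<sigma> permutes {..<2}"
  shows "equivariant 0 (perm_chart 2 \<sigma>)"
  unfolding equivariant_def
proof
  fix p :: "('k, 'v) tm" assume p: "p \<in> tset (0 + 2) U"
  let ?\<sigma> = "inv \<sigma>"
  have \<sigma>': "?\<sigma> permutes {..<2}" by (rule permutes_inv[OF \<sigma>])
  then have swap: "{?\<sigma> 0, ?\<sigma> 1} = {0, 1}"
    using permutes_image[OF \<sigma>'] by (simp add: lessThan_Suc numeral_2_eq_2 insert_commute)
  have *: "tcoord 2 (\<Phi> 0 q) \<alpha> = (if \<alpha> = {0, 1}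
      then tcoord 2 q {0, 1} + b (tcoord 2 q {}) (tcoord 2 q {0}) (tcoord 2 q {1}) else tcoord 2 q \<alpha>)"
    if "\<alpha> \<subseteq> {..<2}" for q \<alpha>
    using that by (simp add: Phi_chart.simps tcoord_tpoint Int_absorb2 del: One_nat_def)
  have "\<Phi> 0 (perm_chart 2 \<sigma> p) = perm_chart 2 \<sigma> (\<Phi> 0 p)"
  proof (rule tcoord_eqI[where n = 2])
    fix \<alpha> :: "nat set" assume \<alpha>: "\<alpha> \<subseteq> {..<2}"
    then have \<sigma>\<alpha>: "?\<sigma> ` \<alpha> \<subseteq> {..<2}" by (rule image_subset_permutes[OF \<sigma>'])
    have x: "tcoord 2 p {} \<in> U" using p unfolding add_0 tset_iff by blast
    have "?\<sigma> ` \<alpha> = {0, 1} \<longleftrightarrow> \<alpha> = {0, 1}"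
    proof
      assume "?\<sigma> ` \<alpha> = {0, 1}"
      also have "\<dots> = ?\<sigma> ` {0, 1}" using swap by auto
      finally show "\<alpha> = {0, 1}" by (rule iffD1[OF inj_image_eq_iff[OF permutes_inj[OF \<sigma>']]])
    qed (use swap in auto)
    moreover have "b (tcoord 2 p {}) (tcoord 2 p {?\<sigma> 0}) (tcoord 2 p {?\<sigma> 1}) =
        b (tcoord 2 p {}) (tcoord 2 p {0}) (tcoord 2 p {1})"
      using swap sym[OF x] by (fastforce simp: doubleton_eq_iff)
    moreover have "?\<sigma> ` {0, 1} = {0, 1}" using swap by auto
    ultimately show "tcoord 2 (\<Phi> 0 (perm_chart 2 \<sigma> p)) \<alpha> = tcoord 2 (perm_chart 2 \<sigma> (\<Phi> 0 p)) \<alpha>"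
      using \<alpha> \<sigma>\<alpha> by (simp add: * tcoord_perm_chart del: One_nat_def)
  qed (simp_all add: Phi_chart.simps perm_chart_def)
  then show "\<Phi> 0 (perm_chart 2 \<sigma> p) = perm_chart 2 \<sigma> (\<Phi> 0 p)" .
qed

text \<open>
  The cases \<open>k = 0\<close> and \<open>k = 1\<close> are the hypotheses on torsion and curvature.  Later steps use the
  generators: permutations of the old units lift, and the exchange of the last two units is the flip.
\<close>

theorem equivariant_perm:
  assumes sym: "\<And>x u v. x \<in> U \<Longrightarrow> b x u v = b x v u"
    and curv: "\<And>\<sigma>. \<sigma> permutes {..<3} \<Longrightarrow> equivariant 1 (perm_chart 3 \<sigma>)"
    and \<sigma>: "\<sigma> permutes {..<k + 2}"
  shows "equivariant k (perm_chart (k + 2) \<sigma>)"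
  using \<sigma>
proof (induction k arbitrary: \<sigma>)
  case 0
  then show ?case using equivariant_perm_0[OF sym] by (simp add: numeral_2_eq_2)
next
  case (Suc k)
  show ?case
  proof (cases k)
    case 0
    then show ?thesis using curv[of \<sigma>] Suc.prems by (simp add: numeral_3_eq_3)
  next
    case (Suc l)
    have flip: "\<Phi> 1 (flip q) = flip (\<Phi> 1 q)" if q: "q \<in> tset 3 U" for q
    proof -
      have "Transposition.transpose 1 2 permutes {..<3::nat}" by (rule permutes_swap_id) auto
      then have "\<Phi> 1 (perm_chart 3 (Transposition.transpose 1 2) q) = perm_chart 3 (Transposition.transpose 1 2) (\<Phi> 1 q)"
        using curv q by (simp add: equivariant_def numeral_3_eq_3)
      moreover have "perm_chart 3 (Transposition.transpose 1 2) y = flip y" if "y \<in> tset 3 U" for y :: "('k, 'v) tm"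
        using perm_chart_transpose_last[of y 1] that tset_subset[of 3 U]
        by (auto simp: numeral_3_eq_3 numeral_2_eq_2)
      ultimately show ?thesis using q Phi_tset[of q 1] by (simp add: numeral_3_eq_3)
    qed
    let ?P = "\<lambda>\<sigma>. equivariant (Suc k) (perm_chart (Suc k + 2) \<sigma>)"
    have N: "Suc k + 2 = Suc (Suc (k + 1))" by simp
    show ?thesis
    proof (rule permutes_lessThan_Suc_induct[where P = ?P and n = "k + 1"])
      show "\<sigma> permutes {..<Suc (Suc (k + 1))}" using Suc.prems by simp
      show "?P \<sigma>" if "\<sigma> permutes {..<Suc (k + 1)}" for \<sigma>
      proof -
        have \<sigma>: "\<sigma> permutes {..<k + 2}" using that by simp
        from equivariant_lift[OF index_map_perm[OF \<sigma>] Suc.IH[OF \<sigma>, unfolded perm_chart_reindex]]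
        show ?thesis unfolding perm_chart_lift[OF \<sigma>] by simp
      qed
      show "?P (Transposition.transpose (k + 1) (Suc (k + 1)))"
      proof (rule equivariant_cong)
        show "equivariant (Suc k) flip"
          unfolding equivariant_def \<open>k = Suc l\<close> using Phi_flip[OF _ flip] by simp
        show "perm_chart (Suc k + 2) (Transposition.transpose (k + 1) (Suc (k + 1))) p = flip p"
          if "p \<in> tset (Suc k + 2) U" for p :: "('k, 'v) tm"
          unfolding N by (rule perm_chart_transpose_last[OF subsetD[OF tset_subset that[unfolded N]]])
      qed
      fix \<sigma> \<tau> assume "\<sigma> permutes {..<Suc (Suc (k + 1))}" "\<tau> permutes {..<Suc (Suc (k + 1))}"
        and P: "?P \<sigma>" "?P \<tau>"
      then have perm: "\<sigma> permutes {..<Suc k + 2}" "\<tau> permutes {..<Suc k + 2}" by simp_all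
      show "?P (\<sigma> \<circ> \<tau>)"
        by (rule equivariant_cong[OF equivariant_comp[OF P perm_chart_tset[OF perm(2)]] perm_chart_comp[OF perm]])
    qed
  qed
qed

text \<open>
  For two units, \<open>\<epsilon>\<^sub>0\<close> has the coefficient \<open>0\<close> after the shift, so that the Christoffel term vanishes
  there, and a Christoffel term added before the shift is discarded by it.
\<close>

lemma equivariant_shift_01: "equivariant k (shift_chart (k + 2) 0 1)"
proof (induction k)
  case 0
  have "\<Phi> 0 (shift_chart 2 0 1 p) = shift_chart 2 0 1 (\<Phi> 0 p)" if p: "p \<in> tset 2 U" for p :: "('k, 'v) tm"
  proof (rule tcoord_eqI[where n = 2])
    fix \<alpha> :: "nat set" assume \<alpha>: "\<alpha> \<subseteq> {..<2}"
    have *: "tcoord 2 (\<Phi> 0 q) \<alpha> = (if \<alpha> = {0, 1}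
        then tcoord 2 q {0, 1} + b (tcoord 2 q {}) (tcoord 2 q {0}) (tcoord 2 q {1}) else tcoord 2 q \<alpha>)"
      if "\<alpha> \<subseteq> {..<2}" for q \<alpha>
      using that by (simp add: Phi_chart.simps tcoord_tpoint Int_absorb2 del: One_nat_def)
    have **: "tcoord 2 (shift_chart 2 0 1 q) \<alpha> =
        (if 0 \<notin> \<alpha> then tcoord 2 q \<alpha> else if 1 \<in> \<alpha> then tcoord 2 q (\<alpha> - {1}) else 0)"
      if "\<alpha> \<subseteq> {..<2}" for q :: "('k, 'v) tm" and \<alpha>
      using that by (simp add: shift_chart_reindex tcoord_reindex split: if_splits)
    have x: "tcoord 2 p {} \<in> U" using p by (simp add: tset_iff)
    have d: "\<alpha> - {1} \<subseteq> {..<2}" "{0, 1} - {1} = {0::nat}" "1 \<notin> \<alpha> - {1}" using \<alpha> by auto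
    have "\<alpha> - {1} \<noteq> {0, 1}" by (metis d(3) insertI1 insert_commute)
    then show "tcoord 2 (\<Phi> 0 (shift_chart 2 0 1 p)) \<alpha> = tcoord 2 (shift_chart 2 0 1 (\<Phi> 0 p)) \<alpha>"
      using \<alpha> d b_zero[OF x] by (auto simp: * ** simp del: One_nat_def)
  qed (simp_all add: Phi_chart.simps shift_chart_def)
  then show ?case by (simp add: equivariant_def numeral_2_eq_2)
next
  case (Suc k)
  have "equivariant (Suc k) (shift_chart (Suc (k + 2)) 0 1)"
    using equivariant_lift[OF index_map_shift Suc.IH[unfolded shift_chart_reindex]]
    unfolding shift_chart_lift[of 0 "k + 2" 1, simplified] by (simp add: shift_chart_lift)
  then show ?case by simp
qed

lemma exists_permutation_mapping_pair:
  assumes "i < n" "j < n" "i \<noteq> (j::nat)"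
  obtains \<sigma> where "\<sigma> permutes {..<n}" "\<sigma> 0 = i" "\<sigma> 1 = j"
proof -
  define j' where "j' = Transposition.transpose 0 i j"
  have n: "0 < n" "1 < n" using assms by auto
  have j': "j' \<noteq> 0" "j' < n" "Transposition.transpose 0 i j' = j" using assms n by (auto simp: j'_def Transposition.transpose_def)
  have "Transposition.transpose 0 i \<circ> Transposition.transpose 1 j' permutes {..<n}"
    using assms n j' by (intro permutes_compose permutes_swap_id) auto
  moreover have "(Transposition.transpose 0 i \<circ> Transposition.transpose 1 j') 0 = i" "(Transposition.transpose 0 i \<circ> Transposition.transpose 1 j') 1 = j"
    using j' by auto
  ultimately show ?thesis using that by blast
qed

lemma shift_chart_conjugate:
  assumes \<sigma>: "\<sigma> permutes {..<n}"
  shows "shift_chart n (\<sigma> i) (\<sigma> j) p = perm_chart n \<sigma> (shift_chart n i j (perm_chart n (inv \<sigma>) p))"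
  unfolding shift_chart_def[of n "\<sigma> i"] perm_chart_def[of n \<sigma>]
proof (rule tpoint_cong)
  fix \<beta> assume \<beta>: "\<beta> \<subseteq> {..<n}"
  have s\<beta>: "inv \<sigma> ` \<beta> \<subseteq> {..<n}" by (rule image_subset_permutes[OF permutes_inv[OF \<sigma>] \<beta>])
  have mem: "i \<in> inv \<sigma> ` \<beta> \<longleftrightarrow> \<sigma> i \<in> \<beta>" for i
    using permutes_inverses[OF \<sigma>] by (metis imageE image_eqI)
  have "\<sigma> ` (inv \<sigma> ` \<beta>) = \<beta>" "\<sigma> ` (inv \<sigma> ` \<beta> - {j}) = \<beta> - {\<sigma> j}"
    using permutes_inverses[OF \<sigma>] permutes_inj[OF \<sigma>] by (auto simp: image_comp image_set_diff)
  moreover have "inv \<sigma> ` \<beta> - {j} \<subseteq> {..<n}" using s\<beta> by auto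
  ultimately show "(if \<sigma> i \<notin> \<beta> then tcoord n p \<beta> else if \<sigma> j \<in> \<beta> then tcoord n p (\<beta> - {\<sigma> j}) else 0) =
      tcoord n (shift_chart n i j (perm_chart n (inv \<sigma>) p)) (inv \<sigma> ` \<beta>)"
    using s\<beta> mem by (simp add: shift_chart_reindex tcoord_reindex tcoord_perm_chart permutes_inv_inv[OF \<sigma>])
qed

theorem equivariant_shift:
  assumes perm: "\<And>\<sigma>. \<sigma> permutes {..<k + 2} \<Longrightarrow> equivariant k (perm_chart (k + 2) \<sigma>)"
    and ij: "i < k + 2" "j < k + 2" "i \<noteq> j"
  shows "equivariant k (shift_chart (k + 2) i j)"
proof -
  obtain \<sigma> where \<sigma>: "\<sigma> permutes {..<k + 2}" "\<sigma> 0 = i" "\<sigma> 1 = j"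
    using exists_permutation_mapping_pair[OF ij] .
  note \<sigma>' = permutes_inv[OF \<sigma>(1)]
  have shift_tset: "shift_chart (k + 2) 0 1 p \<in> tset (k + 2) U" if "p \<in> tset (k + 2) U" for p :: "('k, 'v) tm"
    unfolding shift_chart_reindex by (rule reindex_tset[OF index_map_shift that]) simp
  show ?thesis
  proof (rule equivariant_cong)
    show "equivariant k (\<lambda>p. perm_chart (k + 2) \<sigma> (shift_chart (k + 2) 0 1 (perm_chart (k + 2) (inv \<sigma>) p)))"
      by (intro equivariant_comp[OF perm[OF \<sigma>(1)]] equivariant_comp[OF equivariant_shift_01 perm[OF \<sigma>']]
          shift_tset perm_chart_tset[OF \<sigma>'])
    show "shift_chart (k + 2) i j p =
        perm_chart (k + 2) \<sigma> (shift_chart (k + 2) 0 1 (perm_chart (k + 2) (inv \<sigma>) p))" for p :: "('k, 'v) tm"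
      using shift_chart_conjugate[OF \<sigma>(1), of 0 1 p] \<sigma>(2,3) by simp
  qed
qed

end


section \<open>Iterated tangent bundles\<close>

lemma tcoord_tmap_base: "tcoord n (tmap n sc U f p) {} = f (tcoord n p {})"
  by (induction n arbitrary: p) (simp_all add: tcoord.simps tangent_map_def)

context topological_module
begin

abbreviation smooth_vec :: "'v set \<Rightarrow> ('v \<Rightarrow> 'v) \<Rightarrow> bool" where
  "smooth_vec U f \<equiv> smooth sc vec_space vec_space (Vec ` U) (\<lambda>p. Vec (f (vec_of p)))"

lemma smooth_tmap:
  assumes "smooth_vec U f" "open U"
  shows "smooth sc (tspace n) (tspace n) (tset n U) (tmap n sc U f)"
proof (induction n)
  case 0
  then show ?case using assms by (simp add: tset.simps tspace.simps)
next
  case (Suc n)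
  then show ?case
    using smooth_tangent[OF Suc tree_module_tspace tree_module_tspace openin_tset[OF assms(2)]]
    by (simp add: tset_Suc_tangent_dom tspace.simps)
qed

lemma tmap_tset:
  assumes "smooth_vec U f" "open U" "p \<in> tset n U" "f (tcoord n p {}) \<in> U'"
  shows "tmap n sc U f p \<in> tset n U'"
  unfolding tset_iff tcoord_tmap_base
  using smooth_maps[OF smooth_tmap[OF assms(1,2)] tree_module_tspace tree_module_tspace tset_subset assms(3)]
    assms(4) by blast

text \<open>
  Functoriality of iterated tangent maps, in the local form which changes of charts require.
\<close>

lemma tmap_chain:
  assumes f: "smooth_vec U f" "open U" and g: "smooth_vec U' g" "open U'"
    and h: "smooth_vec W' h" "open W'" and W: "open W" "W \<subseteq> U" "W \<subseteq> W'" "f ` W \<subseteq> U'"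
    and eq: "\<And>x. x \<in> W \<Longrightarrow> h x = g (f x)" and p: "p \<in> tset n W"
  shows "tmap n sc W' h p = tmap n sc U' g (tmap n sc U f p)"
  using p
proof (induction n arbitrary: p)
  case 0
  then show ?case using eq by (auto simp: tset.simps)
next
  case (Suc n)
  have mono: "tset n W \<subseteq> (tset n V :: ('k, 'v) tm set)" if "W \<subseteq> V" for V
    using that by (auto simp: tset_iff)
  have "tmap n sc U f ` tset n W \<subseteq> tset n U'"
  proof safe
    fix p :: "('k, 'v) tm" assume p: "p \<in> tset n W"
    then have "f (tcoord n p {}) \<in> U'" using W(4) by (auto simp: tset_iff)
    then show "tmap n sc U f p \<in> tset n U'"
      by (rule tmap_tset[OF f subsetD[OF mono[OF W(2)] p]])
  qed
  then show ?case
    unfolding tmap.simps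
    by (rule tangent_chain[OF smooth_tmap[OF f] smooth_tmap[OF g] smooth_tmap[OF h]
        tree_module_tspace tree_module_tspace tree_module_tspace openin_tset[OF f(2)] openin_tset[OF g(2)]
        openin_tset[OF h(2)] openin_tset[OF W(1)] mono[OF W(2)] mono[OF W(3)] _ Suc.IH
        Suc.prems[unfolded tset_Suc_tangent_dom]])
qed

lemma tmap_id:
  assumes U: "open U" and id: "\<And>x. x \<in> U \<Longrightarrow> f x = x" and p: "p \<in> tset n U"
  shows "tmap n sc U f p = p"
  using p
proof (induction n arbitrary: p)
  case 0
  then show ?case using id by (auto simp: tset.simps)
next
  case (Suc n)
  note tree = tree_module_tspace[of n, where ?'a = 'k and ?'b = 'v] and opn = openin_tset[OF U, of n]
  have S: "smooth sc (tspace n) (tspace n) (tset n U) (\<lambda>p. p)"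
    by (rule smooth_linear[OF tm_linear_id tree tree tset_subset])
  have T: "smooth sc (tspace n) (tspace n) (tset n U) (tmap n sc U f)"
    by (rule smooth_cong_subset[OF S subset_refl Suc.IH tset_subset])
  obtain q r where p: "p = Pair q r" "q \<in> tset n U" "r \<in> topspace (tspace n)"
    using Suc.prems unfolding tset_Suc_tangent_dom by (rule in_tangent_domE)
  have "differential sc (tspace n) (tspace n) (tset n U) (tmap n sc U f) q r = r"
    using differential_chain[OF S S T tree tree tree opn opn opn opn subset_refl subset_refl
        _ Suc.IH p(2,3)] differential_linear[OF tm_linear_id tree tree opn p(2,3)] by simp
  then show ?case using Suc.IH[OF p(2)] by (simp add: p(1) tangent_map_def)
qed

context
  fixes A :: "('m::topological_space, 'v) chart set"
  assumes atlas: "smooth_atlas sc A"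
begin

lemma chart_homeomorphism:
  assumes "c \<in> A"
  obtains \<psi> where "homeomorphism (cdom c) (cimg c) (cmap c) \<psi>"
  using atlas assms unfolding smooth_atlas_def by blast

lemma chart_inj: "c \<in> A \<Longrightarrow> inj_on (cmap c) (cdom c)"
  by (rule chart_homeomorphism) (auto simp: homeomorphism_def intro: inj_on_inverseI)

lemma transition_cmap: "c \<in> A \<Longrightarrow> m \<in> cdom c \<Longrightarrow> transition c d (cmap c m) = cmap d m"
  by (simp add: transition_def chart_inj)

lemma open_cimg: "c \<in> A \<Longrightarrow> open (cimg c)"
  using atlas unfolding smooth_atlas_def by blast

lemma open_cdom: "c \<in> A \<Longrightarrow> open (cdom c)"
  using atlas unfolding smooth_atlas_def by blast

lemma open_cmap_image:
  assumes "c \<in> A" "open S" "S \<subseteq> cdom c"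
  shows "open (cmap c ` S)"
proof -
  obtain \<psi> where "homeomorphism (cdom c) (cimg c) (cmap c) \<psi>"
    using chart_homeomorphism[OF assms(1)] .
  then have "openin (top_of_set (cimg c)) (cmap c ` S)"
    using assms(2,3) by (intro homeomorphism_imp_open_map) (auto intro: open_subset)
  then show ?thesis using open_cimg[OF assms(1)] by (simp add: openin_open_eq)
qed

lemma smooth_transition: "c \<in> A \<Longrightarrow> d \<in> A \<Longrightarrow> smooth_vec (overlap c d) (transition c d)"
  using atlas unfolding smooth_atlas_def by blast

lemma open_overlap: "c \<in> A \<Longrightarrow> d \<in> A \<Longrightarrow> open (overlap c d)"
  unfolding overlap_def by (intro open_cmap_image open_Int open_cdom) auto

text \<open>
  The expressions in the other charts have to be the images of the given one under the iterated
  tangent maps of the transition maps; functoriality on triple overlaps makes them compatible.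
\<close>

lemma point_of_chart_expression:
  fixes p :: "('k, 'v) tm"
  assumes c: "c \<in> A" "m \<in> cdom c" and p: "p \<in> tset n {cmap c m}"
  obtains \<xi> where "(m, \<xi>) \<in> tangent_bundle n sc A" "\<xi> c = p"
proof -
  define \<xi> where "\<xi> d = (if d \<in> A \<and> m \<in> cdom d then tmap n sc (overlap c d) (transition c d) p
    else undefined)" for d
  have p_in: "p \<in> tset n V" if "cmap c m \<in> V" for V
    using p that by (simp add: tset_iff)
  have base: "tcoord n p {} = cmap c m" using p by (simp add: tset_iff)
  have overlap: "cmap c m \<in> overlap c d" if "m \<in> cdom d" for d
    using that c by (simp add: overlap_def)
  have expr: "\<xi> d \<in> tset n {cmap d m}" if d: "d \<in> A" "m \<in> cdom d" for d
    using tmap_tset[OF smooth_transition open_overlap p_in[OF overlap], of d "{cmap d m}"] c d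
    by (simp add: \<xi>_def base transition_cmap)
  have compatible: "\<xi> e = tmap n sc (overlap d e) (transition d e) (\<xi> d)"
    if d: "d \<in> A" "m \<in> cdom d" and e: "e \<in> A" "m \<in> cdom e" for d e
  proof -
    \<comment> \<open>the triple overlap, on which the transition maps compose\<close>
    let ?W = "cmap c ` (cdom c \<inter> cdom d \<inter> cdom e)"
    have W: "open ?W" "?W \<subseteq> overlap c d" "?W \<subseteq> overlap c e"
      using c d e by (auto simp: overlap_def intro!: open_cmap_image open_Int open_cdom)
    have "transition c d ` ?W \<subseteq> overlap d e"
      using c d e by (auto simp: overlap_def transition_cmap)
    moreover have "transition c e x = transition d e (transition c d x)" if "x \<in> ?W" for x
      using that c d e by (auto simp: transition_cmap)
    moreover have "p \<in> tset n ?W" using c d e by (intro p_in) auto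
    ultimately have "tmap n sc (overlap c e) (transition c e) p =
      tmap n sc (overlap d e) (transition d e) (tmap n sc (overlap c d) (transition c d) p)"
      using c d e W
      by (intro tmap_chain[where W = ?W and f = "transition c d" and g = "transition d e"]
          smooth_transition open_overlap) auto
    then show ?thesis using d e by (simp add: \<xi>_def)
  qed
  have "(m, \<xi>) \<in> tangent_bundle n sc A"
    unfolding tangent_bundle_def mem_Collect_eq case_prod_conv
  proof (intro conjI ballI allI impI)
    show "\<xi> d = undefined" if "\<not> (d \<in> A \<and> m \<in> cdom d)" for d
      using that by (auto simp: \<xi>_def)
  qed (use expr compatible in blast)+
  moreover have "\<xi> c = p"
  proof -
    have "tmap n sc (overlap c c) (transition c c) p = p"
    proof (rule tmap_id[OF open_overlap[OF c(1) c(1)] _ p_in[OF overlap[OF c(2)]]])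
      show "transition c c x = x" if "x \<in> overlap c c" for x
        using that transition_cmap[OF c(1)] unfolding overlap_def by blast
    qed
    then show ?thesis using c by (simp add: \<xi>_def)
  qed
  ultimately show ?thesis using that by blast
qed

end

lemma reindex_chart_struct:
  assumes \<phi>: "index_map n n \<phi>"
  shows "reindex n n \<phi> (ladd (chart_struct n sc) p q) =
      ladd (chart_struct n sc) (reindex n n \<phi> p) (reindex n n \<phi> q)"
    and "reindex n n \<phi> (lscale (chart_struct n sc) t p) =
      lscale (chart_struct n sc) t (reindex n n \<phi> p)"
proof -
  have tc: "tcoord n (reindex n n \<phi> p) \<gamma> = (case \<phi> \<gamma> of None \<Rightarrow> 0 | Some \<alpha> \<Rightarrow> tcoord n p \<alpha>)"
    if "\<gamma> \<subseteq> {..<n}" for p :: "('k, 'v) tm" and \<gamma> by (rule tcoord_reindex[OF that])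
  have \<phi>': "\<alpha> \<inter> {..<n} = \<alpha>" "\<alpha> = {} \<longleftrightarrow> \<gamma> = {}" if "\<gamma> \<subseteq> {..<n}" "\<phi> \<gamma> = Some \<alpha>" for \<gamma> \<alpha>
    using index_mapD[OF \<phi>] that by auto
  have e: "\<phi> \<gamma> = None \<Longrightarrow> \<gamma> \<noteq> {}" for \<gamma> using index_mapD(1)[OF \<phi>] by auto
  show "reindex n n \<phi> (ladd (chart_struct n sc) p q) =
      ladd (chart_struct n sc) (reindex n n \<phi> p) (reindex n n \<phi> q)"
    unfolding chart_struct_def lin_struct.simps reindex_def[of n n \<phi> "tpoint n _"]
  proof (rule tpoint_cong)
    fix \<gamma> assume \<gamma>: "\<gamma> \<subseteq> {..<n}"
    show "(case \<phi> \<gamma> of None \<Rightarrow> 0 | Some \<alpha> \<Rightarrow> tcoord n (tpoint n (\<lambda>\<alpha>.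
         if \<alpha> = {} then tcoord n p {} else tcoord n p \<alpha> + tcoord n q \<alpha>)) \<alpha>) =
      (if \<gamma> = {} then tcoord n (reindex n n \<phi> p) {}
       else tcoord n (reindex n n \<phi> p) \<gamma> + tcoord n (reindex n n \<phi> q) \<gamma>)"
      using \<gamma> \<phi>'[OF \<gamma>] e[of \<gamma>] index_mapD(1)[OF \<phi>]
      by (cases "\<phi> \<gamma>") (simp_all add: tc tcoord_tpoint)
  qed
  show "reindex n n \<phi> (lscale (chart_struct n sc) t p) =
      lscale (chart_struct n sc) t (reindex n n \<phi> p)"
    unfolding chart_struct_def lin_struct.simps reindex_def[of n n \<phi> "tpoint n _"]
  proof (rule tpoint_cong)
    fix \<gamma> assume \<gamma>: "\<gamma> \<subseteq> {..<n}"
    show "(case \<phi> \<gamma> of None \<Rightarrow> 0 | Some \<alpha> \<Rightarrow> tcoord n (tpoint n (\<lambda>\<alpha>.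
         if \<alpha> = {} then tcoord n p {} else sc t (tcoord n p \<alpha>))) \<alpha>) =
      (if \<gamma> = {} then tcoord n (reindex n n \<phi> p) {} else sc t (tcoord n (reindex n n \<phi> p) \<gamma>))"
      using \<gamma> \<phi>'[OF \<gamma>] e[of \<gamma>] index_mapD(1)[OF \<phi>]
      by (cases "\<phi> \<gamma>") (simp_all add: tc tcoord_tpoint)
  qed
qed

lemma chart_struct_tset:
  assumes "p \<in> tset n U"
  shows "ladd (chart_struct n sc) p q \<in> tset n U" "lscale (chart_struct n sc) t p \<in> tset n U"
  using assms by (simp_all add: chart_struct_def tset_iff tcoord_tpoint)

end

context chart_connection
begin

definition \<Phi>_inv :: "nat \<Rightarrow> ('k, 'v) tm \<Rightarrow> ('k, 'v) tm" where
  "\<Phi>_inv k = inv_into (tset (k + 2) U) (\<Phi> k)"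

lemma Phi_inverse:
  assumes "p \<in> tset (k + 2) U"
  shows "\<Phi>_inv k (\<Phi> k p) = p" "\<Phi> k (\<Phi>_inv k p) = p" "\<Phi>_inv k p \<in> tset (k + 2) U"
proof -
  note bij = Phi_bij_betw[of k]
  show "\<Phi>_inv k (\<Phi> k p) = p" "\<Phi> k (\<Phi>_inv k p) = p"
    unfolding \<Phi>_inv_def
    by (rule bij_betw_inv_into_left[OF bij assms] bij_betw_inv_into_right[OF bij assms])+
  show "\<Phi>_inv k p \<in> tset (k + 2) U"
    unfolding \<Phi>_inv_def using assms bij_betw_inv_into[OF bij] by (rule bij_betwE[rule_format, rotated])
qed

text \<open>
  An equivariant reindexing also commutes with \<open>\<Phi>\<^sup>-\<^sup>1\<close>, and it is linear for the structure of the chart.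
\<close>

lemma push_forward_linear:
  assumes \<phi>: "index_map (k + 2) (k + 2) \<phi>" and eq: "equivariant k (reindex (k + 2) (k + 2) \<phi>)"
    and p: "p \<in> tset (k + 2) U"
  defines "R \<equiv> reindex (k + 2) (k + 2) \<phi>" and "S \<equiv> chart_struct (k + 2) sc"
  shows "q \<in> tset (k + 2) U \<Longrightarrow> R (\<Phi> k (ladd S (\<Phi>_inv k p) (\<Phi>_inv k q))) =
      \<Phi> k (ladd S (\<Phi>_inv k (R p)) (\<Phi>_inv k (R q)))"
    and "R (\<Phi> k (lscale S t (\<Phi>_inv k p))) = \<Phi> k (lscale S t (\<Phi>_inv k (R p)))"
proof -
  have comm: "R (\<Phi> k x) = \<Phi> k (R x)" if "x \<in> tset (k + 2) U" for x
    using eq that by (simp add: equivariant_def R_def)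
  have inv: "\<Phi>_inv k (R x) = R (\<Phi>_inv k x)" if x: "x \<in> tset (k + 2) U" for x
    using comm[OF Phi_inverse(3)[OF x]] Phi_inverse(1)[OF reindex_tset[OF \<phi> Phi_inverse(3)[OF x]]]
      Phi_inverse(2)[OF x] by (simp add: R_def)
  show "R (\<Phi> k (ladd S (\<Phi>_inv k p) (\<Phi>_inv k q))) = \<Phi> k (ladd S (\<Phi>_inv k (R p)) (\<Phi>_inv k (R q)))"
    if q: "q \<in> tset (k + 2) U"
    unfolding inv[OF p] inv[OF q]
    using comm[OF chart_struct_tset(1)[OF Phi_inverse(3)[OF p]]] reindex_chart_struct(1)[OF \<phi>]
    by (simp add: R_def S_def)
  show "R (\<Phi> k (lscale S t (\<Phi>_inv k p))) = \<Phi> k (lscale S t (\<Phi>_inv k (R p)))"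
    unfolding inv[OF p]
    using comm[OF chart_struct_tset(2)[OF Phi_inverse(3)[OF p]]] reindex_chart_struct(2)[OF \<phi>]
    by (simp add: R_def S_def)
qed

end

lemma bundle_chart_expression:
  assumes "\<xi> \<in> fiber (tangent_bundle n sc A) m" "c \<in> A" "m \<in> cdom c"
  shows "fst \<xi> = m" "snd \<xi> c \<in> tset n (cimg c)"
proof -
  obtain \<xi>' where \<xi>': "\<xi> = (m, \<xi>')" "(m, \<xi>') \<in> tangent_bundle n sc A"
    using assms(1) unfolding fiber_def by (cases \<xi>) simp
  then have "\<xi>' c \<in> tset n {cmap c m}"
    using assms(2,3) unfolding tangent_bundle_def by blast
  with \<xi>'(1) show "fst \<xi> = m" "snd \<xi> c \<in> tset n (cimg c)"
    using assms by (auto simp: tset_iff)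
qed

lemma fiberwise_linear_reindex:
  assumes conn: "\<And>c. c \<in> A \<Longrightarrow> chart_connection sc (cimg c) (christoffel sc A L c)"
    and \<phi>: "index_map (k + 2) (k + 2) \<phi>"
    and eq: "\<And>c. c \<in> A \<Longrightarrow> chart_connection.equivariant sc (cimg c) (christoffel sc A L c) k
      (reindex (k + 2) (k + 2) \<phi>)"
  shows "fiberwise_linear (tangent_bundle (k + 2) sc A) (derived_struct k sc A L)
    (in_charts A (\<lambda>c. reindex (k + 2) (k + 2) \<phi>))"
  unfolding fiberwise_linear_def
proof (intro allI ballI conjI)
  fix m \<xi> assume \<xi>: "\<xi> \<in> fiber (tangent_bundle (k + 2) sc A) m"
  have fst: "fst \<zeta> = m" if "\<zeta> \<in> fiber (tangent_bundle (k + 2) sc A) m" for \<zeta>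
    using that by (simp add: fiber_def)
  note defs = derived_struct_def push_forward_def A_struct_def Phi_def Phi_inv_def in_charts_def in_charts2_def
  show "in_charts A (\<lambda>c. reindex (k + 2) (k + 2) \<phi>) (ladd (derived_struct k sc A L) \<xi> \<eta>) =
      ladd (derived_struct k sc A L) (in_charts A (\<lambda>c. reindex (k + 2) (k + 2) \<phi>) \<xi>)
        (in_charts A (\<lambda>c. reindex (k + 2) (k + 2) \<phi>) \<eta>)"
    if \<eta>: "\<eta> \<in> fiber (tangent_bundle (k + 2) sc A) m" for \<eta>
  proof -
    have "reindex (k + 2) (k + 2) \<phi> (Phi_chart k sc (cimg c) (christoffel sc A L c)
        (ladd (chart_struct (k + 2) sc)
          (inv_into (tset (k + 2) (cimg c)) (Phi_chart k sc (cimg c) (christoffel sc A L c)) (snd \<xi> c))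
          (inv_into (tset (k + 2) (cimg c)) (Phi_chart k sc (cimg c) (christoffel sc A L c)) (snd \<eta> c)))) =
      Phi_chart k sc (cimg c) (christoffel sc A L c)
        (ladd (chart_struct (k + 2) sc)
          (inv_into (tset (k + 2) (cimg c)) (Phi_chart k sc (cimg c) (christoffel sc A L c))
            (reindex (k + 2) (k + 2) \<phi> (snd \<xi> c)))
          (inv_into (tset (k + 2) (cimg c)) (Phi_chart k sc (cimg c) (christoffel sc A L c))
            (reindex (k + 2) (k + 2) \<phi> (snd \<eta> c))))"
      if c: "c \<in> A" "m \<in> cdom c" for c
      using chart_connection.push_forward_linear(1)[OF conn[OF c(1)] \<phi> eq[OF c(1)]
          bundle_chart_expression(2)[OF \<xi> c] bundle_chart_expression(2)[OF \<eta> c]]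
      unfolding chart_connection.\<Phi>_inv_def[OF conn[OF c(1)]] .
    then show ?thesis using fst[OF \<xi>] fst[OF \<eta>] by (auto simp: defs fun_eq_iff)
  qed
  show "in_charts A (\<lambda>c. reindex (k + 2) (k + 2) \<phi>) (lscale (derived_struct k sc A L) t \<xi>) =
      lscale (derived_struct k sc A L) t (in_charts A (\<lambda>c. reindex (k + 2) (k + 2) \<phi>) \<xi>)" for t
  proof -
    have "reindex (k + 2) (k + 2) \<phi> (Phi_chart k sc (cimg c) (christoffel sc A L c)
        (lscale (chart_struct (k + 2) sc) t
          (inv_into (tset (k + 2) (cimg c)) (Phi_chart k sc (cimg c) (christoffel sc A L c)) (snd \<xi> c)))) =
      Phi_chart k sc (cimg c) (christoffel sc A L c)
        (lscale (chart_struct (k + 2) sc) t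
          (inv_into (tset (k + 2) (cimg c)) (Phi_chart k sc (cimg c) (christoffel sc A L c))
            (reindex (k + 2) (k + 2) \<phi> (snd \<xi> c))))"
      if c: "c \<in> A" "m \<in> cdom c" for c
      using chart_connection.push_forward_linear(2)[OF conn[OF c(1)] \<phi> eq[OF c(1)]
          bundle_chart_expression(2)[OF \<xi> c]]
      unfolding chart_connection.\<Phi>_inv_def[OF conn[OF c(1)]] .
    then show ?thesis using fst[OF \<xi>] by (auto simp: defs fun_eq_iff)
  qed
qed

section \<open>Flat connections\<close>

lemma chart_connection_christoffel:
  fixes sc :: "'k::base_ring \<Rightarrow> 'v::{topological_ab_group_add,t2_space} \<Rightarrow> 'v"
    and A :: "('m::topological_space, 'v) chart set"
  assumes "topological_module sc" "smooth_atlas sc A" "linear_connection sc A L" "c \<in> A"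
  shows "chart_connection sc (cimg c) (christoffel sc A L c)"
proof -
  interpret topological_module sc by fact
  have "is_christoffel sc A L c (christoffel sc A L c)"
    unfolding christoffel_def
    by (rule someI_ex[of "is_christoffel sc A L c"]) (use assms(3,4) in \<open>auto simp: linear_connection_def\<close>)
  then show ?thesis
    using open_cimg[OF assms(2,4)] by unfold_locales (auto simp: is_christoffel_def)
qed

text \<open>
  Every point of \<open>T\<^sup>3U\<close> is the expression of a point of \<open>T\<^sup>3M\<close>, so in each chart the curvature
  operators are identities: \<open>\<tau> \<circ> \<Phi> \<circ> \<tau>\<^sup>-\<^sup>1 = \<Phi>\<close> for all permutations \<open>\<tau>\<close>, here with \<open>\<tau> = \<sigma>\<^sup>-\<^sup>1\<close>.
\<close>

lemma flat_chart:
  fixes sc :: "'k::base_ring \<Rightarrow> 'v::{topological_ab_group_add,t2_space} \<Rightarrow> 'v"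
    and A :: "('m::topological_space, 'v) chart set"
  assumes tm: "topological_module sc" and atlas: "smooth_atlas sc A"
    and L: "linear_connection sc A L"
    and flat: "curvature_forms_vanish sc A L" and c: "c \<in> A" and \<sigma>: "\<sigma> permutes {..<3}"
  shows "chart_connection.equivariant sc (cimg c) (christoffel sc A L c) 1 (perm_chart 3 \<sigma>)"
proof -
  interpret chart_connection sc "cimg c" "christoffel sc A L c"
    by (rule chart_connection_christoffel[OF tm atlas L c])
  have N: "1 + 2 = (3::nat)" by simp
  show ?thesis
    unfolding equivariant_def N
  proof
    fix p :: "('k, 'v) tm" assume p: "p \<in> tset 3 (cimg c)"
    \<comment> \<open>at \<open>q\<close> the inverse of \<open>\<Phi>\<close> in the curvature operator cancels\<close>
    define q where "q = \<Phi> 1 p"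
    have \<sigma>p: "perm_chart 3 \<sigma> p \<in> tset 3 (cimg c)" by (rule perm_chart_tset[OF \<sigma> p])
    have q: "q \<in> tset 3 (cimg c)" unfolding q_def using Phi_tset[of p 1, unfolded N, OF p] .
    then obtain m where m: "m \<in> cdom c" "q \<in> tset 3 {cmap c m}" by (auto simp: tset_iff)
    obtain \<xi> where \<xi>: "(m, \<xi>) \<in> tangent_bundle 3 sc A" "\<xi> c = q"
      using point_of_chart_expression[OF atlas c m] .
    have inv: "inv \<sigma> permutes {..<3}" by (rule permutes_inv[OF \<sigma>])
    have "curvature_operator sc A L (inv \<sigma>) (m, \<xi>) = (m, \<xi>)"
      using flat inv \<xi>(1) unfolding curvature_forms_vanish_def by blast
    then have "snd (curvature_operator sc A L (inv \<sigma>) (m, \<xi>)) c = q" using \<xi>(2) by simp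
    then have "perm_chart 3 (inv \<sigma>) (\<Phi> 1 (perm_chart 3 \<sigma> (\<Phi>_inv 1 q))) = q"
      using c m(1) \<xi>(2)
      by (simp add: curvature_operator_def perm_action_def Phi_def Phi_inv_def in_charts_def \<Phi>_inv_def
          permutes_inv_inv[OF \<sigma>])
    then have "perm_chart 3 \<sigma> (perm_chart 3 (inv \<sigma>) (\<Phi> 1 (perm_chart 3 \<sigma> p))) = perm_chart 3 \<sigma> (\<Phi> 1 p)"
      using Phi_inverse(1)[of p 1, unfolded N, OF p] by (simp add: q_def)
    moreover have "perm_chart 3 \<sigma> (perm_chart 3 (inv \<sigma>) y) = y" if "y \<in> tset 3 (cimg c)" for y :: "('k, 'v) tm"
      using perm_chart_comp[OF \<sigma> inv, of y] perm_chart_id[OF subsetD[OF tset_subset that]]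
      by (simp add: permutes_inv_o[OF \<sigma>])
    ultimately show "\<Phi> 1 (perm_chart 3 \<sigma> p) = perm_chart 3 \<sigma> (\<Phi> 1 p)"
      using Phi_tset[of _ 1, unfolded N, OF \<sigma>p] by simp
  qed
qed

theorem theorem20p7:
  fixes sc :: "'k::base_ring \<Rightarrow> 'v::{topological_ab_group_add,t2_space} \<Rightarrow> 'v"
    and A :: "('m::topological_space, 'v) chart set"
    and L :: "('k, ('k, 'm, 'v) tpt) lin_struct"
  assumes "topological_module sc"
    and "smooth_atlas sc A"
    and "linear_connection sc A L"
    and "flat_connection sc A L"
  shows "\<forall>k. totally_symmetric (k + 2) sc A (derived_struct k sc A L) \<and>
             shift_invariant (k + 2) sc A (derived_struct k sc A L)"
proof
  fix k
  have torsion: "torsionfree sc A L" and curv: "curvature_forms_vanish sc A L"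
    using assms(4) by (auto simp: flat_connection_def)
  have conn: "chart_connection sc (cimg c) (christoffel sc A L c)" if "c \<in> A" for c
    by (rule chart_connection_christoffel[OF assms(1-3) that])
  have perm: "chart_connection.equivariant sc (cimg c) (christoffel sc A L c) k (perm_chart (k + 2) \<sigma>)"
    if c: "c \<in> A" and \<sigma>: "\<sigma> permutes {..<k + 2}" for c \<sigma>
  proof (rule chart_connection.equivariant_perm[OF conn[OF c] _ _ \<sigma>])
    show "christoffel sc A L c x u v = christoffel sc A L c x v u" if "x \<in> cimg c" for x u v
      using torsion c that unfolding torsionfree_def by blast
    show "chart_connection.equivariant sc (cimg c) (christoffel sc A L c) 1 (perm_chart 3 \<sigma>)"
      if "\<sigma> permutes {..<3}" for \<sigma>
      by (rule flat_chart[OF assms(1-3) curv c that])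
  qed
  have "totally_symmetric (k + 2) sc A (derived_struct k sc A L)"
    unfolding totally_symmetric_def perm_action_def
  proof (intro allI impI)
    fix \<sigma> assume \<sigma>: "\<sigma> permutes {..<k + 2}"
    show "fiberwise_linear (tangent_bundle (k + 2) sc A) (derived_struct k sc A L)
        (in_charts A (\<lambda>c. perm_chart (k + 2) \<sigma>))"
      using fiberwise_linear_reindex[OF conn index_map_perm[OF \<sigma>]] perm[OF _ \<sigma>]
      by (simp add: perm_chart_reindex)
  qed
  moreover have "shift_invariant (k + 2) sc A (derived_struct k sc A L)"
    unfolding shift_invariant_def shift_def
  proof (intro allI impI)
    fix i j assume ij: "i < k + 2" "j < k + 2" "i \<noteq> j"
    show "fiberwise_linear (tangent_bundle (k + 2) sc A) (derived_struct k sc A L)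
        (in_charts A (\<lambda>c. shift_chart (k + 2) i j))"
      using fiberwise_linear_reindex[OF conn index_map_shift[OF ij(3)]]
        chart_connection.equivariant_shift[OF conn perm ij]
      by (simp add: shift_chart_reindex)
  qed
  ultimately show "totally_symmetric (k + 2) sc A (derived_struct k sc A L) \<and>
      shift_invariant (k + 2) sc A (derived_struct k sc A L)" ..
qed

end
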